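(* Let $\mathcal{A}$ be a simplicial arrangement of $n$ pseudolines in $\mathbb{P}^2(\mathbb{R})$ which is not a near pencil, whose characteristic polynomial $\chi(\mathcal{A},t)$ has only real roots, and with $m(\mathcal{A})\leq 6$. Then $$\frac{(n-5)^2 +44}{16} \leq t_2 \leq \frac{(n+1)^2}{16},$$ $$\frac{n^2-22n+185}{24} \leq t_3 \leq \frac{n^2+116 n -597}{24},$$ $$t_4 + t_5 \leq \frac{3}{2} n - \frac{17}{2},$$ $$\frac{n^2-46n+225}{48} \leq t_6 \leq \frac{n^2+2n-47}{48}.$$
   Context: An arrangement of pseudolines is a finite set $\mathcal{A}=\{\ell_1,\dots,\ell_n\}$ of $n\geq 3$ smooth closed curves in $\mathbb{P}^2(\mathbb{R})$ that do not intersect themselves, any two distinct of which meet transversally in exactly one point, and which do not all pass through a common point. It induces a cell decomposition of $\mathbb{P}^2(\mathbb{R})$ whose $2$-cells are chambers. The weight of a point is the number of pseudolines through it; $t_i$ is the number of points of weight exactly $i$; the multiplicity $m(\mathcal{A})$ is the largest $j$ with $t_j>0$. $\mathcal{A}$ is simplicial if every chamber is bounded by exactly three pseudolines; it is a near pencil if $t_2=n-1$ and $t_{n-1}=1$. The intersection lattice $L$ consists of $\emptyset$ (rank $0$), the singletons $\{i\}$ (rank $1$), the sets $I_v=\{i: v\in\ell_i\}$ for points $v$ with $|I_v|\ge 2$ (rank $2$), and $\{1,\dots,n\}$ (rank $3$), ordered by inclusion; $\chi(\mathcal{A},t)=\sum_{X\in L}\mu(\emptyset,X)\,t^{3-\operatorname{rank}(X)}$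 with $\mu$ the Möbius function of $L$.
   Formalization: An arrangement of n = 3 pseudolines is counted as a near pencil and so excluded; by the literal definition it is not one, and the claim fails there: three generic lines have t_2 = 3 > (3+1)^2/16 = 1. *)

theory Defs
  imports "HOL-Analysis.Analysis" "HOL-Computational_Algebra.Polynomial"
begin

section \<open>The real projective plane\<close>

typedef proj_plane = "{S :: (real ^ 3) set. subspace S \<and> dim S = 1}"
  morphisms line_of Abs_proj_plane
proof -
  have "dim (span {axis 1 1 :: real ^ 3}) = 1"
    by (simp add: dim_singleton axis_eq_0_iff)
  then show ?thesis
    by (metis (mono_tags, lifting) mem_Collect_eq subspace_span)
qed

text \<open>The point with homogeneous coordinates \<open>v\<close>; meaningful for nonzero \<open>v\<close> only.\<close>

definition proj :: "real ^ 3 \<Rightarrow> proj_plane" where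
  "proj v = Abs_proj_plane (span {v})"

text \<open>The topology is the quotient topology of the nonzero vectors under the projection.\<close>

instantiation proj_plane :: topological_space
begin

definition open_proj_plane :: "proj_plane set \<Rightarrow> bool" where
  "open_proj_plane U \<longleftrightarrow> open {v. v \<noteq> 0 \<and> proj v \<in> U}"

instance
proof
  have "{v :: real ^ 3. v \<noteq> 0 \<and> proj v \<in> UNIV} = - {0}"
    by auto
  then show "open (UNIV :: proj_plane set)"
    by (simp add: open_proj_plane_def open_Compl)
next
  fix S T :: "proj_plane set"
  assume "open S" "open T"
  moreover have "{v. v \<noteq> 0 \<and> proj v \<in> S \<inter> T} =
      {v. v \<noteq> 0 \<and> proj v \<in> S} \<inter> {v. v \<noteq> 0 \<and> proj v \<in> T}"
    by auto
  ultimately show "open (S \<inter> T)"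
    by (simp add: open_proj_plane_def open_Int)
next
  fix K :: "proj_plane set set"
  assume "\<forall>S\<in>K. open S"
  moreover have "{v. v \<noteq> 0 \<and> proj v \<in> \<Union>K} = (\<Union>S\<in>K. {v. v \<noteq> 0 \<and> proj v \<in> S})"
    by auto
  ultimately show "open (\<Union>K)"
    by (simp add: open_proj_plane_def open_UN)
qed

end

section \<open>Arrangements of pseudolines\<close>

definition smooth :: "(real \<Rightarrow> real ^ 3) \<Rightarrow> bool" where
  "smooth f \<longleftrightarrow> (\<forall>k t. ((\<lambda>g t. vector_derivative g (at t)) ^^ k) f differentiable (at t))"

text \<open>
  A smooth closed curve is a 1-periodic smooth map from the reals to the projective plane. It is
  given by a lift \<open>f\<close> to nonzero vectors, which exists globally because the reals are simply
  connected; only the projection of \<open>f\<close> is required to be periodic (in fact a lift to the unit sphere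
  changes sign after one period exactly if the curve is not contractible). The velocity of the
  projected curve at \<open>t\<close> is the class of \<open>f' t\<close> modulo the line spanned by \<open>f t\<close>, so the third
  conjunct says that the curve is regular. The fourth one says that the curve closes up
  after one period and does not intersect itself.
\<close>

definition parametrizes :: "(real \<Rightarrow> real ^ 3) \<Rightarrow> proj_plane set \<Rightarrow> bool" where
  "parametrizes f l \<longleftrightarrow>
     smooth f \<and>
     (\<forall>t. f t \<noteq> 0) \<and>
     (\<forall>t. vector_derivative f (at t) \<notin> span {f t}) \<and>
     (\<forall>s t. proj (f s) = proj (f t) \<longleftrightarrow> s - t \<in> \<int>) \<and>
     l = range (\<lambda>t. proj (f t))"

definition simple_smooth_closed_curve :: "proj_plane set \<Rightarrow> bool" where
  "simple_smooth_closed_curve l \<longleftrightarrow> (\<exists>f. parametrizes f l)"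

text \<open>
  The tangent line at the parameter \<open>t\<close>, as a plane in the space of homogeneous coordinates. It
  depends neither on the lift nor on the regular parametrization.
\<close>

definition tangent :: "(real \<Rightarrow> real ^ 3) \<Rightarrow> real \<Rightarrow> (real ^ 3) set" where
  "tangent f t = span {f t, vector_derivative f (at t)}"

definition transversal_at :: "proj_plane set \<Rightarrow> proj_plane set \<Rightarrow> proj_plane \<Rightarrow> bool" where
  "transversal_at l l' p \<longleftrightarrow>
     (\<exists>f g s t. parametrizes f l \<and> parametrizes g l' \<and> proj (f s) = p \<and> proj (g t) = p \<and>
        tangent f s \<noteq> tangent g t)"

definition pseudoline_arrangement :: "proj_plane set set \<Rightarrow> bool" where
  "pseudoline_arrangement A \<longleftrightarrow>
     finite A \<and> card A \<ge> 3 \<and>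
     (\<forall>l\<in>A. simple_smooth_closed_curve l) \<and>
     (\<forall>l\<in>A. \<forall>l'\<in>A. l \<noteq> l' \<longrightarrow> (\<exists>p. l \<inter> l' = {p} \<and> transversal_at l l' p)) \<and>
     \<Inter>A = {}"

definition through :: "proj_plane set set \<Rightarrow> proj_plane \<Rightarrow> proj_plane set set" where
  "through A v = {l \<in> A. v \<in> l}"

definition weight :: "proj_plane set set \<Rightarrow> proj_plane \<Rightarrow> nat" where
  "weight A v = card (through A v)"

text \<open>
  For \<open>i < 2\<close> the set is infinite and its cardinality is 0 by convention. This is harmless:
  an arrangement has points of weight at least 2, so the multiplicity is not affected.
\<close>

definition num_points :: "proj_plane set set \<Rightarrow> nat \<Rightarrow> nat" where
  "num_points A i = card {v. weight A v = i}"

definition multiplicity :: "proj_plane set set \<Rightarrow> nat" where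
  "multiplicity A = Max {j. num_points A j > 0}"

section \<open>The cell decomposition\<close>

definition vertices :: "proj_plane set set \<Rightarrow> proj_plane set" where
  "vertices A = {v. weight A v \<ge> 2}"

definition chambers :: "proj_plane set set \<Rightarrow> proj_plane set set" where
  "chambers A = components (- \<Union>A)"

text \<open>
  A pseudoline bounds a chamber if one of its 1-cells lies on the boundary of the chamber; passing
  through a vertex of the chamber is not enough.
\<close>

definition bounds :: "proj_plane set set \<Rightarrow> proj_plane set \<Rightarrow> proj_plane set \<Rightarrow> bool" where
  "bounds A l C \<longleftrightarrow> (\<exists>e \<in> components (l - vertices A). e \<subseteq> frontier C)"

definition simplicial :: "proj_plane set set \<Rightarrow> bool" where
  "simplicial A \<longleftrightarrow> (\<forall>C \<in> chambers A. card {l \<in> A. bounds A l C} = 3)"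

text \<open>
  For \<open>n = 3\<close> both equations would speak about \<open>t\<^sub>2\<close> and contradict each other. Three pseudolines
  without a common point consist of a pencil of two pseudolines and a third pseudoline, so they
  count as the smallest near pencil (with \<open>t\<^sub>2 = 3\<close>).
\<close>

definition near_pencil :: "proj_plane set set \<Rightarrow> bool" where
  "near_pencil A \<longleftrightarrow>
     (num_points A 2 = card A - 1 \<and> num_points A (card A - 1) = 1) \<or> card A = 3"

section \<open>The intersection lattice and the characteristic polynomial\<close>

text \<open>The Moebius function of a finite set \<open>L\<close> with the order of the type; 0 outside of \<open>L\<close>.\<close>

function moebius :: "'a::order set \<Rightarrow> 'a \<Rightarrow> 'a \<Rightarrow> int" where
  "moebius L x y =
     (if finite L \<and> x \<in> L \<and> y \<in> L \<and> x \<le> y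
      then if x = y then 1 else - (\<Sum>z\<in>{z \<in> L. x \<le> z \<and> z < y}. moebius L x z)
      else 0)"
  by pat_completeness auto
termination
proof (relation "Wellfounded.measure (\<lambda>(L, x, y). card {z \<in> L. z < y})")
  fix L :: "'a set" and x y z
  assume *: "finite L \<and> x \<in> L \<and> y \<in> L \<and> x \<le> y" "z \<in> {z \<in> L. x \<le> z \<and> z < y}"
  then have "{w \<in> L. w < z} \<subset> {w \<in> L. w < y}"
    by force
  with * show "((L, x, z), (L, x, y)) \<in> Wellfounded.measure (\<lambda>(L, x, y). card {z \<in> L. z < y})"
    by (simp add: psubset_card_mono)
qed simp

declare moebius.simps [simp del]

text \<open>The pseudolines themselves serve as labels, instead of numbers from 1 to \<open>n\<close>.\<close>

definition intersection_lattice :: "proj_plane set set \<Rightarrow> proj_plane set set set" where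
  "intersection_lattice A =
     {{}} \<union> {{l} | l. l \<in> A} \<union> {through A v | v. card (through A v) \<ge> 2} \<union> {A}"

definition lattice_rank :: "proj_plane set set \<Rightarrow> proj_plane set set \<Rightarrow> nat" where
  "lattice_rank A X =
     (if X = {} then 0
      else if \<exists>l\<in>A. X = {l} then 1
      else if \<exists>v. X = through A v then 2
      else 3)"

definition characteristic_poly :: "proj_plane set set \<Rightarrow> int poly" where
  "characteristic_poly A =
     (\<Sum>X\<in>intersection_lattice A.
        monom (moebius (intersection_lattice A) {} X) (3 - lattice_rank A X))"

definition only_real_roots :: "int poly \<Rightarrow> bool" where
  "only_real_roots p \<longleftrightarrow> (\<forall>z :: complex. poly (map_poly of_int p) z = 0 \<longrightarrow> z \<in> \<real>)"

end

theory Submission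
  imports Defs "HOL-Complex_Analysis.Riemann_Mapping"
begin

text \<open>
  Lift everything to the unit sphere. Because it crosses another pseudoline transversally in a single
  point, a pseudoline lifts to one centrally symmetric Jordan curve; a winding number argument shows
  that the antipodal map exchanges its two sides. So every pseudoline has an odd side function, and by
  Janiszewski's theorem the set of points with a prescribed sign vector is connected. Chambers are
  therefore counted by sign vectors, and deletion of one pseudoline at a time gives
  \<open>f\<^sub>2 = 1 + \<Sum>\<^sub>v (w(v) - 1)\<close>. In a simplicial arrangement \<open>3 f\<^sub>2 = 2 f\<^sub>1\<close>, which yields
  \<open>t\<^sub>2 = 3 + t\<^sub>4 + 2 t\<^sub>5 + 3 t\<^sub>6\<close>, and a chamber with two double points forces a near pencil, so
  \<open>4 t\<^sub>2 \<le> f\<^sub>2\<close>. The roots of the characteristic polynomial are real only if \<open>4 f\<^sub>2 \<le> (n + 1)\<^sup>2\<close>.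
  Together with \<open>\<Sum>\<^sub>v w(v) (w(v) - 1) = n (n - 1)\<close> these relations are linear in the \<open>t\<^sub>i\<close> and imply
  the bounds.
\<close>

section \<open>Stereographic projection and separation of the sphere\<close>

text \<open>In the projective plane a pseudoline has no sides, so signs exist only on the sphere.
  There chambers, edges and vertices all appear twice, which explains the factors:
  \<open>card (topes A)\<close> is twice the number of chambers, and a double point accounts for 8
  topes instead of 4. Smoothness serves a single purpose. A simple closed curve could be
  contractible, with a lift that closes up after one period; transversality excludes this.
  Afterwards the notion \<open>antipodal_curve\<close> and the single common point suffice: that two
  curves really cross is recovered from oddness, since along one curve the sign of another flips
  after every period. The main obstacle is that different components might share a sign vector.
  Connectedness of all regions removes it, and oddness again drives the induction: two lunes in one
  closed side always have a common point, because one of two antipodal points lies on the required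
  side.\<close>

abbreviation unit_sphere :: "(real ^ 3) set" ("\<S>") where "\<S> \<equiv> sphere 0 1"

declare mem_sphere [simp del] mem_sphere_0 [simp del]

lemma minus_in_sphere_iff [simp]: "- x \<in> \<S> \<longleftrightarrow> x \<in> \<S>"
  by (simp add: mem_sphere_0)

lemma sphere_neq_minus [simp]: "x \<in> \<S> \<Longrightarrow> - x \<noteq> x" "x \<in> \<S> \<Longrightarrow> x \<noteq> - x"
proof -
  have "x \<noteq> 0 \<Longrightarrow> - x \<noteq> x"
    by (auto simp: vec_eq_iff)
  then show "x \<in> \<S> \<Longrightarrow> - x \<noteq> x" "x \<in> \<S> \<Longrightarrow> x \<noteq> - x"
    by (metis mem_sphere_0 norm_zero zero_neq_one)+
qed

text \<open>The product formula holds because \<open>(1 - x $ 3) * (1 + x $ 3)\<close> is the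
  squared length of the horizontal part of \<open>x\<close>. At \<open>x = - N\<close> the value
  \<open>h N\<close>, a division by zero, is harmless since \<open>h x = 0\<close>.\<close>

lemma stereographic_north:
  defines "N \<equiv> axis 3 1 :: real ^ 3"
  obtains h :: "real ^ 3 \<Rightarrow> complex" and k where
    "homeomorphism (\<S> - {N}) UNIV h k" "h (- N) = 0"
    "\<And>x. x \<in> \<S> - {N} \<Longrightarrow> h x * cnj (h (- x)) = (if x = - N then 0 else - 1)"
proof -
  define h where "h x = Complex (x $ 1 / (1 - x $ 3)) (x $ 2 / (1 - x $ 3))" for x :: "real ^ 3"
  define k where "k z = (vector [2 * Re z / ((cmod z)\<^sup>2 + 1), 2 * Im z / ((cmod z)\<^sup>2 + 1),
      ((cmod z)\<^sup>2 - 1) / ((cmod z)\<^sup>2 + 1)] :: real ^ 3)" for z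
  have S: "x \<in> \<S> \<longleftrightarrow> (x $ 1)\<^sup>2 + (x $ 2)\<^sup>2 + (x $ 3)\<^sup>2 = 1" for x :: "real ^ 3"
    by (simp add: mem_sphere_0 norm_vec_def L2_set_def sum_3)
  have N: "N $ 1 = 0" "N $ 2 = 0" "N $ 3 = 1"
    by (simp_all add: N_def axis_def)
  have ne: "x $ 3 \<noteq> 1" if "x \<in> \<S>" "x \<noteq> N" for x :: "real ^ 3"
  proof
    assume "x $ 3 = 1"
    then have "x $ 1 = 0 \<and> x $ 2 = 0"
      using that S[of x] by (simp only: S) (simp add: sum_power2_eq_zero_iff)
    then show False
      using that \<open>x $ 3 = 1\<close> by (simp add: vec_eq_iff forall_3 N)
  qed
  have pos: "(cmod z)\<^sup>2 + 1 \<noteq> 0" for z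
    by (metis add_nonneg_pos less_numeral_extra(1,3) zero_le_power2)
  have kS: "k z \<in> \<S> - {N}" for z
  proof -
    let ?m = "(cmod z)\<^sup>2"
    have "(2 * Re z)\<^sup>2 + (2 * Im z)\<^sup>2 + (?m - 1)\<^sup>2 = (?m + 1)\<^sup>2"
      by (simp add: cmod_def power2_eq_square algebra_simps)
    then have "k z \<in> \<S>"
      using pos[of z] unfolding S k_def
      by (simp add: power_divide add_divide_distrib[symmetric])
    moreover have "k z $ 3 \<noteq> 1"
      using pos[of z] by (simp add: k_def divide_eq_eq)
    ultimately show ?thesis
      using N by auto
  qed
  have hk: "h (k z) = z" for z
  proof -
    have e: "1 - k z $ 3 = 2 / ((cmod z)\<^sup>2 + 1)"
      using pos[of z] by (simp add: k_def field_simps)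
    have "h (k z) = Complex (Re z) (Im z)"
      unfolding h_def e using pos[of z] by (simp add: k_def)
    then show ?thesis by simp
  qed
  have hm: "(cmod (h x))\<^sup>2 = (1 + x $ 3) / (1 - x $ 3)" if "x \<in> \<S>" "x \<noteq> N" for x
  proof -
    have "(cmod (h x))\<^sup>2 = ((x $ 1)\<^sup>2 + (x $ 2)\<^sup>2) / (1 - x $ 3)\<^sup>2"
      by (simp add: h_def cmod_def power_divide add_divide_distrib)
    also have "(x $ 1)\<^sup>2 + (x $ 2)\<^sup>2 = (1 - x $ 3) * (1 + x $ 3)"
      using that S[of x] by (simp add: algebra_simps power2_eq_square)
    finally show ?thesis
      using ne[OF that] by (simp add: power2_eq_square)
  qed
  have kh: "k (h x) = x" if "x \<in> \<S>" "x \<noteq> N" for x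
  proof -
    have n: "1 - x $ 3 \<noteq> 0"
      using ne[OF that] by simp
    have p: "(cmod (h x))\<^sup>2 + 1 = 2 / (1 - x $ 3)" "(cmod (h x))\<^sup>2 - 1 = 2 * x $ 3 / (1 - x $ 3)"
      using n by (simp_all add: hm[OF that] field_simps)
    show ?thesis
      unfolding k_def p vec_eq_iff forall_3 using n by (simp add: h_def)
  qed
  show thesis
  proof
    show "homeomorphism (\<S> - {N}) UNIV h k"
    proof (rule homeomorphismI)
      show "continuous_on (\<S> - {N}) h"
        unfolding h_def Complex_eq
        by (intro continuous_intros) (use ne in auto)
      show "continuous_on UNIV k"
      proof (rule continuous_on_vec_lambda[of UNIV "\<lambda>i z. k z $ i", simplified])
        fix i :: 3
        consider "i = 1" | "i = 2" | "i = 3"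
          using exhaust_3 by blast
        then show "continuous_on UNIV (\<lambda>z. k z $ i)"
          by cases (auto simp: k_def pos intro!: continuous_intros)
      qed
    qed (use kS hk kh in auto)
    show "h (- N) = 0"
      by (simp add: h_def N zero_complex.code)
    fix x assume x: "x \<in> \<S> - {N}"
    show "h x * cnj (h (- x)) = (if x = - N then 0 else - 1)"
    proof (cases "x = - N")
      case True
      then show ?thesis by (simp add: h_def N zero_complex.code)
    next
      case False
      then have "- x \<noteq> N" by auto
      then have n: "1 - x $ 3 \<noteq> 0" "1 + x $ 3 \<noteq> 0"
        using ne[of x] ne[of "- x"] x by auto
      have "(x $ 1)\<^sup>2 + (x $ 2)\<^sup>2 = (1 - x $ 3) * (1 + x $ 3)"
        using x S[of x] by (simp add: algebra_simps power2_eq_square)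
      then have "x $ 1 * x $ 1 / ((1 - x $ 3) * (1 + x $ 3)) + x $ 2 * x $ 2 / ((1 - x $ 3) * (1 + x $ 3)) = 1"
        using n by (simp add: power2_eq_square add_divide_distrib[symmetric])
      then show ?thesis
        using False by (simp add: h_def complex_eq_iff algebra_simps)
    qed
  qed
qed

text \<open>An orthogonal map carries \<open>c\<close> to the north pole; being linear it commutes
  with the antipodal map, so the product formula is inherited.\<close>

lemma stereographic:
  assumes "c \<in> \<S>"
  obtains h :: "real ^ 3 \<Rightarrow> complex" and k where
    "homeomorphism (\<S> - {c}) UNIV h k" "h (- c) = 0"
    "\<And>x. x \<in> \<S> - {c, - c} \<Longrightarrow> h x * cnj (h (- x)) = - 1"
proof -
  let ?N = "axis 3 1 :: real ^ 3"
  obtain h k where hk: "homeomorphism (\<S> - {?N}) UNIV h k" "h (- ?N) = 0"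
    "\<And>x. x \<in> \<S> - {?N} \<Longrightarrow> h x * cnj (h (- x)) = (if x = - ?N then 0 else - 1)"
    using stereographic_north by metis
  obtain f where f: "orthogonal_transformation f" "f c = ?N"
    using orthogonal_transformation_exists_1[of c ?N] assms by (auto simp: norm_axis_1 mem_sphere_0)
  have lin: "linear f" "linear (inv f)" "bij f" 
    using f(1) orthogonal_transformation_linear orthogonal_transformation_inv orthogonal_transformation_bij 
    by blast+
  have nf: "f x \<in> \<S> \<longleftrightarrow> x \<in> \<S>" for x
    using f(1) by (simp add: orthogonal_transformation mem_sphere_0)
  have fi: "f (inv f y) = y" "inv f (f x) = x" for x y
    using lin(3) by (simp_all add: bij_is_inj bij_is_surj surj_f_inv_f)
  have ni: "inv f x \<in> \<S> \<longleftrightarrow> x \<in> \<S>" for x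
    using nf fi by metis
  have "homeomorphism (\<S> - {c}) (\<S> - {?N}) f (inv f)"
    by (rule homeomorphismI)
      (use linear_continuous_on[OF linear_conv_bounded_linear[THEN iffD1, OF lin(1)]]
        linear_continuous_on[OF linear_conv_bounded_linear[THEN iffD1, OF lin(2)]] f(2) fi in \<open>auto simp: nf ni, metis+\<close>)
  then have hom: "homeomorphism (\<S> - {c}) UNIV (h \<circ> f) (inv f \<circ> k)"
    using hk(1) homeomorphism_compose by blast
  have fm: "f (- x) = - f x" for x
    using lin(1) linear_neg by blast
  show thesis
  proof
    show "homeomorphism (\<S> - {c}) UNIV (h \<circ> f) (inv f \<circ> k)" by (fact hom)
    show "(h \<circ> f) (- c) = 0" by (simp add: fm f(2) hk(2))
    fix x assume x: "x \<in> \<S> - {c, - c}"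
    then have "f x \<in> \<S> - {?N}" "f x \<noteq> - ?N"
      using nf f(2) fi fm by (auto, metis, metis fi(2) fm minus_minus)
    then show "(h \<circ> f) x * cnj ((h \<circ> f) (- x)) = - 1"
      using hk(3)[of "f x"] by (simp add: fm)
  qed
qed

text \<open>Stereographic projection from \<open>c\<close> turns punctured neighbourhoods of
  \<open>c\<close> into neighbourhoods of infinity, and the complement of a large disc in the plane
  is connected.\<close>

lemma punctured_cap:
  assumes "openin (top_of_set \<S>) U" "c \<in> U"
  obtains D where "D \<subseteq> U - {c}" "connected D" "D \<noteq> {}" "openin (top_of_set \<S>) (insert c D)"
proof -
  have c: "c \<in> \<S>"
    using openin_imp_subset[OF assms(1)] assms(2) by blast
  obtain h :: "real ^ 3 \<Rightarrow> complex" and k where hk: "homeomorphism (\<S> - {c}) UNIV h k"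
    using stereographic[OF c] by blast
  have "compact (\<S> - U)"
    using assms(1) by (intro closedin_compact[OF compact_sphere] closedin_diff) auto
  moreover have "continuous_on (\<S> - U) h"
    using hk assms(2) by (metis Diff_mono continuous_on_subset empty_subsetI homeomorphism_cont1 insert_subset order_refl)
  ultimately have "compact (h ` (\<S> - U))"
    using compact_continuous_image by blast
  then obtain r where r: "h ` (\<S> - U) \<subseteq> cball 0 r"
    using bounded_subset_ballD[OF compact_imp_bounded, of "h ` (\<S> - U)" 0] ball_subset_cball by (metis order_trans)
  let ?D = "k ` (- cball 0 r)"
  have kc: "continuous_on UNIV k" and kS: "range k = \<S> - {c}"
    using homeomorphism_cont1[OF hk] homeomorphism_cont2[OF hk] homeomorphism_image2[OF hk] by simp_all
  have hk': "h (k z) = z" for z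
    using hk by (simp add: homeomorphism_def)
  have sub: "?D \<subseteq> U - {c}"
  proof
    fix x assume "x \<in> ?D"
    then obtain z where z: "x = k z" "z \<notin> cball 0 r" by auto
    then have "x \<in> \<S> - {c}" using kS by auto
    moreover have "x \<in> U"
      using z r hk' \<open>x \<in> \<S> - {c}\<close> by (metis DiffD1 DiffI image_subset_iff)
    ultimately show "x \<in> U - {c}" by auto
  qed
  have con: "connected ?D"
    by (intro connected_continuous_image connected_complement_bounded_convex continuous_on_subset[OF kc]) auto
  have "(- cball (0::complex) r) \<noteq> {}"
    using not_bounded_UNIV[where 'a = complex] bounded_cball by (metis Compl_empty_eq double_compl)
  moreover have "insert c ?D = \<S> - k ` cball 0 r"
  proof -
    have "k ` (- cball 0 r) = range k - k ` cball 0 r"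
      by (metis (no_types, lifting) Compl_eq_Diff_UNIV hk' image_set_diff injI)
    then show ?thesis
      using kS c by auto
  qed
  moreover have "compact (k ` cball 0 r)"
    by (intro compact_continuous_image continuous_on_subset[OF kc]) auto
  moreover have "k ` cball 0 r \<subseteq> \<S>"
    using kS by blast
  ultimately show thesis
    using that[OF sub con] by (metis closed_subset compact_imp_closed image_is_empty openin_diff openin_subtopology_self)
qed

lemma sphere_in_closure_delete:
  assumes "openin (top_of_set \<S>) U" "c \<in> U"
  shows "c \<in> closure (U - {c})"
proof (rule ccontr)
  assume n: "c \<notin> closure (U - {c})"
  have "openin (top_of_set \<S>) (U \<inter> - closure (U - {c}))"
    using assms(1) by (simp add: openin_Int_open open_Compl)
  then obtain D where "D \<subseteq> U \<inter> - closure (U - {c}) - {c}" "D \<noteq> {}"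
    using punctured_cap[of "U \<inter> - closure (U - {c})" c] n assms(2) by (metis ComplI IntI)
  then show False
    using closure_subset[of "U - {c}"] by blast
qed

text \<open>If \<open>P\<close> and \<open>Q\<close> separated \<open>U - {c}\<close>, the connected
  cap \<open>D\<close> around \<open>c\<close> would lie in one of them, and adding \<open>c\<close>
  to that one would separate \<open>U\<close>.\<close>

lemma connected_delete_point_sphere:
  assumes "openin (top_of_set \<S>) U" "connected U"
  shows "connected (U - {c})"
proof (cases "c \<in> U")
  case True
  obtain D where D: "D \<subseteq> U - {c}" "connected D" "D \<noteq> {}" "openin (top_of_set \<S>) (insert c D)"
    using punctured_cap[OF assms(1) True] by metis
  have one: False
    if P: "openin (top_of_set \<S>) P" and Q: "openin (top_of_set \<S>) Q" "P \<union> Q = U - {c}" "P \<inter> Q = {}"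
      "Q \<noteq> {}" "D \<subseteq> P" for P Q
  proof -
    have "openin (top_of_set \<S>) (insert c P)"
      using openin_Un[OF P D(4)] that(6) by (metis Un_insert_right sup.absorb1)
    moreover have "insert c P \<union> Q = U" "insert c P \<inter> Q = {}"
      using True that by auto
    ultimately show False
      using assms Q(1) \<open>Q \<noteq> {}\<close> unfolding connected_openin_eq 
      by (metis Un_upper1 Un_upper2 insert_not_empty openin_subset_trans openin_imp_subset)
  qed
  have U: "openin (top_of_set \<S>) (U - {c})"
    by (simp add: assms(1) openin_delete)
  show ?thesis
    unfolding connected_openin_eq
  proof (rule notI, elim exE conjE)
    fix P Q assume PQ: "openin (top_of_set (U - {c})) P" "openin (top_of_set (U - {c})) Q"
      "P \<union> Q = U - {c}" "P \<inter> Q = {}" "P \<noteq> {}" "Q \<noteq> {}"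
    have o: "openin (top_of_set \<S>) P" "openin (top_of_set \<S>) Q"
      using PQ U openin_trans by blast+
    have "D \<subseteq> P \<or> D \<subseteq> Q"
    proof (rule ccontr)
      assume n: "\<not> ?thesis"
      obtain P' Q' where op: "open P'" "P = \<S> \<inter> P'" "open Q'" "Q = \<S> \<inter> Q'"
        using o unfolding openin_open by blast
      have "D \<subseteq> \<S>"
        using D(1) assms(1) openin_imp_subset by blast
      then have "P' \<inter> Q' \<inter> D = {}" "D \<subseteq> P' \<union> Q'" "P' \<inter> D \<noteq> {}" "Q' \<inter> D \<noteq> {}"
        using n D(1) PQ(3,4) op(2,4) by blast+
      then show False
        using connectedD[OF D(2) op(1,3)] by blast
    qed
    then show False
      using one[OF o] one[OF o(2) o(1)] PQ by blast
  qed
qed (use assms in simp)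

text \<open>Janiszewski's theorem transferred from the plane: projecting from a point
  \<open>c\<close> outside both sets makes their images compact. The point \<open>c\<close> itself
  is put back at the end, as it lies in the closure of the rest.\<close>

lemma connected_compl_union_sphere:
  assumes S: "closed S" "S \<subseteq> \<S>" and T: "closed T" "T \<subseteq> \<S>" and con: "connected (S \<inter> T)"
    and cS: "connected (\<S> - S)" and cT: "connected (\<S> - T)"
  shows "connected (\<S> - (S \<union> T))"
proof (cases "\<S> - (S \<union> T) = {}")
  case False
  let ?O = "\<S> - (S \<union> T)"
  obtain c where c: "c \<in> ?O" using False by blast
  have oO: "openin (top_of_set \<S>) ?O" "openin (top_of_set \<S>) (\<S> - S)" "openin (top_of_set \<S>) (\<S> - T)"
    using S T by (auto intro!: openin_diff closedin_Un closed_subset)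
  obtain h :: "real ^ 3 \<Rightarrow> complex" and k where hk: "homeomorphism (\<S> - {c}) UNIV h k"
    using stereographic[of c] c by blast
  have k: "continuous_on UNIV k" and kS: "range k = \<S> - {c}"
    using homeomorphism_cont1[OF hk] homeomorphism_cont2[OF hk] homeomorphism_image2[OF hk] by simp_all
  have h: "continuous_on (\<S> - {c}) h"
    using homeomorphism_cont1[OF hk] homeomorphism_cont2[OF hk] homeomorphism_image2[OF hk] by simp_all
  have hk': "h (k z) = z" for z
    using hk by (simp add: homeomorphism_def)
  have kh': "k (h x) = x" if "x \<in> \<S>" "x \<noteq> c" for x
    using hk that by (simp add: homeomorphism_def)
  have cS': "c \<notin> S" "c \<notin> T" using c by auto
  have img: "h ` (\<S> - X - {c}) = - h ` X" if "X \<subseteq> \<S>" "c \<notin> X" for X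
  proof (intro set_eqI iffI)
    fix z assume "z \<in> h ` (\<S> - X - {c})"
    then show "z \<in> - h ` X" using that kh' by (auto, metis subset_iff)
  next
    fix z assume "z \<in> - h ` X"
    then have "k z \<notin> X" using hk' by (metis ComplD imageI)
    then have "k z \<in> \<S> - X - {c}" using kS by auto
    then show "z \<in> h ` (\<S> - X - {c})" using hk' by (metis imageI)
  qed
  have cmp: "compact (h ` X)" if "closed X" "X \<subseteq> \<S>" "c \<notin> X" for X
  proof (rule compact_continuous_image)
    show "continuous_on X h"
      by (rule continuous_on_subset[OF h]) (use that in blast)
    show "compact X"
      using that compact_Int_closed[OF compact_sphere, of X 0 1] by (simp add: Int_absorb1)
  qed
  have "connected (- (h ` S \<union> h ` T))"
  proof (rule Janiszewski_connected)
    show "compact (h ` S)" "closed (h ` T)"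
      using cmp S T cS' compact_imp_closed by blast+
    have "h ` S \<inter> h ` T = h ` (S \<inter> T)"
    proof -
      have "inj_on h (\<S> - {c})"
        by (rule inj_on_inverseI[of _ k]) (simp add: kh')
      then show ?thesis
        by (rule inj_on_image_Int[symmetric]) (use S(2) T(2) cS' in auto)
    qed
    moreover have "connected (h ` (S \<inter> T))"
      by (rule connected_continuous_image[OF continuous_on_subset[OF h] con]) (use S cS' in blast)
    ultimately show "connected (h ` S \<inter> h ` T)" by simp
    have "connected (h ` (\<S> - S - {c}))" "connected (h ` (\<S> - T - {c}))"
      by (rule connected_continuous_image[OF continuous_on_subset[OF h]],
        auto intro!: connected_delete_point_sphere oO cS cT)+
    then show "connected (- h ` S)" "connected (- h ` T)"
      using img S T cS' by simp_all
  qed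
  then have "connected (k ` (- (h ` S \<union> h ` T)))"
    by (intro connected_continuous_image continuous_on_subset[OF k]) auto
  moreover have "k ` (- (h ` S \<union> h ` T)) = ?O - {c}"
  proof -
    have e: "- (h ` S \<union> h ` T) = h ` (?O - {c})"
      using img[of "S \<union> T"] S T cS' by (simp add: image_Un)
    have "k (h x) = x" if "x \<in> ?O - {c}" for x
      using that kh' by blast
    then have "k ` h ` (?O - {c}) = ?O - {c}"
      by (simp add: image_image)
    then show ?thesis
      by (simp only: e)
  qed
  ultimately have con': "connected (?O - {c})" by simp
  have "c \<in> closure (?O - {c})"
    by (rule sphere_in_closure_delete[OF oO(1) c])
  then show ?thesis
    using connected_intermediate_closure[OF con', of ?O] closure_subset[of "?O - {c}"] by blast
qed (use connected_empty in metis)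

text \<open>Removing two points leaves the sphere connected, but cuts a simple closed curve into two
  relatively closed arcs. The result provides the pole off the curve in
  \<open>jordan_curve_sphere\<close>.\<close>

lemma sphere_not_simple_closed_curve:
  assumes "simple_path p" "pathfinish p = pathstart p" "path_image p \<subseteq> \<S>"
  shows "path_image p \<noteq> \<S>"
proof
  assume eq: "path_image p = \<S>"
  have p: "continuous_on {0..1} p"
    using assms(1) by (simp add: simple_path_def path_def)
  have p10: "p 1 = p 0"
    using assms(2) by (simp add: pathfinish_def pathstart_def)
  have inj: "s = t" if "p s = p t" "s \<in> {0..<1}" "t \<in> {0..<1}" for s t
    using simple_path_inj_on[OF assms(1)] assms(1) that unfolding simple_path_def loop_free_def
    by (metis atLeastAtMost_iff atLeastLessThan_iff less_irrefl less_le)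
  let ?A = "p ` {0..1/2}" and ?B = "p ` {1/2..1}"
  let ?O = "\<S> - {p 0} - {p (1/2)}"
  have "openin (top_of_set \<S>) (\<S> - {p 0})"
    by (simp add: openin_delete)
  moreover have "connected (\<S> - {p 0})"
    by (rule connected_delete_point_sphere) (auto intro: connected_sphere)
  ultimately have con: "connected ?O"
    by (rule connected_delete_point_sphere)
  have cl: "closed ?A" "closed ?B"
    by (intro compact_imp_closed compact_continuous_image continuous_on_subset[OF p]; auto)+
  have cov: "?O \<subseteq> ?A \<union> ?B"
    using eq unfolding path_image_def by (force simp: image_iff)
  have "?A \<inter> ?B \<inter> ?O = {}"
  proof -
    have False if "s \<in> {0..1/2}" "t \<in> {1/2..1}" "p s = p t" "p s \<noteq> p 0" "p s \<noteq> p (1/2)" for s t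
    proof -
      have "t \<noteq> 1" using that(3,4) p10 by auto
      moreover have "s \<noteq> 1/2" using that(5) by metis
      ultimately have "s = t" by (intro inj) (use that in auto)
      then show False using that \<open>s \<noteq> 1/2\<close> by auto
    qed
    then show ?thesis by (auto simp: image_iff) metis
  qed
  moreover have "p (1/4) \<in> ?A \<inter> ?O"
  proof -
    have "p (1/4) \<in> \<S>" using assms(3) unfolding path_image_def by auto
    moreover have "p (1/4) \<noteq> p 0" "p (1/4) \<noteq> p (1/2)"
      using inj[of "1/4" 0] inj[of "1/4" "1/2"] by auto
    ultimately show ?thesis by auto
  qed
  moreover have "p (3/4) \<in> ?B \<inter> ?O"
  proof -
    have "p (3/4) \<in> \<S>" using assms(3) unfolding path_image_def by auto
    moreover have "p (3/4) \<noteq> p 0" "p (3/4) \<noteq> p (1/2)"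
      using inj[of "3/4" 0] inj[of "3/4" "1/2"] by auto
    ultimately show ?thesis by auto
  qed
  ultimately show False
    using con cl cov unfolding connected_closed by blast
qed

text \<open>
  The antipodal map becomes \<open>z \<mapsto> - 1 / cnj z\<close> under stereographic projection. If the winding number
  around \<open>0\<close> vanished, a continuous logarithm would be periodic, and the difference \<open>\<phi>\<close> of its
  imaginary parts at antipodal parameters would be odd under a half turn, hence zero somewhere.
\<close>

lemma antipodal_curve_odd_winding:
  fixes q :: "real \<Rightarrow> complex"
  assumes q: "path q" "pathfinish q = pathstart q"
    and anti: "\<And>t. t \<in> {0..1/2} \<Longrightarrow> q t * cnj (q (t + 1/2)) = - 1"
  shows "0 \<notin> outside (path_image q)"
proof
  assume out: "0 \<in> outside (path_image q)"
  then have nin: "0 \<notin> path_image q"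
    using outside_no_overlap by blast
  have "winding_number q 0 = 0"
    by (rule winding_number_zero_in_outside[OF q out])
  then obtain L where L: "path L" "pathfinish L = pathstart L" "\<And>t. t \<in> {0..1} \<Longrightarrow> q t = exp (L t)"
    using winding_number_as_continuous_log[OF q(1) nin] by (metis (no_types, lifting) add_0 mult_zero_right right_minus_eq)
  define \<phi> where "\<phi> t = Im (L t) - Im (L (t + 1/2))" for t
  have contL: "continuous_on {0..1} L"
    using L(1) by (simp add: path_def)
  have cont: "continuous_on {0..1/2} \<phi>"
    unfolding \<phi>_def
    by (intro continuous_intros continuous_on_compose2[OF contL] continuous_on_subset[OF contL]) auto
  \<comment> \<open>The number \<open>exp (L t + cnj (L (t + 1/2)))\<close> has modulus 1 and
    argument \<open>\<phi> t\<close>; as it equals \<open>- 1\<close>, the function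
    \<open>\<phi>\<close> cannot vanish.\<close>
  have cos: "cos (\<phi> t) = - 1" if t: "t \<in> {0..1/2}" for t
  proof -
    have "q t * cnj (q (t + 1/2)) = exp (L t + cnj (L (t + 1/2)))"
      using t L(3) by (simp add: exp_add exp_cnj)
    then have e: "exp (L t + cnj (L (t + 1/2))) = - 1"
      using anti[OF t] by simp
    then have "norm (exp (L t + cnj (L (t + 1/2)))) = 1"
      by simp
    then have "exp (Re (L t + cnj (L (t + 1/2)))) = 1"
      by simp
    then show ?thesis
      using arg_cong[OF e, of Re] by (simp add: Re_exp \<phi>_def)
  qed
  have "L 1 = L 0"
    using L(2) by (simp add: pathfinish_def pathstart_def)
  then have "\<phi> (1/2) = - \<phi> 0"
    by (simp add: \<phi>_def)
  then have "\<exists>t \<in> {0..1/2}. \<phi> t = 0"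
    using IVT'[of \<phi> 0 0 "1/2"] IVT2'[of \<phi> "1/2" 0 0] cont by (cases "\<phi> 0 \<le> 0") auto
  then show False
    using cos by force
qed

text \<open>Jordan's theorem in the plane, seen from a pole \<open>c\<close> off the curve:
  \<open>c\<close> is infinity and belongs to the outer side \<open>W\<close>, while
  \<open>- c\<close> is the origin. The last clause is an implication so that the lemma serves
  antipodal curves and, in \<open>transversal_imp_antipodal\<close>, hypothetical ones that close up
  after one period.\<close>

lemma jordan_curve_sphere:
  fixes p :: "real \<Rightarrow> real ^ 3"
  assumes p: "simple_path p" "pathfinish p = pathstart p" "path_image p \<subseteq> \<S>"
  obtains c U W where "openin (top_of_set \<S>) U" "openin (top_of_set \<S>) W" "connected U" "connected W"
    "U \<inter> W = {}" "U \<union> W = \<S> - path_image p" "path_image p \<subseteq> closure U" "path_image p \<subseteq> closure W"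
    "c \<in> W" "(\<forall>t \<in> {0..1/2}. p (t + 1/2) = - p t) \<longrightarrow> - c \<in> U"
proof -
  let ?P = "path_image p"
  have "?P \<noteq> \<S>"
    by (rule sphere_not_simple_closed_curve) (use p in auto)
  then obtain c where c: "c \<in> \<S>" "c \<notin> ?P"
    using p by blast
  obtain h :: "real ^ 3 \<Rightarrow> complex" and k where hk: "homeomorphism (\<S> - {c}) UNIV h k" and h0: "h (- c) = 0"
    and hm: "\<And>x. x \<in> \<S> - {c, - c} \<Longrightarrow> h x * cnj (h (- x)) = - 1"
    using stereographic[OF c(1)] by blast
  have conth: "continuous_on (\<S> - {c}) h" and contk: "continuous_on UNIV k" and kS: "range k = \<S> - {c}"
    using homeomorphism_cont1[OF hk] homeomorphism_cont2[OF hk] homeomorphism_image2[OF hk] by simp_all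
  have hk': "h (k z) = z" for z
    using hk by (simp add: homeomorphism_def)
  have kh': "k (h x) = x" if "x \<in> \<S>" "x \<noteq> c" for x
    using hk that by (simp add: homeomorphism_def)
  have injk: "inj k"
    by (rule inj_on_inverseI[of _ h]) (simp add: hk')
  have injh: "inj_on h (\<S> - {c})"
    by (rule inj_on_inverseI[of _ k]) (simp add: kh')
  have Psub: "?P \<subseteq> \<S> - {c}"
    using p c by blast
  define q where "q = h \<circ> p"
  have q: "simple_path q"
    unfolding q_def
    by (rule simple_path_continuous_image[OF p(1) continuous_on_subset[OF conth Psub] inj_on_subset[OF injh Psub]])
  have qloop: "pathfinish q = pathstart q"
    using p(2) by (simp add: q_def pathfinish_def pathstart_def)
  have qim: "path_image q = h ` ?P"
    by (simp add: q_def path_image_def image_comp)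
  have kP: "k ` path_image q = ?P"
  proof -
    have "k (h x) = x" if "x \<in> ?P" for x using kh' that Psub by blast
    then show ?thesis by (simp add: qim image_image)
  qed
  let ?I = "inside (path_image q)" and ?E = "outside (path_image q)"
  note J = Jordan_inside_outside[OF q qloop]
  have I: "?I \<noteq> {}" "open ?I" "connected ?I" "bounded ?I" and E: "open ?E" "connected ?E" "\<not> bounded ?E"
    and IE: "?I \<inter> ?E = {}" "?I \<union> ?E = - path_image q"
    and fr: "frontier ?I = path_image q" "frontier ?E = path_image q"
    using J by auto
  have opk: "openin (top_of_set \<S>) (k ` X)" if "open X" for X
  proof -
    have "k ` X = (\<S> - {c}) \<inter> h -` X"
    proof (intro set_eqI iffI)
      fix x assume "x \<in> k ` X"
      then show "x \<in> (\<S> - {c}) \<inter> h -` X" using kS hk' by auto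
    next
      fix x assume "x \<in> (\<S> - {c}) \<inter> h -` X"
      then have "k (h x) = x" "h x \<in> X" using kh' by auto
      then show "x \<in> k ` X" by (metis imageI)
    qed
    moreover have "openin (top_of_set (\<S> - {c})) ((\<S> - {c}) \<inter> h -` X)"
      using conth that by (simp add: continuous_openin_preimage_gen)
    moreover have "openin (top_of_set \<S>) (\<S> - {c})"
      by (simp add: openin_delete)
    ultimately show ?thesis
      using openin_trans by metis
  qed
  let ?U = "k ` ?I" and ?W = "insert c (k ` ?E)"
  \<comment> \<open>Written as the complement of a compact set, \<open>?W\<close> is seen to be open
    also at \<open>c\<close>.\<close>
  have W_eq: "?W = \<S> - k ` (?I \<union> path_image q)"
  proof -
    have "k ` ?E = range k - k ` (?I \<union> path_image q)"
    proof -
      have "?E = UNIV - (?I \<union> path_image q)"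
        using IE by blast
      then show ?thesis
        by (metis image_set_diff[OF injk])
    qed
    moreover have "insert c (\<S> - {c} - Z) = \<S> - Z" if "Z \<subseteq> \<S> - {c}" for Z
      using that c(1) by blast
    moreover have "k ` (?I \<union> path_image q) \<subseteq> \<S> - {c}"
      using kS by blast
    ultimately show ?thesis by (simp only: kS)
  qed
  have cptI: "compact (?I \<union> path_image q)"
  proof -
    have "closure ?I = ?I \<union> path_image q"
      using fr(1) I(2) by (metis closure_Un_frontier)
    then show ?thesis
      using I(4) by (metis compact_closure)
  qed
  have "openin (top_of_set \<S>) ?W"
  proof -
    have "compact (k ` (?I \<union> path_image q))"
      by (intro compact_continuous_image[OF _ cptI] continuous_on_subset[OF contk]) auto
    moreover have "k ` (?I \<union> path_image q) \<subseteq> \<S>"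
      using kS by blast
    ultimately show ?thesis
      unfolding W_eq by (intro openin_diff openin_subtopology_self closed_subset compact_imp_closed)
  qed
  have conkE: "connected (k ` ?E)"
    by (intro connected_continuous_image[OF _ E(2)] continuous_on_subset[OF contk]) auto
  have "c \<in> closure (?W - {c})"
    by (rule sphere_in_closure_delete[OF \<open>openin (top_of_set \<S>) ?W\<close>]) simp
  moreover have "?W - {c} \<subseteq> k ` ?E"
    by blast
  ultimately have "c \<in> closure (k ` ?E)"
    using closure_mono by (metis subsetD)
  then have conW: "connected ?W"
    by (intro connected_intermediate_closure[OF conkE]) (simp_all add: subset_insertI closure_subset)
  have conU: "connected ?U"
    by (intro connected_continuous_image[OF _ I(3)] continuous_on_subset[OF contk]) auto
  have UW: "?U \<inter> ?W = {}"
    unfolding W_eq image_Un by (simp add: Diff_Un Int_Diff Int_commute) blast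
  have UW': "?U \<union> ?W = \<S> - ?P"
  proof -
    have "k ` ?I \<inter> k ` path_image q = {}"
      using inside_no_overlap[of "path_image q"] by (simp flip: image_Int[OF injk])
    moreover have "k ` ?I \<subseteq> \<S>"
      using kS by blast
    moreover have "X \<union> (\<S> - (X \<union> Y)) = \<S> - Y" if "X \<inter> Y = {}" "X \<subseteq> \<S>" for X Y
      using that by blast
    ultimately show ?thesis
      unfolding W_eq image_Un kP by simp
  qed
  have clk: "k ` path_image q \<subseteq> closure (k ` X)" if "path_image q \<subseteq> closure X" for X
  proof -
    have "k ` closure X \<subseteq> closure (k ` X)"
      by (rule image_closure_subset[OF continuous_on_subset[OF contk]]) (auto simp: closure_subset)
    then show ?thesis using that by blast
  qed
  have clU: "?P \<subseteq> closure ?U"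
    using clk[of ?I] fr(1) kP by (metis frontier_def Diff_subset)
  have "?P \<subseteq> closure (k ` ?E)"
    using clk[of ?E] fr(2) kP by (metis frontier_def Diff_subset)
  then have clW: "?P \<subseteq> closure ?W"
    by (meson closure_mono order_trans subset_insertI)
  have "- c \<in> ?U" if anti: "\<And>t. t \<in> {0..1/2} \<Longrightarrow> p (t + 1/2) = - p t"
  proof -
    have PP: "p t \<in> ?P" if "t \<in> {0..1}" for t
      using that by (auto simp: path_image_def)
    have mc: "- c \<notin> ?P"
    proof
      assume "- c \<in> ?P"
      then obtain t where t: "t \<in> {0..1}" "p t = - c"
        by (auto simp: path_image_def)
      have "c = p (if t \<le> 1/2 then t + 1/2 else t - 1/2)"
        using anti[of t] anti[of "t - 1/2"] t by auto
      then have "c \<in> ?P" using t(1) by (auto intro!: PP split: if_splits)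
      then show False using c by blast
    qed
    have "q t * cnj (q (t + 1/2)) = - 1" if t: "t \<in> {0..1/2}" for t
    proof -
      have "p t \<in> ?P" using PP t by auto
      then have "p t \<in> \<S> - {c, - c}"
        using c mc p(3) by auto
      then show ?thesis
        using hm[of "p t"] anti[OF t] by (simp add: q_def)
    qed
    then have "0 \<notin> ?E"
      by (intro antipodal_curve_odd_winding simple_path_imp_path q qloop)
    moreover have k0: "k 0 = - c"
      using h0 kh'[of "- c"] c(1) by simp
    moreover have "0 \<notin> path_image q"
      using k0 kP mc by (metis imageI)
    ultimately have "0 \<in> ?I"
      using IE(2) by blast
    with k0 show ?thesis by (metis imageI)
  qed
  then show thesis
    using that[OF opk[OF I(2)] \<open>openin (top_of_set \<S>) ?W\<close> conU conW UW UW' clU clW] by blast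
qed

section \<open>Side functions of antipodal curves\<close>

lemma connected_subset_one_side:
  assumes "connected C" "C \<subseteq> U \<union> W" "U \<inter> W = {}"
    "openin (top_of_set S) U" "openin (top_of_set S) W" "C \<inter> U \<noteq> {}"
  shows "C \<subseteq> U"
proof (rule ccontr)
  assume "\<not> C \<subseteq> U"
  obtain U' W' where op: "open U'" "U = S \<inter> U'" "open W'" "W = S \<inter> W'"
    using assms(4,5) unfolding openin_open by blast
  have "C \<subseteq> S" using assms(2) op by blast
  then have "U' \<inter> W' \<inter> C = {}" "C \<subseteq> U' \<union> W'" "U' \<inter> C \<noteq> {}" "W' \<inter> C \<noteq> {}"
    using assms(2,3,6) op \<open>\<not> C \<subseteq> U\<close> by blast+
  then show False
    using connectedD[OF assms(1) op(1,3)] by blast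
qed

text \<open>The lift of a simple closed curve with period 1 in the projective plane and period 2 on
  the sphere, where half a turn is the antipodal map.\<close>

definition antipodal_curve :: "(real \<Rightarrow> real ^ 3) \<Rightarrow> bool" where
  "antipodal_curve g \<longleftrightarrow> continuous_on UNIV g \<and> range g \<subseteq> \<S> \<and> (\<forall>t. g (t + 1) = - g t) \<and>
     (\<forall>s t. g s = g t \<or> g s = - g t \<longleftrightarrow> s - t \<in> \<int>)"

lemma antipodal_curve_add_int:
  assumes "\<And>t. g (t + 1) = - g t"
  shows "g (t + of_int k) = (if even k then g t else - (g t :: 'a :: real_vector))"
proof (induction k rule: int_induct[where k = 0])
  case (step1 i)
  then show ?case using assms[of "t + of_int i"] by (auto simp: add.assoc)
next
  case (step2 i)
  have "g (t + of_int i) = - g (t + of_int (i - 1))"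
    using assms[of "t + of_int (i - 1)"] by (simp add: algebra_simps)
  then have "g (t + of_int (i - 1)) = - g (t + of_int i)"
    by simp
  then show ?case using step2 by auto
qed simp

text \<open>Topologically only the positive side is described; the negative one is its antipodal
  image, see \<open>side_function_uminus\<close>.\<close>

definition side_function :: "(real ^ 3 \<Rightarrow> real) \<Rightarrow> (real ^ 3) set \<Rightarrow> bool" where
  "side_function s L \<longleftrightarrow> (\<forall>x \<in> \<S>. s x \<in> {- 1, 0, 1} \<and> s (- x) = - s x) \<and> {x \<in> \<S>. s x = 0} = L \<and>
     openin (top_of_set \<S>) {x \<in> \<S>. s x = 1} \<and> connected {x \<in> \<S>. s x = 1} \<and> L \<subseteq> closure {x \<in> \<S>. s x = 1}"

lemma antipodal_curve_side_function:
  assumes "antipodal_curve g"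
  obtains s where "side_function s (range g)"
proof -
  have cont: "continuous_on UNIV g" and gS: "\<And>t. g t \<in> \<S>" and anti: "\<And>t. g (t + 1) = - g t"
    and inj: "\<And>s t. g s = g t \<or> g s = - g t \<longleftrightarrow> s - t \<in> \<int>"
    using assms by (auto simp: antipodal_curve_def)
  \<comment> \<open>A full turn on the sphere takes two units of the parameter.\<close>
  define p where "p t = g (2 * t)" for t
  have im: "path_image p = range g"
  proof
    show "range g \<subseteq> path_image p"
    proof (intro subsetI, elim rangeE)
      fix x t assume "x = g t"
      define u where "u = t / 2 - of_int \<lfloor>t / 2\<rfloor>"
      have "t + of_int (- 2 * \<lfloor>t / 2\<rfloor>) = 2 * u"
        by (simp add: u_def)
      then have "x = p u"
        using antipodal_curve_add_int[where g = g, OF anti, of t "- 2 * \<lfloor>t / 2\<rfloor>"] \<open>x = g t\<close>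
        unfolding p_def by (metis even_mult_iff even_minus even_numeral)
      moreover have "u \<in> {0..1}"
        unfolding u_def atLeastAtMost_iff by linarith
      ultimately show "x \<in> path_image p"
        by (auto simp: path_image_def)
    qed
  qed (auto simp: p_def path_image_def)
  have simple: "simple_path p"
    unfolding simple_path_def loop_free_def
  proof (intro conjI ballI impI)
    show "path p"
      unfolding path_def p_def by (intro continuous_on_compose2[OF cont] continuous_intros) auto
    fix s t :: real assume st: "s \<in> {0..1}" "t \<in> {0..1}" "p s = p t"
    then have eq: "g (2 * s) = g (2 * t)" by (simp add: p_def)
    then obtain k :: int where k: "2 * s - 2 * t = of_int k"
      using inj[of "2 * s" "2 * t"] by (auto elim: Ints_cases)
    then have "real_of_int k \<le> 2" "- 2 \<le> real_of_int k"
      using st(1,2) by (simp_all only: atLeastAtMost_iff, linarith+)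
    then have "- 2 \<le> k" "k \<le> 2" by linarith+
    moreover have "even k"
    proof (rule ccontr)
      assume "odd k"
      have "g (2 * s) = - g (2 * t)"
        using antipodal_curve_add_int[where g = g, OF anti, of "2 * t" k] \<open>odd k\<close> k by (simp add: algebra_simps)
      then show False using eq gS sphere_neq_minus by metis
    qed
    ultimately have "k \<in> {- 2, 0, 2}"
      by (auto simp: even_iff_mod_2_eq_zero)
    then show "s = t \<or> s = 0 \<and> t = 1 \<or> s = 1 \<and> t = 0"
      using k st by auto
  qed
  have loop: "pathfinish p = pathstart p"
    using antipodal_curve_add_int[where g = g, OF anti, of 0 2] by (simp add: pathfinish_def pathstart_def p_def)
  have psub: "path_image p \<subseteq> \<S>"
    unfolding im using gS by (simp add: image_subset_iff)
  obtain c U W where UW: "openin (top_of_set \<S>) U" "openin (top_of_set \<S>) W" "connected U" "connected W"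
    "U \<inter> W = {}" "U \<union> W = \<S> - path_image p" "path_image p \<subseteq> closure U" "path_image p \<subseteq> closure W"
    "c \<in> W" "(\<forall>t \<in> {0..1/2}. p (t + 1/2) = - p t) \<longrightarrow> - c \<in> U"
    by (rule jordan_curve_sphere[OF simple loop psub]) (rule_tac U = U and W = W and c = c in that, assumption+)
  have mc: "- c \<in> U"
    by (rule UW(10)[rule_format]) (use anti in \<open>simp add: p_def distrib_left\<close>)
  have mr: "- x \<in> range g" if "x \<in> range g" for x
    using that anti by (metis (no_types, lifting) rangeE rangeI)
  have neg: "uminus ` X \<subseteq> U \<union> W" if X: "X \<subseteq> U \<union> W" for X
  proof (intro image_subsetI)
    fix x assume "x \<in> X"
    then have "x \<in> \<S>" "x \<notin> range g"
      using X unfolding UW(6) im by auto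
    then have "- x \<in> \<S>" "- x \<notin> range g"
      using mr[of "- x"] by auto
    then show "- x \<in> U \<union> W"
      unfolding UW(6) im by blast
  qed
  have con: "connected (uminus ` X)" if "connected X" for X :: "(real ^ 3) set"
    by (intro connected_continuous_image continuous_intros that)
  \<comment> \<open>The antipodal map preserves the complement of the curve, so it permutes the two
    sides; it moves \<open>c\<close> in \<open>W\<close> to \<open>- c\<close> in \<open>U\<close>,
    hence exchanges them.\<close>
  have "uminus ` W \<subseteq> U"
    by (rule connected_subset_one_side[OF con[OF UW(4)] neg[OF Un_upper2] UW(5) UW(1,2)]) (use mc UW(9) in auto)
  moreover have "uminus ` U \<subseteq> W"
  proof (rule connected_subset_one_side[OF con[OF UW(3)] _ _ UW(2,1)])
    show "uminus ` U \<inter> W \<noteq> {}"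
      using mc UW(9) by (metis IntI empty_iff imageI minus_minus)
  qed (use neg[OF Un_upper1] UW(5) in blast)+
  ultimately have swap: "- x \<in> U \<longleftrightarrow> x \<in> W" for x
    by (metis image_subset_iff minus_minus)
  define s :: "real ^ 3 \<Rightarrow> real" where "s x = (if x \<in> W then 1 else if x \<in> U then - 1 else 0)" for x
  have WS: "W \<subseteq> \<S>" using UW(2) openin_imp_subset by blast
  have s1: "{x \<in> \<S>. s x = 1} = W"
    using WS by (auto simp: s_def split: if_splits)
  have s0: "{x \<in> \<S>. s x = 0} = range g"
    using UW(6) gS unfolding im by (auto simp: s_def split: if_splits)
  have odd: "s (- x) = - s x" for x
    using swap[of x] swap[of "- x"] UW(5) by (auto simp: s_def)
  have "side_function s (range g)"
    unfolding side_function_def s1 s0 using odd UW im by (auto simp: s_def)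
  then show thesis by (rule that)
qed

section \<open>Lifts of pseudolines to the sphere\<close>

lemma basis3_coordinates:
  fixes P F H :: "real ^ 3"
  assumes "P \<noteq> 0" "F \<notin> span {P}" "H \<notin> span {P, F}"
  obtains \<alpha> x y :: "real ^ 3 \<Rightarrow> real" where "bounded_linear \<alpha>" "bounded_linear x" "bounded_linear y"
    "\<alpha> P = 1" "\<alpha> F = 0" "\<alpha> H = 0" "x P = 0" "x F = 1" "x H = 0" "y P = 0" "y F = 0" "y H = 1"
    "\<And>v. v = \<alpha> v *\<^sub>R P + x v *\<^sub>R F + y v *\<^sub>R H"
proof -
  have ne: "F \<noteq> P" "H \<noteq> P" "H \<noteq> F" 
    using assms(2,3) span_base by blast+
  have ind: "independent {H, F, P}"
  proof -
    have "independent {F, P}"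
      using assms(1,2) by (simp add: independent_insert)
    moreover have "H \<notin> span {F, P}"
      using assms(3) by (simp add: insert_commute)
    ultimately show ?thesis
      by (rule independent_insertI[rotated])
  qed
  have "card {H, F, P} = 3"
    using ne by auto
  then have span: "v \<in> span {H, F, P}" for v
    using card_ge_dim_independent[OF _ ind, of UNIV] by auto
  have ex: "\<exists>\<phi> :: real ^ 3 \<Rightarrow> real. linear \<phi> \<and> (\<forall>v\<in>{H, F, P}. \<phi> v = c v)" for c
    using linear_independent_extend[OF ind] by blast
  obtain \<alpha> :: "real ^ 3 \<Rightarrow> real" where \<alpha>: "linear \<alpha>" "\<alpha> P = 1" "\<alpha> F = 0" "\<alpha> H = 0"
    using ex[of "\<lambda>v. if v = P then 1 else 0"] ne by auto
  obtain x :: "real ^ 3 \<Rightarrow> real" where x: "linear x" "x P = 0" "x F = 1" "x H = 0"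
    using ex[of "\<lambda>v. if v = F then 1 else 0"] ne by auto
  obtain y :: "real ^ 3 \<Rightarrow> real" where y: "linear y" "y P = 0" "y F = 0" "y H = 1"
    using ex[of "\<lambda>v. if v = H then 1 else 0"] ne by auto
  have lin: "linear (\<lambda>v. \<alpha> v *\<^sub>R P + x v *\<^sub>R F + y v *\<^sub>R H)"
    using \<alpha>(1) x(1) y(1) by (simp add: linear_iff algebra_simps)
  have "id v = \<alpha> v *\<^sub>R P + x v *\<^sub>R F + y v *\<^sub>R H" for v
    by (rule linear_eq_on[OF linear_id lin span]) (use \<alpha> x y in auto)
  then show thesis
    using \<alpha> x y by (intro that[of \<alpha> x y]) (simp_all add: linear_conv_bounded_linear)
qed

lemma sgn_eq_iff_scale: "a \<noteq> 0 \<Longrightarrow> b \<noteq> 0 \<Longrightarrow> sgn a = sgn b \<longleftrightarrow> (\<exists>c > 0. a = c *\<^sub>R b)"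
  for a b :: "'a :: real_normed_vector"
proof safe
  assume "a \<noteq> 0" "b \<noteq> 0" "sgn a = sgn b"
  then have "a = (norm a / norm b) *\<^sub>R b"
    by (metis divide_inverse norm_eq_zero scaleR_one right_inverse scaleR_scaleR sgn_div_norm)
  then show "\<exists>c>0. a = c *\<^sub>R b"
    using \<open>a \<noteq> 0\<close> \<open>b \<noteq> 0\<close> by (metis divide_pos_pos zero_less_norm_iff)
qed (simp add: sgn_scaleR)

text \<open>
  In the affine chart spanned by the two tangent directions, the cones \<open>\<bar>X\<bar> / 2 < Y\<close> and
  \<open>\<bar>X\<bar> / 2 < - Y\<close> avoid the first curve near the crossing, while the second curve passes from one to
  the other. Every nearby point off the first curve can be moved vertically into one of the cones.
  Hence the cones lie on different sides, since the crossing is in the closure of both sides.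
\<close>

lemma transversal_curve_changes_side:
  fixes f h :: "real \<Rightarrow> real ^ 3"
  assumes f0: "\<And>t. f t \<noteq> 0" and der: "\<And>t. (f has_vector_derivative f' t) (at t)" and cont': "continuous_on UNIV f'"
    and per: "\<And>s t. sgn (f s) = sgn (f t) \<longleftrightarrow> s - t \<in> \<int>"
    and UW: "U \<inter> W = {}" "U \<union> W = \<S> - range (\<lambda>t. sgn (f t))"
      "openin (top_of_set \<S>) U" "openin (top_of_set \<S>) W"
      "range (\<lambda>t. sgn (f t)) \<subseteq> closure U" "range (\<lambda>t. sgn (f t)) \<subseteq> closure W"
    and h: "(h has_vector_derivative H) (at t0)" "h t0 = c *\<^sub>R f s0" "c > 0"
    and ind: "f' s0 \<notin> span {f s0}" "H \<notin> span {f s0, f' s0}"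
  obtains V d where "V = U \<or> V = W" "d > 0"
    "\<And>t. 0 < t \<Longrightarrow> t < d \<Longrightarrow> sgn (h (t0 + t)) \<in> V"
    "\<And>t. 0 < t \<Longrightarrow> t < d \<Longrightarrow> sgn (h (t0 - t)) \<in> U \<union> W - V"
proof -
  define P F where "P = f s0" and "F = f' s0"
  let ?\<Gamma> = "range (\<lambda>t. sgn (f t))"
  obtain \<alpha> x y :: "real ^ 3 \<Rightarrow> real" where bl: "bounded_linear \<alpha>" "bounded_linear x" "bounded_linear y"
    and b: "\<alpha> P = 1" "\<alpha> F = 0" "\<alpha> H = 0" "x P = 0" "x F = 1" "x H = 0" "y P = 0" "y F = 0" "y H = 1"
    and v: "\<And>v. v = \<alpha> v *\<^sub>R P + x v *\<^sub>R F + y v *\<^sub>R H"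
    by (rule basis3_coordinates[of P F H]) (use ind f0[of s0] in \<open>simp_all add: P_def F_def\<close>)
  have contl: "continuous_on S (\<lambda>u. \<phi> (k u))" if "bounded_linear \<phi>" "continuous_on S k"
    for \<phi> :: "real ^ 3 \<Rightarrow> real" and k :: "'a :: topological_space \<Rightarrow> real ^ 3" and S
    using bounded_linear.continuous_on[OF that] .
  have contf: "continuous_on S f" for S
    using der by (meson continuous_at_imp_continuous_on has_vector_derivative_continuous)
  have derl: "((\<lambda>t. \<phi> (k t)) has_real_derivative \<phi> k') (at t)"
    if "bounded_linear \<phi>" "(k has_vector_derivative k') (at t)" for \<phi> :: "real ^ 3 \<Rightarrow> real" and k k' t
    using bounded_linear.has_vector_derivative[OF that] by (simp add: has_real_derivative_iff_has_vector_derivative)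
  \<comment> \<open>\<open>q\<close> is the affine chart \<open>\<alpha> = 1\<close> centred at the
    crossing \<open>P\<close>, with axes along the two tangent directions; \<open>\<nu>\<close>
    projects it radially to the sphere.\<close>
  define q where "q X Y = P + X *\<^sub>R F + Y *\<^sub>R H" for X Y
  define \<nu> where "\<nu> z = sgn (q (fst z) (snd z))" for z
  have qc: "\<alpha> (q X Y) = 1" "x (q X Y) = X" "y (q X Y) = Y" for X Y
    using bl b by (simp_all add: q_def linear_simps)
  have q0: "q X Y \<noteq> 0" for X Y
    using qc(1)[of X Y] bl(1) by (metis linear_simps(3) zero_neq_one)
  have cont\<nu>: "continuous_on S \<nu>" for S
    unfolding \<nu>_def by (intro continuous_on_sgn) (use q0 in \<open>auto simp: q_def intro!: continuous_intros\<close>)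
  have \<nu>S: "\<nu> z \<in> \<S>" for z
    using q0 by (simp add: \<nu>_def mem_sphere_0 norm_sgn)
  have \<nu>_of: "\<nu> (x w / \<alpha> w, y w / \<alpha> w) = sgn w" if "\<alpha> w > 0" for w
  proof -
    have "\<alpha> w *\<^sub>R q (x w / \<alpha> w) (y w / \<alpha> w) = w"
      using v[of w] that by (simp add: q_def scaleR_add_right)
    then show ?thesis
      using that by (metis \<nu>_def fst_conv snd_conv mult_1 scaleR_one sgn_pos sgn_scaleR)
  qed
  have of_\<nu>: "\<alpha> w > 0 \<and> x w / \<alpha> w = X \<and> y w / \<alpha> w = Y" if w: "\<nu> (X, Y) = sgn w" "w \<noteq> 0" for X Y w
  proof -
    obtain k where "k > 0" "w = k *\<^sub>R q X Y"
      using w(1)[symmetric] w(2) q0 sgn_eq_iff_scale[of w "q X Y"] unfolding \<nu>_def fst_conv snd_conv by blast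
    then show ?thesis
      using qc bl by (simp add: linear_simps)
  qed
  define Xf Yf where "Xf s = x (f s) / \<alpha> (f s)" and "Yf s = y (f s) / \<alpha> (f s)" for s
  define X' where "X' s = (x (f' s) * \<alpha> (f s) - x (f s) * \<alpha> (f' s)) / (\<alpha> (f s) * \<alpha> (f s))" for s
  have dX: "(Xf has_real_derivative X' s) (at s)" if "\<alpha> (f s) \<noteq> 0" for s
    unfolding Xf_def X'_def by (rule DERIV_divide[OF derl[OF bl(2) der] derl[OF bl(1) der] that])
  have dY: "(Yf has_real_derivative 0) (at s0)"
    using DERIV_divide[OF derl[OF bl(3) der] derl[OF bl(1) der], of s0] b
    by (simp add: Yf_def[abs_def] P_def[symmetric] F_def[symmetric])
  have X's0: "X' s0 = 1" and \<alpha>s0: "\<alpha> (f s0) = 1" and Xf0: "Xf s0 = 0" "Yf s0 = 0"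
    using b by (simp_all add: X'_def Xf_def Yf_def P_def[symmetric] F_def[symmetric])
  have "isCont (\<lambda>s. \<alpha> (f s)) s0"
    using contl[OF bl(1) contf, of UNIV] by (simp add: continuous_on_eq_continuous_at)
  then have "\<forall>\<^sub>F s in at s0. \<alpha> (f s) > 0"
    using \<alpha>s0 by (intro order_tendstoD(1)[of _ 1]) (simp_all add: isCont_def)
  moreover have "\<forall>\<^sub>F s in at s0. X' s > 0"
  proof -
    have "isCont X' s0"
      unfolding X'_def 
      using contl[OF bl(1) contf, of UNIV] contl[OF bl(2) contf, of UNIV] contl[OF bl(1) cont'] contl[OF bl(2) cont'] \<alpha>s0
      by (intro continuous_intros) (simp_all add: continuous_on_eq_continuous_at)
    then show ?thesis
      using X's0 by (intro order_tendstoD(1)[of _ 1]) (simp_all add: isCont_def)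
  qed
  ultimately have "\<forall>\<^sub>F s in at s0. \<alpha> (f s) > 0 \<and> X' s > 0"
    by (rule eventually_conj)
  then obtain d0 where "d0 > 0" "\<And>s. s \<noteq> s0 \<Longrightarrow> \<bar>s - s0\<bar> < d0 \<Longrightarrow> \<alpha> (f s) > 0 \<and> X' s > 0"
    by (auto simp: eventually_at dist_real_def)
  then have d0: "d0 > 0" "\<bar>s - s0\<bar> < d0 \<Longrightarrow> \<alpha> (f s) > 0 \<and> X' s > 0" for s
    using X's0 \<alpha>s0 by (cases "s = s0"; simp)+
  \<comment> \<open>\<open>Xf\<close> is strictly increasing near \<open>s0\<close>, so a vertical
    line meets this branch of the curve at most once.\<close>
  have injX: "s = t" if "\<bar>s - s0\<bar> < d0" "\<bar>t - s0\<bar> < d0" "Xf s = Xf t" for s t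
  proof -
    have mono: "Xf a < Xf b" if "a < b" "\<bar>a - s0\<bar> < d0" "\<bar>b - s0\<bar> < d0" for a b
    proof (rule DERIV_pos_imp_increasing[OF that(1)])
      fix u assume "a \<le> u" "u \<le> b"
      then have "\<bar>u - s0\<bar> < d0" using that by linarith
      then show "\<exists>y. (Xf has_real_derivative y) (at u) \<and> 0 < y"
        using d0(2) dX by (metis less_irrefl)
    qed
    show ?thesis
      using mono[of s t] mono[of t s] that by (cases s t rule: linorder_cases) auto
  qed
  have dXs0: "(Xf has_real_derivative 1) (at s0)"
    using dX[of s0] \<alpha>s0 X's0 by simp
  \<comment> \<open>The curve is tangent to the X axis, so both functions increase through 0;
    together this gives \<open>\<bar>Y\<bar> \<le> \<bar>X\<bar> / 2\<close> on the branch.\<close>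
  have p1: "((\<lambda>s. Xf s / 2 - Yf s) has_real_derivative 1/2) (at s0)"
    "((\<lambda>s. Xf s / 2 + Yf s) has_real_derivative 1/2) (at s0)"
    by (auto intro!: derivative_eq_intros dXs0 dY)
  obtain d1 where d1: "d1 > 0" "\<And>s. \<bar>s - s0\<bar> < d1 \<Longrightarrow> \<bar>Yf s\<bar> \<le> \<bar>Xf s\<bar> / 2"
  proof -
    obtain a where a: "a > 0" "\<And>u. 0 < u \<Longrightarrow> u < a \<Longrightarrow> Xf s0 / 2 - Yf s0 < Xf (s0 + u) / 2 - Yf (s0 + u)"
      using DERIV_pos_inc_right[OF p1(1)] by auto
    obtain b where b: "b > 0" "\<And>u. 0 < u \<Longrightarrow> u < b \<Longrightarrow> Xf s0 / 2 + Yf s0 < Xf (s0 + u) / 2 + Yf (s0 + u)"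
      using DERIV_pos_inc_right[OF p1(2)] by auto
    obtain c where c: "c > 0" "\<And>u. 0 < u \<Longrightarrow> u < c \<Longrightarrow> Xf s0 / 2 - Yf s0 > Xf (s0 - u) / 2 - Yf (s0 - u)"
      using DERIV_pos_inc_left[OF p1(1)] by auto
    obtain d where d: "d > 0" "\<And>u. 0 < u \<Longrightarrow> u < d \<Longrightarrow> Xf s0 / 2 + Yf s0 > Xf (s0 - u) / 2 + Yf (s0 - u)"
      using DERIV_pos_inc_left[OF p1(2)] by auto
    show thesis
    proof (rule that[of "Min {a, b, c, d}"])
      fix s assume s: "\<bar>s - s0\<bar> < Min {a, b, c, d}"
      consider "s = s0" | "s > s0" | "s < s0" by linarith
      then show "\<bar>Yf s\<bar> \<le> \<bar>Xf s\<bar> / 2"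
      proof cases
        case 2
        then show ?thesis using a(2)[of "s - s0"] b(2)[of "s - s0"] s Xf0 by auto
      next
        case 3
        then show ?thesis using c(2)[of "s0 - s"] d(2)[of "s0 - s"] s Xf0 by auto
      qed (simp add: Xf0)
    qed (use a b c d in auto)
  qed
  define \<delta> where "\<delta> = Min {d0, d1, 1/4}"
  have \<delta>: "\<delta> > 0" "\<delta> \<le> d0" "\<delta> \<le> d1" "\<delta> \<le> 1/4"
    using d0(1) d1(1) by (auto simp: \<delta>_def)
  \<comment> \<open>\<open>K\<close> is the rest of one period. It is compact and misses the
    crossing, so a small square in the chart meets the curve only in the branch near
    \<open>s0\<close>.\<close>
  define K where "K = (\<lambda>t. sgn (f t)) ` {s0 + \<delta> .. s0 + 1 - \<delta>}"
  have "compact K"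
    unfolding K_def by (intro compact_continuous_image continuous_on_sgn contf) (use f0 in auto)
  then have "open (- K)"
    by (simp add: compact_imp_closed open_Compl)
  have "sgn P \<notin> K"
  proof
    assume "sgn P \<in> K"
    then obtain t where t: "t \<in> {s0 + \<delta> .. s0 + 1 - \<delta>}" "sgn (f s0) = sgn (f t)"
      by (auto simp: K_def P_def)
    then obtain k :: int where "t - s0 = of_int k"
      using per[of t s0] by (auto elim: Ints_cases)
    moreover have "0 < t - s0" "t - s0 < 1"
      using t \<delta> by auto
    ultimately show False by auto
  qed
  moreover have "\<nu> (0, 0) = sgn P"
    by (simp add: \<nu>_def q_def)
  ultimately have "(0, 0) \<in> \<nu> -` (- K)" by simp
  moreover have "open (\<nu> -` (- K))"
    by (rule open_vimage[OF \<open>open (- K)\<close> cont\<nu>])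
  ultimately obtain e where e: "e > 0" "ball (0, 0) e \<subseteq> \<nu> -` (- K)"
    using open_contains_ball by blast
  define r where "r = e / 2"
  have r: "r > 0" using e by (simp add: r_def)
  have rK: "\<nu> (X, Y) \<notin> K" if "\<bar>X\<bar> < r" "\<bar>Y\<bar> < r" for X Y
  proof -
    have "norm (- X, - Y) \<le> \<bar>X\<bar> + \<bar>Y\<bar>"
      using norm_Pair_le[of "- X" "- Y"] by simp
    then have "(X, Y) \<in> ball (0, 0) e"
      using that by (simp add: r_def dist_norm)
    then show ?thesis using e by blast
  qed
  have local: "\<exists>s. \<bar>s - s0\<bar> < \<delta> \<and> X = Xf s \<and> Y = Yf s"
    if on: "\<nu> (X, Y) \<in> ?\<Gamma>" and XYr: "\<bar>X\<bar> < r" "\<bar>Y\<bar> < r" for X Y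
  proof -
    obtain s1 where s1: "\<nu> (X, Y) = sgn (f s1)" using on by auto
    define s where "s = s1 - of_int \<lfloor>s1 - (s0 - \<delta>)\<rfloor>"
    have "sgn (f s) = sgn (f s1)"
      using per by (simp add: s_def)
    then have s: "\<nu> (X, Y) = sgn (f s)" using s1 by simp
    have "s0 - \<delta> \<le> s" "s < s0 - \<delta> + 1"
      unfolding s_def by linarith+
    moreover have "s \<notin> {s0 + \<delta> .. s0 + 1 - \<delta>}"
      using rK[OF XYr] s by (auto simp: K_def)
    moreover have "s \<noteq> s0 - \<delta>"
    proof
      assume "s = s0 - \<delta>"
      then have "sgn (f (s0 + 1 - \<delta>)) = sgn (f s)"
        using per by simp
      then have "\<nu> (X, Y) \<in> K"
        using s \<delta> by (auto simp: K_def intro!: image_eqI[of _ _ "s0 + 1 - \<delta>"])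
      then show False using rK[OF XYr] by simp
    qed
    ultimately have "\<bar>s - s0\<bar> < \<delta>" by auto
    then show ?thesis
      using of_\<nu>[OF s f0] by (auto simp: Xf_def Yf_def)
  qed
  have thin: "\<bar>Y\<bar> \<le> \<bar>X\<bar> / 2" if "\<nu> (X, Y) \<in> ?\<Gamma>" "\<bar>X\<bar> < r" "\<bar>Y\<bar> < r" for X Y
    using local[OF that] d1 \<delta> by fastforce
  have unique: "Y = Y'" if "\<nu> (X, Y) \<in> ?\<Gamma>" "\<nu> (X, Y') \<in> ?\<Gamma>" "\<bar>X\<bar> < r" "\<bar>Y\<bar> < r" "\<bar>Y'\<bar> < r" for X Y Y'
    using local[OF that(1,3,4)] local[OF that(2,3,5)] injX \<delta> by (smt (verit, ccfv_threshold))
  define Kp where "Kp = {z. \<bar>fst z\<bar> < r \<and> \<bar>snd z\<bar> < r \<and> \<bar>fst z\<bar> / 2 < (snd z :: real)}"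
  define Km where "Km = {z. \<bar>fst z\<bar> < r \<and> \<bar>snd z\<bar> < r \<and> \<bar>fst z\<bar> / 2 < - (snd z :: real)}"
  have side: "\<nu> ` C \<subseteq> V"
    if "connected C" "\<And>z. z \<in> C \<Longrightarrow> \<nu> z \<notin> ?\<Gamma>" "z \<in> C" "\<nu> z \<in> V" "V = U \<or> V = W" for C z V
  proof -
    have con: "connected (\<nu> ` C)"
      by (rule connected_continuous_image[OF cont\<nu> that(1)])
    have sub: "\<nu> ` C \<subseteq> U \<union> W"
      unfolding UW(2) by (intro image_subsetI DiffI \<nu>S that(2))
    show ?thesis
      using that(5)
    proof
      assume "V = U"
      then show ?thesis
        using connected_subset_one_side[OF con sub UW(1,3,4)] that by blast
    next
      assume "V = W"
      then show ?thesis
        using connected_subset_one_side[OF con _ _ UW(4,3)] sub UW(1) that by blast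
    qed
  qed
  have "Kp = {z. inner (1, 0) z < r} \<inter> {z. inner (- 1, 0) z < r} \<inter> {z. inner (0, 1) z < r} \<inter>
      {z. inner (1/2, - 1) z < 0} \<inter> {z. inner (- 1/2, - 1) z < 0}"
    by (auto simp: Kp_def inner_prod_def)
  then have conKp: "connected Kp"
    by (simp only:) (intro convex_connected convex_Int convex_halfspace_lt)
  have "Km = {z. inner (1, 0) z < r} \<inter> {z. inner (- 1, 0) z < r} \<inter> {z. inner (0, - 1) z < r} \<inter>
      {z. inner (1/2, 1) z < 0} \<inter> {z. inner (- 1/2, 1) z < 0}"
    by (auto simp: Km_def inner_prod_def)
  then have conKm: "connected Km"
    by (simp only:) (intro convex_connected convex_Int convex_halfspace_lt)
  have Kfree: "\<nu> z \<notin> ?\<Gamma>" if "z \<in> Kp \<or> z \<in> Km" for z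
    using thin[of "fst z" "snd z"] that by (auto simp: Kp_def Km_def)
  have zp: "(0, r / 2) \<in> Kp" and zm: "(0, - r / 2) \<in> Km"
    using r by (auto simp: Kp_def Km_def)
  obtain V V' where V: "V = U \<and> V' = W \<or> V = W \<and> V' = U" "\<nu> (0, r / 2) \<in> V"
  proof -
    have "\<nu> (0, r / 2) \<in> U \<union> W"
      unfolding UW(2) using \<nu>S Kfree zp by (intro DiffI) simp_all
    then show thesis
      using that[of U W] that[of W U] by fast
  qed
  have VUW: "V = U \<or> V = W" "V \<inter> V' = {}" "V' \<inter> ?\<Gamma> = {}" "?\<Gamma> \<subseteq> closure V'" "U \<union> W = V \<union> V'" "V' \<subseteq> \<S>"
  proof -
    have d: "W \<inter> U = {}" "U \<inter> ?\<Gamma> = {}" "W \<inter> ?\<Gamma> = {}" "U \<subseteq> \<S>" "W \<subseteq> \<S>"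
      using UW(1,2) by fast+
    show "V = U \<or> V = W" "V \<inter> V' = {}" "V' \<inter> ?\<Gamma> = {}" "?\<Gamma> \<subseteq> closure V'" "U \<union> W = V \<union> V'" "V' \<subseteq> \<S>"
      using V(1) d UW(1,5,6) by (elim disjE conjE; simp add: Un_commute)+
  qed
  have KpV: "\<nu> ` Kp \<subseteq> V"
    by (rule side[OF conKp _ zp V(2) VUW(1)]) (use Kfree in simp)
  have "\<nu> (0, - r / 2) \<notin> V"
  proof
    assume mV: "\<nu> (0, - r / 2) \<in> V"
    have KmV: "\<nu> ` Km \<subseteq> V"
      by (rule side[OF conKm _ zm mV VUW(1)]) (use Kfree in simp)
    have all: "\<nu> (X, Y) \<in> V" if XY: "\<bar>X\<bar> < r" "\<bar>Y\<bar> < r" "\<nu> (X, Y) \<notin> ?\<Gamma>" for X Y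
    proof -
      \<comment> \<open>As \<open>\<bar>X\<bar> / 2 < r / 2\<close>, heights of absolute value at
        least \<open>3 * r / 4\<close> and below \<open>r\<close> lie in the cones.\<close>
      define Y1 Y2 where "Y1 = max Y (3 * r / 4)" and "Y2 = min Y (- 3 * r / 4)"
      have Y12: "Y \<le> Y1" "Y2 \<le> Y" "(X, Y1) \<in> Kp" "(X, Y2) \<in> Km" "Y1 < r" "- r < Y2"
        using XY r by (auto simp: Y1_def Y2_def Kp_def Km_def)
      have seg: "connected ({X} \<times> {a..b :: real})" for a b
        by (intro connected_Times) auto
      \<comment> \<open>The two vertical segments share only the given point, which is off the
        curve, and the curve meets this vertical line at most once inside the square; so one segment
        is free.\<close>
      have "(\<forall>y\<in>{Y..Y1}. \<nu> (X, y) \<notin> ?\<Gamma>) \<or> (\<forall>y\<in>{Y2..Y}. \<nu> (X, y) \<notin> ?\<Gamma>)"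
      proof (rule ccontr)
        assume "\<not> ?thesis"
        then obtain a b where ab: "a \<in> {Y..Y1}" "\<nu> (X, a) \<in> ?\<Gamma>" "b \<in> {Y2..Y}" "\<nu> (X, b) \<in> ?\<Gamma>"
          by blast
        then have "a = b"
          by (intro unique[of X]) (use XY Y12 in auto)
        then have "a = Y" using ab by auto
        then show False using ab XY by blast
      qed
      then show ?thesis
      proof
        assume free: "\<forall>y\<in>{Y..Y1}. \<nu> (X, y) \<notin> ?\<Gamma>"
        have "(X, Y1) \<in> {X} \<times> {Y..Y1}" "\<nu> (X, Y1) \<in> V"
          using Y12 KpV by auto
        then have "\<nu> ` ({X} \<times> {Y..Y1}) \<subseteq> V"
          by (intro side[OF seg _ _ _ VUW(1)]) (use free in auto)
        then show ?thesis using Y12 by auto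
      next
        assume free: "\<forall>y\<in>{Y2..Y}. \<nu> (X, y) \<notin> ?\<Gamma>"
        have "(X, Y2) \<in> {X} \<times> {Y2..Y}" "\<nu> (X, Y2) \<in> V"
          using Y12 KmV by auto
        then have "\<nu> ` ({X} \<times> {Y2..Y}) \<subseteq> V"
          by (intro side[OF seg _ _ _ VUW(1)]) (use free in auto)
        then show ?thesis using Y12 by auto
      qed
    qed
    \<comment> \<open>A neighbourhood of the crossing in homogeneous coordinates, corresponding to
      the square in the chart. It must meet \<open>V'\<close>, because the crossing is in the
      closure of \<open>V'\<close>.\<close>
    define N where "N = {w. 0 < \<alpha> w} \<inter> {w. \<bar>x w\<bar> < r * \<alpha> w} \<inter> {w. \<bar>y w\<bar> < r * \<alpha> w}"
    have "open N"
      unfolding N_def using contl[OF bl(1) continuous_on_id] contl[OF bl(2) continuous_on_id] contl[OF bl(3) continuous_on_id]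
      by (intro open_Int open_Collect_less continuous_intros) auto
    moreover have "sgn P \<in> N"
      using b r f0[of s0] bl by (simp add: N_def sgn_div_norm linear_simps P_def[symmetric])
    moreover have "sgn P \<in> closure V'"
      using VUW(4) by (auto simp: P_def)
    ultimately obtain w where w: "w \<in> V'" "w \<in> N"
      using open_Int_closure_eq_empty[of N V'] by (metis IntI IntE empty_iff ex_in_conv)
    then have "\<alpha> w > 0" "\<bar>x w\<bar> / \<alpha> w < r" "\<bar>y w\<bar> / \<alpha> w < r"
      by (auto simp: N_def divide_less_eq)
    moreover have "sgn w = w"
      using w(1) VUW(6) by (auto simp: mem_sphere_0 sgn_div_norm)
    ultimately have "w \<in> V"
      using all[of "x w / \<alpha> w" "y w / \<alpha> w"] \<nu>_of[of w] w(1) VUW(3) by auto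
    then show False using w(1) VUW(2) by blast
  qed
  moreover have "\<nu> (0, - r / 2) \<in> V \<union> V'"
    unfolding VUW(5)[symmetric] UW(2) using \<nu>S Kfree zm by (intro DiffI) simp_all
  ultimately have mV': "\<nu> (0, - r / 2) \<in> V'" by blast
  have KmV': "\<nu> ` Km \<subseteq> V'"
    by (rule side[OF conKm _ zm mV']) (use Kfree V(1) in simp_all, fast)
  define Xh Yh where "Xh t = x (h t) / \<alpha> (h t)" and "Yh t = y (h t) / \<alpha> (h t)" for t
  have ht0: "\<alpha> (h t0) = c" "x (h t0) = 0" "y (h t0) = 0"
    using h(2) b bl by (simp_all add: P_def[symmetric] linear_simps)
  \<comment> \<open>In the chart \<open>h\<close> passes the crossing with velocity along the Y
    axis, so it runs from the lower cone into the upper one.\<close>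
  have dXh: "(Xh has_real_derivative 0) (at t0)" and dYh: "(Yh has_real_derivative 1 / c) (at t0)"
    using DERIV_divide[OF derl[OF bl(2) h(1)] derl[OF bl(1) h(1)]]
      DERIV_divide[OF derl[OF bl(3) h(1)] derl[OF bl(1) h(1)]] ht0 b h(3)
    by (simp_all add: Xh_def[abs_def] Yh_def[abs_def])
  have "Xh t0 = 0" "Yh t0 = 0"
    using ht0 by (simp_all add: Xh_def Yh_def)
  have tendX: "(Xh \<longlongrightarrow> 0) (at t0)" and tendY: "(Yh \<longlongrightarrow> 0) (at t0)" and tenda: "((\<lambda>t. \<alpha> (h t)) \<longlongrightarrow> c) (at t0)"
    using DERIV_isCont[OF dXh] DERIV_isCont[OF dYh] DERIV_isCont[OF derl[OF bl(1) h(1)]] ht0 \<open>Xh t0 = 0\<close> \<open>Yh t0 = 0\<close>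
    by (simp_all add: isCont_def)
  have "\<forall>\<^sub>F t in at t0. \<bar>Xh t\<bar> < r \<and> \<bar>Yh t\<bar> < r \<and> 0 < \<alpha> (h t)"
    using tendX tendY r h(3) tendstoD[OF tendX r] tendstoD[OF tendY r] order_tendstoD(1)[OF tenda h(3)]
    by (simp add: eventually_conj_iff)
  then obtain d where d: "d > 0" "\<And>t. t \<noteq> t0 \<Longrightarrow> \<bar>t - t0\<bar> < d \<Longrightarrow> \<bar>Xh t\<bar> < r \<and> \<bar>Yh t\<bar> < r \<and> 0 < \<alpha> (h t)"
    unfolding eventually_at by (auto simp: dist_real_def)
  have p2: "((\<lambda>t. Yh t - Xh t / 2) has_real_derivative 1/c) (at t0)"
    "((\<lambda>t. Yh t + Xh t / 2) has_real_derivative 1/c) (at t0)"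
    by (auto intro!: derivative_eq_intros dXh dYh)
  have c: "1 / c > 0" using h(3) by simp
  obtain a1 where a1: "a1 > 0" "\<And>u. 0 < u \<Longrightarrow> u < a1 \<Longrightarrow> 0 < Yh (t0 + u) - Xh (t0 + u) / 2"
    using DERIV_pos_inc_right[OF p2(1) c] \<open>Xh t0 = 0\<close> \<open>Yh t0 = 0\<close> by auto
  obtain a2 where a2: "a2 > 0" "\<And>u. 0 < u \<Longrightarrow> u < a2 \<Longrightarrow> 0 < Yh (t0 + u) + Xh (t0 + u) / 2"
    using DERIV_pos_inc_right[OF p2(2) c] \<open>Xh t0 = 0\<close> \<open>Yh t0 = 0\<close> by auto
  obtain a3 where a3: "a3 > 0" "\<And>u. 0 < u \<Longrightarrow> u < a3 \<Longrightarrow> 0 > Yh (t0 - u) - Xh (t0 - u) / 2"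
    using DERIV_pos_inc_left[OF p2(1) c] \<open>Xh t0 = 0\<close> \<open>Yh t0 = 0\<close> by auto
  obtain a4 where a4: "a4 > 0" "\<And>u. 0 < u \<Longrightarrow> u < a4 \<Longrightarrow> 0 > Yh (t0 - u) + Xh (t0 - u) / 2"
    using DERIV_pos_inc_left[OF p2(2) c] \<open>Xh t0 = 0\<close> \<open>Yh t0 = 0\<close> by auto
  show thesis
  proof (rule that[of V "Min {d, a1, a2, a3, a4}"])
    fix t assume t: "0 < t" "t < Min {d, a1, a2, a3, a4}"
    have "(Xh (t0 + t), Yh (t0 + t)) \<in> Kp" "0 < \<alpha> (h (t0 + t))"
      using d(2)[of "t0 + t"] a1(2)[of t] a2(2)[of t] t by (auto simp: Kp_def)
    then show "sgn (h (t0 + t)) \<in> V"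
      using KpV \<nu>_of[of "h (t0 + t)"] unfolding Xh_def Yh_def by (metis image_subset_iff)
    have "(Xh (t0 - t), Yh (t0 - t)) \<in> Km" "0 < \<alpha> (h (t0 - t))"
      using d(2)[of "t0 - t"] a3(2)[of t] a4(2)[of t] t by (auto simp: Km_def)
    then have "sgn (h (t0 - t)) \<in> V'"
      using KmV' \<nu>_of[of "h (t0 - t)"] unfolding Xh_def Yh_def by (metis image_subset_iff)
    then show "sgn (h (t0 - t)) \<in> U \<union> W - V"
      using VUW(2,5) by blast
  qed (use VUW(1) d a1 a2 a3 a4 in auto)
qed

section \<open>Projective points as antipodal pairs on the sphere\<close>

lemma span_singleton_eq_iff:
  fixes u v :: "'a :: real_vector"
  assumes "u \<noteq> 0"
  shows "span {u} = span {v} \<longleftrightarrow> (\<exists>c. c \<noteq> 0 \<and> u = c *\<^sub>R v)"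
proof
  assume "span {u} = span {v}"
  then have "u \<in> span {v}"
    using span_base by blast
  then obtain c where "u = c *\<^sub>R v"
    by (auto simp: span_singleton)
  then show "\<exists>c. c \<noteq> 0 \<and> u = c *\<^sub>R v"
    using assms by (intro exI[of _ c]) auto
next
  assume "\<exists>c. c \<noteq> 0 \<and> u = c *\<^sub>R v"
  then obtain c where c: "c \<noteq> 0" "u = c *\<^sub>R v" by blast
  then have "v = (1 / c) *\<^sub>R u"
    by simp
  then have "v \<in> span {u}"
    by (metis span_base span_scale singletonI)
  moreover have "u \<in> span {v}"
    unfolding c(2) by (simp add: span_base span_scale)
  ultimately show "span {u} = span {v}"
    by (intro equalityI span_minimal) (auto simp: subspace_span)
qed

lemma proj_eq_iff:
  assumes "u \<noteq> 0" "v \<noteq> 0"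
  shows "proj u = proj v \<longleftrightarrow> (\<exists>c. c \<noteq> 0 \<and> u = c *\<^sub>R v)"
proof -
  have "span {w} \<in> {S. subspace S \<and> dim S = 1}" if "w \<noteq> 0" for w :: "real ^ 3"
    using that by (simp add: dim_singleton)
  then have "proj u = proj v \<longleftrightarrow> span {u} = span {v}"
    unfolding proj_def using assms by (intro Abs_proj_plane_inject)
  then show ?thesis
    using span_singleton_eq_iff[OF assms(1)] by simp
qed

lemma sphere_nonzero: "x \<in> \<S> \<Longrightarrow> x \<noteq> 0"
  by (auto simp: mem_sphere_0)

lemma proj_sphere_eq_iff:
  assumes "x \<in> \<S>" "y \<in> \<S>"
  shows "proj x = proj y \<longleftrightarrow> x = y \<or> x = - y"
proof -
  have "\<bar>c\<bar> = 1" if "x = c *\<^sub>R y" for c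
    using assms that by (simp add: mem_sphere_0)
  then have "(\<exists>c. c \<noteq> 0 \<and> x = c *\<^sub>R y) \<longleftrightarrow> x = y \<or> x = - y"
    by (auto simp: abs_eq_iff' intro: exI[of _ 1] exI[of _ "- 1"])
      (metis abs_eq_iff abs_one scaleR_minus1_left scaleR_one)
  then show ?thesis
    using proj_eq_iff[of x y] assms by (simp add: sphere_nonzero)
qed

lemma proj_sgn [simp]: "v \<noteq> 0 \<Longrightarrow> proj (sgn v) = proj v"
  by (subst proj_eq_iff) (auto simp: sgn_zero_iff sgn_div_norm intro!: exI[of _ "inverse (norm v)"])

lemma sgn_in_sphere: "v \<noteq> 0 \<Longrightarrow> sgn v \<in> \<S>"
  by (simp add: mem_sphere_0 norm_sgn)

lemma proj_surj: obtains x where "x \<in> \<S>" "proj x = p"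
proof (cases p)
  case (Abs_proj_plane L)
  then have L: "subspace L" "dim L = 1" by auto
  then obtain v where v: "v \<in> L" "v \<noteq> 0"
    by (metis dim_eq_0 singletonI subsetI zero_neq_one)
  have "span {v} = L"
    by (rule subspace_dim_equal[OF subspace_span L(1)]) (use v L in \<open>auto simp: span_minimal dim_singleton\<close>)
  then show thesis
    using that[of "sgn v"] v Abs_proj_plane by (simp add: sgn_in_sphere) (simp add: proj_def)
qed

lemma parametrizesD:
  assumes "parametrizes f l"
  shows "f t \<noteq> 0" "(f has_vector_derivative vector_derivative f (at t)) (at t)"
    "continuous_on UNIV (\<lambda>t. vector_derivative f (at t))"
    "vector_derivative f (at t) \<notin> span {f t}" "proj (f s) = proj (f t) \<longleftrightarrow> s - t \<in> \<int>"
    "l = range (\<lambda>t. proj (f t))" "continuous_on UNIV (\<lambda>t. sgn (f t))"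
proof -
  have 0: "smooth f" "\<And>t. f t \<noteq> 0"
    using assms by (auto simp: parametrizes_def)
  have d: "f differentiable (at t)" "(\<lambda>t. vector_derivative f (at t)) differentiable (at t)" for t
    using 0(1)[unfolded smooth_def, rule_format, of 0 t] 0(1)[unfolded smooth_def, rule_format, of 1 t] by simp_all
  show "f t \<noteq> 0" by (fact 0)
  show "(f has_vector_derivative vector_derivative f (at t)) (at t)"
    using d vector_derivative_works by blast
  show "continuous_on UNIV (\<lambda>t. vector_derivative f (at t))"
    using d by (simp add: continuous_at_imp_continuous_on differentiable_imp_continuous_within)
  show "continuous_on UNIV (\<lambda>t. sgn (f t))"
    using d 0 by (intro continuous_on_sgn continuous_at_imp_continuous_on) (auto simp: differentiable_imp_continuous_within)
qed (use assms in \<open>auto simp: parametrizes_def\<close>)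

text \<open>The shift by one period multiplies the unit lift by a sign. The parameters for either
  sign form a closed set, and the reals are connected.\<close>

lemma parametrizes_period:
  assumes "parametrizes f l"
  shows "(\<forall>t. sgn (f (t + 1)) = sgn (f t)) \<or> (\<forall>t. sgn (f (t + 1)) = - sgn (f t))"
proof -
  let ?g = "\<lambda>t. sgn (f t)"
  note P = parametrizesD[OF assms]
  have gS: "?g t \<in> \<S>" for t
    using P(1) by (rule sgn_in_sphere)
  have cont1: "continuous_on UNIV (\<lambda>t. ?g (t + 1))"
    by (rule continuous_on_compose2[OF P(7)]) (auto intro!: continuous_intros)
  have "proj (?g (t + 1)) = proj (?g t)" for t
    using P(1) P(5)[of "t + 1" t] by simp
  then have cov: "?g (t + 1) = ?g t \<or> ?g (t + 1) = - ?g t" for t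
    using proj_sphere_eq_iff gS by metis
  have cl: "closed {t. ?g (t + 1) = ?g t}" "closed {t. ?g (t + 1) = - ?g t}"
    by (intro closed_Collect_eq cont1 P(7) continuous_intros)+
  have disj: "{t. ?g (t + 1) = ?g t} \<inter> {t. ?g (t + 1) = - ?g t} = {}"
    using sphere_neq_minus(2)[OF gS] by (simp add: disjoint_iff)
  show ?thesis
    using connected_closedD[OF connected_UNIV, of "{t. ?g (t + 1) = ?g t}" "{t. ?g (t + 1) = - ?g t}"] cl disj cov
    by auto
qed

text \<open>
  Otherwise the lift of \<open>l\<close> is a closed curve that is disjoint from its antipode, and a lift of \<open>m\<close>
  would cross it in a single point, although it would have to return to the side where it started.
\<close>

lemma transversal_imp_antipodal:
  assumes f: "parametrizes f l" and h: "parametrizes h m" and lm: "l \<inter> m = {p}"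
    and p: "proj (f s0) = p" "proj (h t0) = p" and tan: "tangent f s0 \<noteq> tangent h t0"
  shows "sgn (f (t + 1)) = - sgn (f t)"
proof (rule ccontr)
  note F = parametrizesD[OF f] and H = parametrizesD[OF h]
  assume "sgn (f (t + 1)) \<noteq> - sgn (f t)"
  then have per1: "\<And>t. sgn (f (t + 1)) = sgn (f t)"
    using parametrizes_period[OF f] by blast
  have gS: "sgn (f t) \<in> \<S>" for t
    using F(1) by (rule sgn_in_sphere)
  have perk: "sgn (f (t + of_int k)) = sgn (f t)" for t k
  proof (induction k rule: int_induct[where k = 0])
    case (step1 i)
    then show ?case using per1[of "t + of_int i"] by (simp add: add.assoc)
  next
    case (step2 i)
    then show ?case using per1[of "t + of_int (i - 1)"] by (simp add: algebra_simps)
  qed simp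
  have per: "sgn (f s) = sgn (f t) \<longleftrightarrow> s - t \<in> \<int>" for s t
  proof
    assume "sgn (f s) = sgn (f t)"
    then have "proj (f s) = proj (f t)"
      using F(1) proj_sgn by metis
    then show "s - t \<in> \<int>" using F(5) by blast
  next
    assume "s - t \<in> \<int>"
    then obtain k where "s = t + of_int k"
      by (metis Ints_cases add.commute diff_add_cancel)
    then show "sgn (f s) = sgn (f t)" using perk by simp
  qed
  let ?\<Gamma> = "range (\<lambda>t. sgn (f t))"
  let ?c = "\<lambda>t. sgn (f t)"
  have simple: "simple_path ?c"
    unfolding simple_path_def loop_free_def path_def
  proof (intro conjI ballI impI)
    show "continuous_on {0..1} ?c"
      using F(7) continuous_on_subset by blast
    fix s t :: real assume st: "s \<in> {0..1}" "t \<in> {0..1}" "?c s = ?c t"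
    then obtain k :: int where k: "s - t = of_int k"
      using per by (metis Ints_cases)
    have "real_of_int k \<le> 1" "- 1 \<le> real_of_int k"
      using st k by (auto simp flip: k)
    then have "k \<in> {- 1, 0, 1}" by auto
    then show "s = t \<or> s = 0 \<and> t = 1 \<or> s = 1 \<and> t = 0"
      using k st by auto
  qed
  have loop: "pathfinish ?c = pathstart ?c"
    using per1[of 0] by (simp add: pathfinish_def pathstart_def)
  have im: "path_image ?c = ?\<Gamma>"
  proof -
    have "sgn (f t) \<in> ?c ` {0..1}" for t
    proof (rule image_eqI)
      show "sgn (f t) = ?c (t - of_int \<lfloor>t\<rfloor>)"
        using perk[of t "- \<lfloor>t\<rfloor>"] by simp
      show "t - of_int \<lfloor>t\<rfloor> \<in> {0..1}"
        unfolding atLeastAtMost_iff by linarith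
    qed
    then show ?thesis by (auto simp: path_image_def)
  qed
  obtain c U W where UW: "openin (top_of_set \<S>) U" "openin (top_of_set \<S>) W" "connected U" "connected W"
    "U \<inter> W = {}" "U \<union> W = \<S> - ?\<Gamma>" "?\<Gamma> \<subseteq> closure U" "?\<Gamma> \<subseteq> closure W"
  proof (rule jordan_curve_sphere[OF simple loop])
    show "path_image ?c \<subseteq> \<S>"
      unfolding im using gS by (simp add: image_subset_iff)
  qed (unfold im, rule_tac U = U and W = W in that, assumption+)
  obtain c0 where c0: "c0 \<noteq> 0" "h t0 = c0 *\<^sub>R f s0"
    using p proj_eq_iff[OF H(1) F(1)] by metis
  \<comment> \<open>Of the two lifts of \<open>m\<close> up to sign, the one that passes through the
    same point of the sphere as \<open>f\<close> at \<open>s0\<close>, not through its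
    antipode.\<close>
  define k where "k t = sgn c0 *\<^sub>R h t" for t
  have k0: "k t \<noteq> 0" for t
    using c0 H(1) by (simp add: k_def sgn_zero_iff)
  have kS: "sgn (k t) \<in> \<S>" for t
    using k0 by (rule sgn_in_sphere)
  have projk: "proj (sgn (k t)) = proj (h t)" for t
    using k0 H(1) c0 by (simp add: proj_eq_iff) (auto simp: k_def sgn_zero_iff)
  let ?H = "vector_derivative h (at t0)"
  have dk: "(k has_vector_derivative sgn c0 *\<^sub>R ?H) (at t0)"
    unfolding k_def using H(2) by (auto intro!: derivative_eq_intros)
  have kt0: "k t0 = \<bar>c0\<bar> *\<^sub>R f s0"
    by (simp add: k_def c0(2) abs_sgn mult.commute)
  have ind: "sgn c0 *\<^sub>R ?H \<notin> span {f s0, vector_derivative f (at s0)}"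
  proof
    assume "sgn c0 *\<^sub>R ?H \<in> span {f s0, vector_derivative f (at s0)}"
    then have "?H \<in> tangent f s0"
      using c0(1) unfolding tangent_def by (metis sgn_zero_iff span_scale scaleR_scaleR left_inverse scaleR_one)
    moreover have "h t0 \<in> tangent f s0"
      unfolding c0(2) tangent_def by (simp add: span_base span_scale)
    ultimately have "tangent h t0 \<subseteq> tangent f s0"
      unfolding tangent_def by (intro span_minimal) (auto simp: subspace_span)
    moreover have "dim (tangent f s0) = 2" "dim (tangent h t0) = 2"
    proof -
      have "dim (span {a, b}) = 2" if "a \<noteq> 0" "b \<notin> span {a}" for a b :: "real ^ 3"
      proof -
        have "a \<noteq> b" using that span_base by blast
        moreover have "independent {b, a}"
          using that by (simp add: independent_insert)
        ultimately show ?thesis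
          using dim_eq_card_independent[of "{b, a}"] by (simp add: insert_commute)
      qed
      then show "dim (tangent f s0) = 2" "dim (tangent h t0) = 2"
        unfolding tangent_def using F(1,4) H(1,4) by blast+
    qed
    ultimately have "tangent h t0 = tangent f s0"
      by (intro subspace_dim_equal) (auto simp: tangent_def)
    then show False using tan by simp
  qed
  obtain V d where V: "V = U \<or> V = W" "d > 0"
    "\<And>t. 0 < t \<Longrightarrow> t < d \<Longrightarrow> sgn (k (t0 + t)) \<in> V"
    "\<And>t. 0 < t \<Longrightarrow> t < d \<Longrightarrow> sgn (k (t0 - t)) \<in> U \<union> W - V"
  proof (rule transversal_curve_changes_side[OF F(1) F(2) F(3) per UW(5,6,1,2,7,8) dk kt0 _ F(4) ind])
    show "\<bar>c0\<bar> > 0" using c0 by simp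
  qed (rule that)
  define e where "e = min (d / 2) (1 / 4)"
  have e: "0 < e" "e < d" "e \<le> 1/4" using V(2) by (auto simp: e_def)
  have meets: "t - t0 \<in> \<int>" if on: "sgn (k t) \<in> ?\<Gamma>" for t
  proof -
    obtain s where "sgn (k t) = sgn (f s)" using on by blast
    then have "proj (h t) = proj (f s)"
      using projk F(1) proj_sgn by metis
    then have "proj (h t) \<in> l \<inter> m"
      using F(6) H(6) by (metis IntI rangeI)
    then have "proj (h t) = proj (h t0)"
      using lm p(2) by simp
    then show ?thesis
      using H(5) by blast
  qed
  have contk: "continuous_on X (\<lambda>t. sgn (k t))" for X
    unfolding k_def sgn_scaleR
    by (intro continuous_on_scaleR continuous_on_const continuous_on_subset[OF H(7)]) simp
  \<comment> \<open>An arc of \<open>m\<close> off the curve stays on one side; but just after the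
    crossing it is in \<open>V\<close>, and just before the crossing it is not.\<close>
  have noncross: False if "b > t0 + e" "\<And>t. t \<in> {t0 + e..b} \<Longrightarrow> sgn (k t) \<notin> ?\<Gamma>" "sgn (k b) = sgn (k (t0 - e))" for b
  proof -
    let ?C = "(\<lambda>t. sgn (k t)) ` {t0 + e..b}"
    have con: "connected ?C"
      by (intro connected_continuous_image contk) auto
    have sub: "?C \<subseteq> U \<union> W"
      unfolding UW(6) by (intro image_subsetI DiffI kS that(2))
    have inV: "sgn (k (t0 + e)) \<in> V" "sgn (k (t0 + e)) \<in> ?C"
      using V(3) e that(1) by auto
    have outV: "sgn (k b) \<in> ?C" "sgn (k b) \<notin> V"
      using that(1) by (simp, use V(4)[of e] e that(3) in auto)
    show False
      using V(1)
    proof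
      assume "V = U"
      then have "?C \<subseteq> U"
        using connected_subset_one_side[OF con sub UW(5,1,2)] inV by blast
      then show False using outV \<open>V = U\<close> by blast
    next
      assume "V = W"
      then have "?C \<subseteq> W"
        using connected_subset_one_side[OF con _ _ UW(2,1)] sub UW(5) inV by (metis Int_commute Un_commute IntI empty_iff)
      then show False using outV \<open>V = W\<close> by blast
    qed
  qed
  show False
    using parametrizes_period[OF h]
  proof
    assume "\<forall>t. sgn (h (t + 1)) = sgn (h t)"
    then have "sgn (k (t0 + 1 - e)) = sgn (k (t0 - e))"
      by (metis add.commute add_diff_eq k_def sgn_scaleR diff_add_eq)
    moreover have "sgn (k t) \<notin> ?\<Gamma>" if "t \<in> {t0 + e..t0 + 1 - e}" for t
    proof
      assume "sgn (k t) \<in> ?\<Gamma>"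
      then obtain j :: int where "t - t0 = of_int j"
        using meets by (metis Ints_cases)
      moreover have "0 < t - t0" "t - t0 < 1" using that e by auto
      ultimately show False by auto
    qed
    ultimately show False
      using noncross[of "t0 + 1 - e"] e by auto
  next
    assume anti: "\<forall>t. sgn (h (t + 1)) = - sgn (h t)"
    then have kanti: "sgn (k (t + 1)) = - sgn (k t)" for t
      by (simp add: k_def sgn_scaleR)
    have "sgn (k (t0 + 2 - e)) = sgn (k (t0 - e))"
      using kanti[of "t0 + 1 - e"] kanti[of "t0 - e"] by (simp add: algebra_simps)
    \<comment> \<open>A lift of \<open>m\<close> with period 2 passes the antipode of the crossing
      halfway. This is no point of \<open>?\<Gamma>\<close>, because a lift of \<open>l\<close> with
      period 1 contains no antipodal pair.\<close>
    moreover have "sgn (k t) \<notin> ?\<Gamma>" if "t \<in> {t0 + e..t0 + 2 - e}" for t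
    proof
      assume on: "sgn (k t) \<in> ?\<Gamma>"
      then obtain j :: int where j: "t - t0 = of_int j"
        using meets by (metis Ints_cases)
      moreover have "0 < t - t0" "t - t0 < 2" using that e by auto
      ultimately have "j = 1" by auto
      then have "t = t0 + 1" using j by simp
      then have eq: "sgn (k t) = - sgn (f s0)"
        using kanti[of t0] kt0 c0 by (simp add: sgn_scaleR)
      obtain s where s: "sgn (k t) = sgn (f s)" using on by blast
      then have "proj (f s) = proj (f s0)"
        using eq F(1) gS proj_sgn proj_sphere_eq_iff by metis
      then have "sgn (f s) = sgn (f s0)"
        using F(5) per by blast
      then show False
        using eq s sphere_neq_minus[OF gS[of s0]] by simp
    qed
    ultimately show False
      using noncross[of "t0 + 2 - e"] e by auto
  qed
qed

lemma parametrizes_antipodal_curve: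
  assumes f: "parametrizes f l" and anti: "\<And>t. sgn (f (t + 1)) = - sgn (f t)"
  shows "antipodal_curve (\<lambda>t. sgn (f t))" "range (\<lambda>t. sgn (f t)) = {x \<in> \<S>. proj x \<in> l}"
proof -
  note F = parametrizesD[OF f]
  have gS: "sgn (f t) \<in> \<S>" for t
    using F(1) by (rule sgn_in_sphere)
  have iff: "sgn (f s) = sgn (f t) \<or> sgn (f s) = - sgn (f t) \<longleftrightarrow> s - t \<in> \<int>" for s t
    using proj_sphere_eq_iff[OF gS gS, of s t] F(1,5) by simp
  then show "antipodal_curve (\<lambda>t. sgn (f t))"
    using F(7) gS anti by (auto simp: antipodal_curve_def)
  show "range (\<lambda>t. sgn (f t)) = {x \<in> \<S>. proj x \<in> l}"
  proof (intro equalityI subsetI)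
    fix x assume "x \<in> {x \<in> \<S>. proj x \<in> l}"
    then obtain t where t: "x \<in> \<S>" "proj x = proj (f t)"
      using F(6) by auto
    then have "x = sgn (f t) \<or> x = - sgn (f t)"
      using proj_sphere_eq_iff[OF t(1) gS[of t]] t(2) F(1) by simp
    then show "x \<in> range (\<lambda>t. sgn (f t))"
      using anti[of t] by (metis rangeI)
  qed (use gS F(1,6) in auto)
qed

section \<open>Lifted arrangements\<close>

lemma side_functionD:
  assumes "side_function s L"
  shows "x \<in> \<S> \<Longrightarrow> s x = 1 \<or> s x = - 1 \<or> s x = 0" "x \<in> \<S> \<Longrightarrow> s (- x) = - s x"
    "{x \<in> \<S>. s x = 0} = L" "openin (top_of_set \<S>) {x \<in> \<S>. s x = 1}" "connected {x \<in> \<S>. s x = 1}"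
    "L \<subseteq> closure {x \<in> \<S>. s x = 1}"
  using assms by (auto simp: side_function_def)

lemma side_function_uminus:
  assumes "side_function s L"
  shows "side_function (\<lambda>x. - s x) L"
proof -
  note D = side_functionD[OF assms]
  have neg: "{x \<in> \<S>. - s x = 1} = uminus ` {x \<in> \<S>. s x = 1}"
  proof (intro equalityI subsetI)
    fix x assume "x \<in> {x \<in> \<S>. - s x = 1}"
    then have "- x \<in> {x \<in> \<S>. s x = 1}" using D(2) by auto
    then show "x \<in> uminus ` {x \<in> \<S>. s x = 1}" by (rule image_eqI[rotated]) simp
  qed (use D(2) in auto)
  have hom: "homeomorphism \<S> \<S> uminus (uminus :: real ^ 3 \<Rightarrow> real ^ 3)"
    by (rule homeomorphismI) (auto intro!: continuous_intros)
  have "openin (top_of_set \<S>) (uminus ` {x \<in> \<S>. s x = 1})"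
    using homeomorphism_imp_open_map[OF hom D(4)] .
  moreover have "connected (uminus ` {x \<in> \<S>. s x = 1})"
    by (intro connected_continuous_image continuous_intros D(5))
  moreover have "L \<subseteq> closure (uminus ` {x \<in> \<S>. s x = 1})"
  proof
    fix x assume "x \<in> L"
    then have "- x \<in> L" using D(2,3) by auto
    then have "- x \<in> closure {x \<in> \<S>. s x = 1}" using D(6) by blast
    moreover have "uminus ` closure {x \<in> \<S>. s x = 1} \<subseteq> closure (uminus ` {x \<in> \<S>. s x = 1})"
      by (intro image_closure_subset continuous_intros closed_closure closure_subset)
    ultimately have "- (- x) \<in> closure (uminus ` {x \<in> \<S>. s x = 1})" by blast
    then show "x \<in> closure (uminus ` {x \<in> \<S>. s x = 1})" by simp
  qed
  ultimately show ?thesis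
    unfolding side_function_def neg using D(1,2,3) by auto
qed

lemma side_function_le_closed:
  assumes "side_function s L"
  shows "closed {x \<in> \<S>. s x \<le> 0}" "\<S> - {x \<in> \<S>. s x \<le> 0} = {x \<in> \<S>. s x = 1}"
proof -
  note D = side_functionD[OF assms]
  show eq: "\<S> - {x \<in> \<S>. s x \<le> 0} = {x \<in> \<S>. s x = 1}"
    using D(1) by force
  have "{x \<in> \<S>. s x \<le> 0} = \<S> - {x \<in> \<S>. s x = 1}"
    using D(1) by force
  moreover have "closedin (top_of_set \<S>) (\<S> - {x \<in> \<S>. s x = 1})"
    by (intro closedin_diff D(4)) simp
  ultimately show "closed {x \<in> \<S>. s x \<le> 0}"
    using closedin_closed_trans[OF _ closed_sphere] by simp
qed

section \<open>Crossings of two curves and closed lunes\<close>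

definition meet_once :: "(real ^ 3 \<Rightarrow> real) \<Rightarrow> (real ^ 3 \<Rightarrow> real) \<Rightarrow> bool" where
  "meet_once s s' \<longleftrightarrow> (\<exists>x \<in> \<S>. {y \<in> \<S>. s y = 0 \<and> s' y = 0} = {x, - x})"

text \<open>Consecutive zeros of \<open>s'\<close> along \<open>g\<close> are one period apart.
  Between them the arc is connected and avoids the other curve, so it stays on one side.\<close>

lemma crossing_parameter:
  assumes g: "antipodal_curve g" and s: "side_function s (range g)" and s': "side_function s' L"
    and one: "meet_once s s'"
  obtains u \<sigma> where "\<sigma> = 1 \<or> \<sigma> = - 1" "\<And>t. s' (g t) = 0 \<longleftrightarrow> t - u \<in> \<int>"
    "\<And>t. u < t \<Longrightarrow> t < u + 1 \<Longrightarrow> s' (g t) = \<sigma>"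
proof -
  note S = side_functionD[OF s] and S' = side_functionD[OF s']
  have G: "continuous_on UNIV g" "\<And>t. g t \<in> \<S>" "\<And>s t. g s = g t \<or> g s = - g t \<longleftrightarrow> s - t \<in> \<int>"
    using g by (auto simp: antipodal_curve_def)
  obtain x where x: "x \<in> \<S>" "{y \<in> \<S>. s y = 0 \<and> s' y = 0} = {x, - x}"
    using one by (auto simp: meet_once_def)
  have "x \<in> range g"
    using x S(3) by blast
  then obtain u where u: "x = g u" by blast
  have zero: "s' (g t) = 0 \<longleftrightarrow> t - u \<in> \<int>" for t
  proof -
    have "s (g t) = 0" using S(3) by blast
    then have "s' (g t) = 0 \<longleftrightarrow> g t \<in> {x, - x}"
      using x(2) G(2)[of t] by blast
    then show ?thesis using G(3)[of t u] u by simp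
  qed
  let ?C = "g ` {u<..<u + 1}"
  have con: "connected ?C"
    by (intro connected_continuous_image continuous_on_subset[OF G(1)]) auto
  have nz: "s' (g t) \<noteq> 0" if t: "u < t" "t < u + 1" for t
  proof
    assume "s' (g t) = 0"
    then obtain k :: int where "t - u = of_int k"
      using zero by (metis Ints_cases)
    moreover have "0 < t - u" "t - u < 1" using t by simp_all
    ultimately show False by simp
  qed
  note N = side_functionD[OF side_function_uminus[OF s']]
  let ?p = "{x \<in> \<S>. s' x = 1}" and ?n = "{x \<in> \<S>. - s' x = 1}"
  have sub: "?C \<subseteq> ?p \<union> ?n"
    using nz S'(1) G(2) by fastforce
  have disj: "?p \<inter> ?n = {}" by auto
  have "?C \<subseteq> ?p \<or> ?C \<subseteq> ?n"
  proof (cases "?C \<inter> ?p = {}")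
    case False
    then show ?thesis
      using connected_subset_one_side[OF con sub disj S'(4) N(4)] by blast
  qed (use sub in blast)
  then show thesis
  proof
    assume "?C \<subseteq> ?p"
    then show thesis by (intro that[of 1 u] zero) (auto simp: image_subset_iff)
  next
    assume "?C \<subseteq> ?n"
    then show thesis by (intro that[of "- 1" u] zero) (force simp: image_subset_iff)+
  qed
qed

text \<open>Along \<open>g\<close> the sign of \<open>s'\<close> alternates from one period to the
  next, so the set is the image of a single closed interval of length 1.\<close>

lemma half_arc_connected:
  assumes g: "antipodal_curve g" and s: "side_function s (range g)" and s': "side_function s' L"
    and one: "meet_once s s'"
  shows "connected {x \<in> \<S>. s x = 0 \<and> s' x \<le> 0}"
proof -
  note S = side_functionD[OF s] and S' = side_functionD[OF s']
  have G: "continuous_on UNIV g" "\<And>t. g t \<in> \<S>" "\<And>t. g (t + 1) = - g t"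
    using g by (auto simp: antipodal_curve_def)
  obtain u \<sigma> where \<sigma>: "\<sigma> = 1 \<or> \<sigma> = - 1" and u: "\<And>t. s' (g t) = 0 \<longleftrightarrow> t - u \<in> \<int>"
    "\<And>t. u < t \<Longrightarrow> t < u + 1 \<Longrightarrow> s' (g t) = \<sigma>"
    by (rule crossing_parameter[OF assms]) (rule that)
  \<comment> \<open>The start of a period on which \<open>s'\<close> is negative.\<close>
  define v where "v = (if \<sigma> = 1 then u + 1 else u)"
  have neg: "s' (g t) = - 1" if t: "v < t" "t < v + 1" for t
  proof (cases "\<sigma> = 1")
    case True
    then have "s' (g (t - 1)) = 1" using u(2)[of "t - 1"] t by (simp add: v_def)
    then show ?thesis using G(3)[of "t - 1"] S'(2) G(2) by simp
  next
    case False
    then show ?thesis using u(2) t \<sigma> by (simp add: v_def)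
  qed
  have v0: "s' (g v) = 0" "s' (g (v + 1)) = 0"
    using u(1) by (auto simp: v_def)
  have "{x \<in> \<S>. s x = 0 \<and> s' x \<le> 0} = g ` {v..v + 1}"
  proof (intro equalityI subsetI)
    fix x assume x: "x \<in> {x \<in> \<S>. s x = 0 \<and> s' x \<le> 0}"
    then obtain t where t: "x = g t" using S(3) by blast
    define w where "w = t - of_int \<lfloor>t - v\<rfloor>"
    have w: "v \<le> w" "w < v + 1" unfolding w_def by linarith+
    have "t = w + of_int \<lfloor>t - v\<rfloor>" by (simp add: w_def)
    then have gt: "g t = (if even \<lfloor>t - v\<rfloor> then g w else - g w)"
      using antipodal_curve_add_int[where g = g, OF G(3)] by metis
    show "x \<in> g ` {v..v + 1}"
    proof (cases "even \<lfloor>t - v\<rfloor>")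
      case True
      then show ?thesis using t gt w by auto
    next
      case False
      then have "s' (g w) \<ge> 0" using x t gt S'(2) G(2) by simp
      then have "w = v" using neg[of w] w by (cases "w = v") auto
      then have "x = g (v + 1)" using t gt False G(3) by simp
      then show ?thesis by auto
    qed
  next
    fix x assume "x \<in> g ` {v..v + 1}"
    then obtain t where t: "x = g t" "v \<le> t" "t \<le> v + 1" by auto
    have "s' (g t) \<le> 0"
      using neg[of t] v0 t by (cases "t = v"; cases "t = v + 1") auto
    moreover have "s (g t) = 0" using S(3) by blast
    ultimately show "x \<in> {x \<in> \<S>. s x = 0 \<and> s' x \<le> 0}"
      using t G(2) by auto
  qed
  then show ?thesis
    using connected_continuous_image[OF continuous_on_subset[OF G(1)]] by auto
qed

lemma meet_once_commute: "meet_once s s' \<longleftrightarrow> meet_once s' s"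
  by (simp add: meet_once_def conj_commute)

lemma meet_once_uminus [simp]: "meet_once (\<lambda>x. - s x) s' \<longleftrightarrow> meet_once s s'"
  "meet_once s (\<lambda>x. - s' x) \<longleftrightarrow> meet_once s s'"
  by (simp_all add: meet_once_def)

lemma connected_via_core:
  assumes "connected J" "J \<noteq> {}" "J \<subseteq> L"
    and "\<And>x. x \<in> L \<Longrightarrow> \<exists>C. connected C \<and> C \<subseteq> L \<and> x \<in> C \<and> C \<inter> J \<noteq> {}"
  shows "connected L"
proof -
  let ?D = "{D. connected D \<and> D \<subseteq> L \<and> J \<subseteq> D}"
  have "x \<in> \<Union>?D" if x: "x \<in> L" for x
  proof -
    obtain C where C: "connected C" "C \<subseteq> L" "x \<in> C" "C \<inter> J \<noteq> {}"
      using assms(4)[OF x] by blast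
    have "connected (C \<union> J)" by (rule connected_Un[OF C(1) assms(1) C(4)])
    then show ?thesis using C assms(3) by blast
  qed
  then have "L = \<Union>?D" by (intro equalityI subsetI) auto
  moreover have "connected (\<Union>?D)"
    by (rule connected_Union) (use assms(2) in auto)
  ultimately show ?thesis by simp
qed

text \<open>
  Every point of the lune lies in the closure of a component of its interior, which reaches the
  boundary; the boundary is connected, being the union of two half arcs with common endpoints.
\<close>

lemma closed_lune_connected:
  assumes g: "antipodal_curve g" and s: "side_function s (range g)"
    and g': "antipodal_curve g'" and s': "side_function s' (range g')" and one: "meet_once s s'"
  shows "connected {x \<in> \<S>. s x \<le> 0 \<and> s' x \<le> 0}" (is "connected ?L")
proof -
  note S = side_functionD[OF s] and S' = side_functionD[OF s']
  obtain p where p: "p \<in> \<S>" "s p = 0" "s' p = 0"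
    using one by (auto simp: meet_once_def)
  let ?J = "{x \<in> \<S>. s x = 0 \<and> s' x \<le> 0} \<union> {x \<in> \<S>. s' x = 0 \<and> s x \<le> 0}"
  have J: "connected ?J"
    by (rule connected_Un[OF half_arc_connected[OF g s s' one]
        half_arc_connected[OF g' s' s one[unfolded meet_once_commute[of s]]]]) (use p in auto)
  have "?L = {x \<in> \<S>. s x \<le> 0} \<inter> {x \<in> \<S>. s' x \<le> 0}"
    by auto
  then have clL: "closed ?L"
    by (simp only:) (intro closed_Int side_function_le_closed(1)[OF s] side_function_le_closed(1)[OF s'])
  let ?n = "{x \<in> \<S>. - s x = 1} \<inter> {x \<in> \<S>. - s' x = 1}"
  have on: "openin (top_of_set \<S>) ?n"
    using side_functionD(4)[OF side_function_uminus[OF s]] side_functionD(4)[OF side_function_uminus[OF s']]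
    by (rule openin_Int)
  have ex: "\<exists>C. connected C \<and> C \<subseteq> ?L \<and> x \<in> C \<and> C \<inter> ?J \<noteq> {}" if x: "x \<in> ?L" for x
  proof (cases "x \<in> ?J")
    case True
    then show ?thesis using x by (intro exI[of _ "{x}"]) auto
  next
    case False
    then have xn: "x \<in> ?n" using x S(1) S'(1) by force
    let ?K = "connected_component_set ?n x"
    have K: "connected ?K" "?K \<subseteq> ?n" "x \<in> ?K" "?K \<subseteq> ?L"
      using xn connected_component_subset[of ?n x] by (auto simp: connected_component_refl)
    have "locally connected \<S>"
      by (intro locally_path_connected_imp_locally_connected locally_path_connected_sphere)
    then have oK: "openin (top_of_set \<S>) ?K"
      by (rule openin_trans[OF openin_connected_component_locally_connected[OF locally_open_subset[OF _ on]] on])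
    \<comment> \<open>A closed \<open>?K\<close> would be closed and open in the sphere, hence all
      of it; but the common point \<open>p\<close> of the curves is not in
      \<open>?n\<close>.\<close>
    have "\<not> closed ?K"
    proof
      assume "closed ?K"
      then have "closedin (top_of_set \<S>) ?K"
        using K by (intro closed_subset) auto
      moreover have "connected \<S>"
        by (rule connected_sphere) simp
      ultimately have "?K = {} \<or> ?K = \<S>"
        using oK unfolding connected_clopen by blast
      then have "?K = \<S>"
        using K(3) by blast
      then show False using p K(2) by auto
    qed
    then obtain y where y: "y \<in> closure ?K" "y \<notin> ?K"
      using closure_subset[of ?K] closure_eq[of ?K] by blast
    have yL: "y \<in> ?L"
      using y(1) closure_minimal[OF K(4) clL] by blast
    \<comment> \<open>\<open>?K\<close> is closed in \<open>?n\<close>, so a limit point outside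
      \<open>?K\<close> is outside \<open>?n\<close> as well, that is, on the boundary of the
      lune.\<close>
    have "y \<notin> ?n"
    proof
      assume "y \<in> ?n"
      moreover have "closedin (top_of_set ?n) ?K"
        by (rule closedin_connected_component)
      ultimately show False
        using y unfolding closedin_limpt closure_def by blast
    qed
    then have "y \<in> ?J" using yL S(1) S'(1) by force
    moreover have "connected (closure ?K)"
      by (rule connected_imp_connected_closure[OF K(1)])
    moreover have "closure ?K \<subseteq> ?L"
      by (rule closure_minimal[OF K(4) clL])
    ultimately show ?thesis
      using K(3) y(1) closure_subset[of ?K] by blast
  qed
  show ?thesis
    by (rule connected_via_core[OF J _ _ ex]) (use p in auto)
qed

section \<open>Sign vectors and their regions\<close>

locale lifted_arrangement =
  fixes A :: "proj_plane set set" and g :: "proj_plane set \<Rightarrow> real \<Rightarrow> real ^ 3"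
    and s :: "proj_plane set \<Rightarrow> real ^ 3 \<Rightarrow> real"
  assumes finite_A: "finite A"
    and curve: "l \<in> A \<Longrightarrow> antipodal_curve (g l)"
    and range_g: "l \<in> A \<Longrightarrow> range (g l) = {x \<in> \<S>. proj x \<in> l}"
    and side: "l \<in> A \<Longrightarrow> side_function (s l) (range (g l))"
    and meet: "l \<in> A \<Longrightarrow> m \<in> A \<Longrightarrow> l \<noteq> m \<Longrightarrow> \<exists>p. l \<inter> m = {p}"
begin

lemma side_zero_iff: "l \<in> A \<Longrightarrow> x \<in> \<S> \<Longrightarrow> s l x = 0 \<longleftrightarrow> proj x \<in> l"
  using side_functionD(3)[OF side] range_g by blast

lemma side_cases: "l \<in> A \<Longrightarrow> x \<in> \<S> \<Longrightarrow> s l x = 1 \<or> s l x = - 1 \<or> s l x = 0"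
  using side_functionD(1)[OF side] .

lemma side_minus: "l \<in> A \<Longrightarrow> x \<in> \<S> \<Longrightarrow> s l (- x) = - s l x"
  using side_functionD(2)[OF side] .

lemma curve_in_sphere: "l \<in> A \<Longrightarrow> g l t \<in> \<S>"
  using curve[of l] by (simp add: antipodal_curve_def image_subset_iff)

lemma meet_once_side:
  assumes "l \<in> A" "m \<in> A" "l \<noteq> m"
  shows "meet_once (s l) (s m)"
proof -
  obtain p where p: "l \<inter> m = {p}" using meet[OF assms] by blast
  obtain x where x: "x \<in> \<S>" "proj x = p" using proj_surj .
  have "{y \<in> \<S>. s l y = 0 \<and> s m y = 0} = {y \<in> \<S>. proj y \<in> l \<inter> m}"
    using side_zero_iff assms by auto
  also have "\<dots> = {x, - x}"
    unfolding p using x proj_sphere_eq_iff[of _ x] by auto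
  finally show ?thesis
    unfolding meet_once_def using x(1) by blast
qed

text \<open>
  A sign vector is encoded by the set \<open>Y\<close> of the lines on which it is positive; \<open>tw Y l\<close> is the side
  function of \<open>l\<close>, oriented so that this sign becomes \<open>1\<close>.
\<close>

definition tw :: "proj_plane set set \<Rightarrow> proj_plane set \<Rightarrow> real ^ 3 \<Rightarrow> real" where
  "tw Y l = (if l \<in> Y then s l else (\<lambda>x. - s l x))"

definition region :: "proj_plane set set \<Rightarrow> proj_plane set set \<Rightarrow> (real ^ 3) set" where
  "region B Y = {x \<in> \<S>. \<forall>l\<in>B. tw Y l x = 1}"

lemma side_tw: "l \<in> A \<Longrightarrow> side_function (tw Y l) (range (g l))"
  using side side_function_uminus by (auto simp: tw_def)

lemma region_insert: "region (insert l B) Y = region B Y \<inter> {x \<in> \<S>. tw Y l x = 1}"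
  by (auto simp: region_def)

lemma region_subset_sphere: "region B Y \<subseteq> \<S>"
  by (auto simp: region_def)

lemma region_open:
  assumes "B \<subseteq> A"
  shows "openin (top_of_set \<S>) (region B Y)"
proof -
  have "finite B" using assms finite_A finite_subset by blast
  then show ?thesis
    using assms
  proof (induction B)
    case empty
    then show ?case by (simp add: region_def)
  next
    case (insert l B)
    then show ?case
      unfolding region_insert using side_functionD(4)[OF side_tw] by (intro openin_Int) auto
  qed
qed

text \<open>Induction on the lines by \<open>connected_compl_union_sphere\<close>, applied to the
  closed non-positive sides. It needs the side of \<open>l\<close> to meet the union of the earlier
  ones in a connected set: this is a union of closed lunes with pairwise common points.\<close>

lemma region_connected:
  assumes "B \<subseteq> A"
  shows "connected (region B Y)"
proof -
  have "finite B" using assms finite_A finite_subset by blast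
  then show ?thesis
    using assms
  proof (induction B)
    case empty
    have "connected \<S>" by (rule connected_sphere) simp
    then show ?case by (simp add: region_def)
  next
    case (insert l B)
    have l: "l \<in> A" and B: "B \<subseteq> A" using insert by auto
    let ?H = "\<lambda>m. {x \<in> \<S>. tw Y m x \<le> 0}"
    let ?S = "\<Union>m\<in>B. ?H m"
    have S: "\<S> - ?S = region B Y"
    proof -
      have "tw Y m x = 1 \<longleftrightarrow> \<not> tw Y m x \<le> 0" if "m \<in> B" "x \<in> \<S>" for m x
        using side_functionD(1)[OF side_tw[of m Y], of x] that B by auto
      then show ?thesis by (auto simp: region_def)
    qed
    have clS: "closed ?S"
      using insert.hyps(1) B side_function_le_closed(1)[OF side_tw] by (intro closed_UN) auto
    have lune: "connected (?H m \<inter> ?H l)" if m: "m \<in> B" for m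
    proof -
      have "m \<in> A" "m \<noteq> l" using m B insert.hyps by auto
      then have "meet_once (tw Y m) (tw Y l)"
        using meet_once_side[of m l] l by (simp add: tw_def)
      then have "connected {x \<in> \<S>. tw Y m x \<le> 0 \<and> tw Y l x \<le> 0}"
        using closed_lune_connected[OF curve[OF \<open>m \<in> A\<close>] side_tw[OF \<open>m \<in> A\<close>] curve[OF l] side_tw[OF l]] by blast
      moreover have "{x \<in> \<S>. tw Y m x \<le> 0 \<and> tw Y l x \<le> 0} = ?H m \<inter> ?H l" by auto
      ultimately show ?thesis by simp
    qed
    \<comment> \<open>The lines \<open>m\<close> and \<open>l\<close> meet in an antipodal pair,
      both points of which are in the lune; by oddness one of them is on the non-positive side of
      \<open>m'\<close>.\<close>
    have common: "(?H m \<inter> ?H l) \<inter> (?H m' \<inter> ?H l) \<noteq> {}" if m: "m \<in> B" "m' \<in> B" for m m'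
    proof -
      have mA: "m \<in> A" "m' \<in> A" "m \<noteq> l" using m B insert.hyps by auto
      obtain x where x: "x \<in> \<S>" "s m x = 0" "s l x = 0"
        using meet_once_side[of m l] mA l by (auto simp: meet_once_def)
      have "x \<in> ?H m \<inter> ?H l" "- x \<in> ?H m \<inter> ?H l"
        using x mA l side_minus by (auto simp: tw_def)
      moreover have "x \<in> ?H m' \<or> - x \<in> ?H m'"
        using x(1) side_functionD(2)[OF side_tw[OF mA(2)], of x Y] by auto
      ultimately show ?thesis by blast
    qed
    have con: "connected (?S \<inter> ?H l)"
    proof (cases "B = {}")
      case False
      then obtain m0 where m0: "m0 \<in> B" by blast
      show ?thesis
      proof (rule connected_via_core[OF lune[OF m0]])
        show "?H m0 \<inter> ?H l \<noteq> {}" using common[OF m0 m0] by simp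
        show "?H m0 \<inter> ?H l \<subseteq> ?S \<inter> ?H l" using m0 by auto
        fix x assume "x \<in> ?S \<inter> ?H l"
        then obtain m where m: "m \<in> B" "x \<in> ?H m \<inter> ?H l" by auto
        show "\<exists>C. connected C \<and> C \<subseteq> ?S \<inter> ?H l \<and> x \<in> C \<and> C \<inter> (?H m0 \<inter> ?H l) \<noteq> {}"
          using lune[OF m(1)] m common[OF m(1) m0] by (intro exI[of _ "?H m \<inter> ?H l"]) auto
      qed
    qed simp
    have "connected (\<S> - (?S \<union> ?H l))"
    proof (rule connected_compl_union_sphere[OF clS _ side_function_le_closed(1)[OF side_tw[OF l]] _ con])
      show "connected (\<S> - ?S)" unfolding S by (rule insert.IH[OF B])
      show "connected (\<S> - ?H l)"
        unfolding side_function_le_closed(2)[OF side_tw[OF l]] by (rule side_functionD(5)[OF side_tw[OF l]])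
    qed auto
    moreover have "\<S> - (?S \<union> ?H l) = region (insert l B) Y"
      using S side_function_le_closed(2)[OF side_tw[OF l], of Y] unfolding region_insert by blast
    ultimately show ?case by simp
  qed
qed

lemma side_dense:
  assumes "l \<in> A" "openin (top_of_set \<S>) U" "x \<in> U" "s l x = 0"
  obtains y where "y \<in> U" "tw Y l y = 1"
proof -
  have "x \<in> \<S>" using assms openin_imp_subset by blast
  then have "x \<in> range (g l)"
    using side_functionD(3)[OF side[OF assms(1)]] assms(4) by blast
  then have "x \<in> closure {x \<in> \<S>. tw Y l x = 1}"
    using side_functionD(6)[OF side_tw[OF assms(1)]] by blast
  moreover obtain U' where U': "open U'" "U = \<S> \<inter> U'"
    using assms(2) by (auto simp: openin_open)
  ultimately have "U' \<inter> {x \<in> \<S>. tw Y l x = 1} \<noteq> {}"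
    using open_Int_closure_eq_empty[OF U'(1)] assms(3) by blast
  then show thesis using that U'(2) by blast
qed

text \<open>A line can be left by an arbitrarily small move, and staying on an open side of it is an
  open condition; so the lines can be treated one at a time, shrinking \<open>U\<close>.\<close>

lemma generic_point:
  assumes "B \<subseteq> A" "openin (top_of_set \<S>) U" "U \<noteq> {}"
  obtains x where "x \<in> U" "\<And>l. l \<in> B \<Longrightarrow> s l x \<noteq> 0"
proof -
  have "finite B" using assms finite_A finite_subset by blast
  then have "\<exists>x\<in>U. \<forall>l\<in>B. s l x \<noteq> 0"
    using assms
  proof (induction B arbitrary: U)
    case empty
    then show ?case by auto
  next
    case (insert l B)
    have l: "l \<in> A" using insert by auto
    obtain x where x: "x \<in> U" using insert by blast
    define Y where "Y = (if s l x = 1 then {l} else {})"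
    have "\<exists>y\<in>U. tw Y l y = 1"
    proof (cases "s l x = 0")
      case True
      then show ?thesis using side_dense[OF l insert.prems(2) x] by blast
    next
      case False
      have "x \<in> \<S>" using x insert.prems(2) openin_imp_subset by blast
      then show ?thesis
        using False side_cases[OF l] x by (intro bexI[of _ x]) (auto simp: Y_def tw_def)
    qed
    moreover have "openin (top_of_set \<S>) (U \<inter> {x \<in> \<S>. tw Y l x = 1})"
      by (intro openin_Int insert.prems side_functionD(4)[OF side_tw[OF l]])
    ultimately obtain y where "y \<in> U \<inter> {x \<in> \<S>. tw Y l x = 1}" "\<forall>l\<in>B. s l y \<noteq> 0"
      using insert.IH[of "U \<inter> {x \<in> \<S>. tw Y l x = 1}"] insert.prems openin_imp_subset[OF insert.prems(2)] by blast
    then show ?case by (intro bexI[of _ y]) (auto simp: tw_def split: if_splits)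
  qed
  then show thesis using that by blast
qed

lemma curve_crossing:
  assumes "l \<in> A" "m \<in> A" "l \<noteq> m"
  obtains u \<sigma> where "\<sigma> = 1 \<or> \<sigma> = - 1" "\<And>t. s m (g l t) = 0 \<longleftrightarrow> t - u \<in> \<int>"
    "\<And>t. u < t \<Longrightarrow> t < u + 1 \<Longrightarrow> s m (g l t) = \<sigma>"
  by (rule crossing_parameter[OF curve[OF assms(1)] side[OF assms(1)] side[OF assms(2)] meet_once_side[OF assms]])
    (rule that)

text \<open>The other lines meet the curve of \<open>l\<close> in countably many parameters, but an
  interval is uncountable.\<close>

lemma generic_curve_point:
  assumes l: "l \<in> A" and U: "openin (top_of_set \<S>) U" "x \<in> U" "s l x = 0"
  obtains y where "y \<in> U" "s l y = 0" "\<And>m. m \<in> A - {l} \<Longrightarrow> s m y \<noteq> 0"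
proof -
  have "x \<in> \<S>" using U openin_imp_subset by blast
  then obtain t where t: "x = g l t"
    using side_functionD(3)[OF side[OF l]] U(3) by blast
  obtain U' where U': "open U'" "U = \<S> \<inter> U'"
    using U(1) by (auto simp: openin_open)
  have "continuous_on UNIV (g l)"
    using curve[OF l] by (simp add: antipodal_curve_def)
  then have "open (g l -` U')"
    using U'(1) by (simp add: open_vimage)
  then obtain e where e: "e > 0" "ball t e \<subseteq> g l -` U'"
    using t U(2) U'(2) open_contains_ball by (metis IntD2 vimageI)
  define Z where "Z m = {t. s m (g l t) = 0}" for m
  have "countable (Z m)" if m: "m \<in> A - {l}" for m
  proof -
    obtain u where "\<And>t. s m (g l t) = 0 \<longleftrightarrow> t - u \<in> \<int>"
      using curve_crossing[OF l, of m] m by (metis DiffD1 DiffD2 singletonI)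
    then have "Z m \<subseteq> range (\<lambda>k::int. u + of_int k)"
      by (auto simp: Z_def elim!: Ints_cases) (metis add.commute diff_add_cancel rangeI)
    then show ?thesis by (rule countable_subset) simp
  qed
  then have "countable (\<Union>m\<in>A - {l}. Z m)"
    using finite_A by (intro countable_UN) (auto simp: countable_finite)
  moreover have "uncountable {t - e<..<t + e}"
    using e(1) by (simp add: uncountable_open_interval)
  ultimately have "\<not> {t - e<..<t + e} \<subseteq> (\<Union>m\<in>A - {l}. Z m)"
    using countable_subset by metis
  then obtain t' where t': "t' \<in> {t - e<..<t + e}" "t' \<notin> (\<Union>m\<in>A - {l}. Z m)"
    by (meson subsetI)
  show thesis
  proof (rule that[of "g l t'"])
    have "t' \<in> ball t e" using t'(1) by (auto simp: dist_real_def)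
    then show "g l t' \<in> U"
      using e(2) U'(2) curve_in_sphere[OF l] by auto
    show "s l (g l t') = 0"
      using side_functionD(3)[OF side[OF l]] by blast
    show "s m (g l t') \<noteq> 0" if "m \<in> A - {l}" for m
      using t'(2) that by (auto simp: Z_def)
  qed
qed

text \<open>All four sign combinations occur near a crossing: moving along \<open>l\<close> in one
  of the two directions gives the wanted sign of \<open>m\<close>, and a small move off
  \<open>l\<close> then gives that of \<open>l\<close>, since the side of \<open>m\<close> is
  open.\<close>

lemma corner:
  assumes lm: "l \<in> A" "m \<in> A" "l \<noteq> m" and U: "openin (top_of_set \<S>) U" "x \<in> U" "s l x = 0" "s m x = 0"
  obtains y where "y \<in> U" "tw Y l y = 1" "tw Y m y = 1" "\<And>k. k \<in> A \<Longrightarrow> s k y \<noteq> 0"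
proof -
  have "x \<in> \<S>" using U openin_imp_subset by blast
  then obtain t where t: "x = g l t"
    using side_functionD(3)[OF side[OF lm(1)]] U(3) by blast
  obtain U' where U': "open U'" "U = \<S> \<inter> U'"
    using U(1) by (auto simp: openin_open)
  have G: "continuous_on UNIV (g l)" "\<And>t. g l (t + 1) = - g l t"
    using curve[OF lm(1)] by (simp_all add: antipodal_curve_def)
  have "open (g l -` U')"
    using U'(1) G(1) by (simp add: open_vimage)
  then obtain e where e: "e > 0" "ball t e \<subseteq> g l -` U'"
    using t U(2) U'(2) open_contains_ball by (metis IntD2 vimageI)
  obtain u \<sigma> where \<sigma>: "\<sigma> = 1 \<or> \<sigma> = - 1" and u: "\<And>t. s m (g l t) = 0 \<longleftrightarrow> t - u \<in> \<int>"
    "\<And>t. u < t \<Longrightarrow> t < u + 1 \<Longrightarrow> s m (g l t) = \<sigma>"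
    by (rule curve_crossing[OF lm]) (rule that)
  obtain k :: int where k: "t = u + of_int k"
    using u(1)[of t] U(4) t by (metis Ints_cases add.commute diff_add_cancel)
  \<comment> \<open>A step shorter than one period reaches no further zero of \<open>s m\<close>,
    and one shorter than \<open>e\<close> stays in \<open>U\<close>.\<close>
  define d where "d = min (e / 2) (1 / 2)"
  have d: "0 < d" "d < 1" "d < e" using e(1) by (auto simp: d_def)
  have in1: "g l (t + d) \<in> U" "g l (t - d) \<in> U"
    using e(2) d U'(2) curve_in_sphere[OF lm(1)] by (auto simp: dist_real_def subset_iff)
  have kshift: "s m (g l (w + of_int k)) = (if even k then s m (g l w) else - s m (g l w))" for w
    using antipodal_curve_add_int[where g = "g l", OF G(2), of w k] side_minus[OF lm(2) curve_in_sphere[OF lm(1)]] by simp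
  have p: "s m (g l (u + d)) = \<sigma>" using u(2) d by simp
  have "g l (u - d + 1) = - g l (u - d)" by (rule G(2))
  moreover have "s m (g l (u - d + 1)) = \<sigma>" using u(2) d by simp
  ultimately have n: "s m (g l (u - d)) = - \<sigma>"
    using side_minus[OF lm(2) curve_in_sphere[OF lm(1)], of "u - d"] by simp
  have td: "t + d = (u + d) + of_int k" "t - d = (u - d) + of_int k"
    using k by auto
  have "s m (g l (t + d)) = (if even k then \<sigma> else - \<sigma>)" "s m (g l (t - d)) = (if even k then - \<sigma> else \<sigma>)"
    unfolding td kshift p n by simp_all
  then have "s m (g l (t + d)) = - s m (g l (t - d))" "s m (g l (t + d)) = 1 \<or> s m (g l (t + d)) = - 1"
    using \<sigma> by (auto split: if_splits)
  then have "tw Y m (g l (t + d)) = 1 \<or> tw Y m (g l (t - d)) = 1"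
    by (auto simp: tw_def)
  then obtain w where w: "g l w \<in> U" "tw Y m (g l w) = 1"
    using in1 by blast
  let ?V = "U \<inter> {x \<in> \<S>. tw Y m x = 1}"
  have zero: "s l (g l w) = 0"
    using side_functionD(3)[OF side[OF lm(1)]] by blast
  have o: "openin (top_of_set \<S>) ?V"
    by (intro openin_Int U side_functionD(4)[OF side_tw[OF lm(2)]])
  have wV: "g l w \<in> ?V"
    using w curve_in_sphere[OF lm(1)] by simp
  obtain z where z: "z \<in> ?V" "tw Y l z = 1"
    by (rule side_dense[OF lm(1) o wV zero]) (rule that)
  have o': "openin (top_of_set \<S>) (?V \<inter> {x \<in> \<S>. tw Y l x = 1})"
    by (intro openin_Int o side_functionD(4)[OF side_tw[OF lm(1)]])
  have ne: "?V \<inter> {x \<in> \<S>. tw Y l x = 1} \<noteq> {}"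
    using z by auto
  obtain y where "y \<in> ?V \<inter> {x \<in> \<S>. tw Y l x = 1}" "\<And>k. k \<in> A \<Longrightarrow> s k y \<noteq> 0"
    by (rule generic_point[OF subset_refl o' ne]) (rule that)
  then show thesis using that by auto
qed

end

section \<open>Counting sign vectors\<close>

lemma double_count:
  assumes "finite S" "finite T"
  shows "(\<Sum>a\<in>S. card {b \<in> T. R a b}) = (\<Sum>b\<in>T. card {a \<in> S. R a b})"
proof -
  have "(\<Sum>a\<in>S. card {b \<in> T. R a b}) = (\<Sum>a\<in>S. \<Sum>b\<in>T. if R a b then 1 else 0)"
    using assms by (simp add: sum.inter_filter[symmetric])
  also have "\<dots> = (\<Sum>b\<in>T. \<Sum>a\<in>S. if R a b then 1 else 0)"
    by (rule sum.swap)
  also have "\<dots> = (\<Sum>b\<in>T. card {a \<in> S. R a b})"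
    using assms by (simp add: sum.inter_filter[symmetric])
  finally show ?thesis .
qed

context lifted_arrangement
begin

text \<open>
  \<open>topes B\<close> are the sign vectors of the chambers of the lift of \<open>B\<close>, \<open>edges l B\<close> those of the 1-cells
  into which \<open>B\<close> cuts \<open>l\<close>. Regions are connected, so both kinds of cells are determined by their sign
  vectors and can be counted through them.
\<close>

definition tope_at :: "proj_plane set set \<Rightarrow> real ^ 3 \<Rightarrow> proj_plane set set" where
  "tope_at B x = {l \<in> B. s l x = 1}"

definition topes :: "proj_plane set set \<Rightarrow> proj_plane set set set" where
  "topes B = {Y. Y \<subseteq> B \<and> region B Y \<noteq> {}}"

definition edges :: "proj_plane set \<Rightarrow> proj_plane set set \<Rightarrow> proj_plane set set set" where
  "edges l B = {Y. Y \<subseteq> B \<and> (\<exists>x \<in> region B Y. s l x = 0)}"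

definition pt :: "proj_plane set \<Rightarrow> proj_plane set \<Rightarrow> proj_plane" where
  "pt l m = (THE p. p \<in> l \<inter> m)"

lemma region_tope_at:
  assumes "B \<subseteq> A" "x \<in> \<S>" "\<And>l. l \<in> B \<Longrightarrow> s l x \<noteq> 0"
  shows "x \<in> region B (tope_at B x)"
  using assms side_cases[of _ x] by (force simp: region_def tope_at_def tw_def)

lemma region_imp_tope_at:
  assumes "x \<in> region B Y" "Y \<subseteq> B"
  shows "Y = tope_at B x"
  using assms by (force simp: region_def tope_at_def tw_def split: if_splits)

lemma region_cong:
  assumes "Y \<inter> B = Y' \<inter> B"
  shows "region B Y = region B Y'"
proof -
  have "l \<in> Y \<longleftrightarrow> l \<in> Y'" if "l \<in> B" for l using assms that by blast
  then show ?thesis by (simp add: region_def tw_def)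
qed

lemma region_nonzero: "x \<in> region B Y \<Longrightarrow> l \<in> B \<Longrightarrow> s l x \<noteq> 0"
  by (force simp: region_def tw_def split: if_splits)

lemma tope_at_topes:
  assumes "B \<subseteq> A" "x \<in> \<S>" "\<And>l. l \<in> B \<Longrightarrow> s l x \<noteq> 0"
  shows "tope_at B x \<in> topes B"
  using region_tope_at[OF assms] by (auto simp: topes_def tope_at_def)

lemma finite_topes: "B \<subseteq> A \<Longrightarrow> finite (topes B)"
  using finite_A finite_subset by (fastforce simp: topes_def intro: finite_subset[of _ "Pow B"])

lemma edges_subset_topes: "edges l B \<subseteq> topes B"
  by (auto simp: edges_def topes_def)

text \<open>The region is connected, so its parts on the two open sides of \<open>l\<close> cannot
  exhaust it.\<close>

lemma region_meets_curve:
  assumes "B \<subseteq> A" "l \<in> A" "x \<in> region B Y" "s l x = 1" "y \<in> region B Y" "s l y = - 1"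
  shows "\<exists>z \<in> region B Y. s l z = 0"
proof (rule ccontr)
  assume n: "\<not> (\<exists>z \<in> region B Y. s l z = 0)"
  have RS: "region B Y \<subseteq> \<S>" by (rule region_subset_sphere)
  have sub: "region B Y \<subseteq> {x \<in> \<S>. s l x = 1} \<union> {x \<in> \<S>. - s l x = 1}"
  proof
    fix z assume "z \<in> region B Y"
    then show "z \<in> {x \<in> \<S>. s l x = 1} \<union> {x \<in> \<S>. - s l x = 1}"
      using side_cases[OF assms(2), of z] n RS by auto
  qed
  have "region B Y \<subseteq> {x \<in> \<S>. s l x = 1}"
  proof (rule connected_subset_one_side[OF region_connected[OF assms(1)] sub])
    show "openin (top_of_set \<S>) {x \<in> \<S>. s l x = 1}"
      "openin (top_of_set \<S>) {x \<in> \<S>. - s l x = 1}"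
      using side_functionD(4)[OF side[OF assms(2)]]
        side_functionD(4)[OF side_function_uminus[OF side[OF assms(2)]]] .
    show "region B Y \<inter> {x \<in> \<S>. s l x = 1} \<noteq> {}"
      using assms(3,4) RS by auto
  qed auto
  then show False using assms(5,6) by auto
qed

lemma region_both_sides:
  assumes "B \<subseteq> A" "l \<in> A" "z \<in> region B Y" "s l z = 0"
  shows "\<exists>x \<in> region B Y. s l x = 1" "\<exists>x \<in> region B Y. s l x = - 1"
proof -
  obtain x where "x \<in> region B Y" "tw {l} l x = 1"
    using side_dense[OF assms(2) region_open[OF assms(1)] assms(3,4)] .
  then show "\<exists>x \<in> region B Y. s l x = 1" by (auto simp: tw_def)
  obtain y where "y \<in> region B Y" "tw {} l y = 1"
    using side_dense[OF assms(2) region_open[OF assms(1)] assms(3,4)] .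
  then show "\<exists>x \<in> region B Y. s l x = - 1" by (force simp: tw_def)
qed

text \<open>A sign vector on \<open>B\<close> extends to \<open>l\<close> in two ways: as a set of
  \<open>insert l B\<close>, \<open>Y\<close> itself encodes a negative sign on \<open>l\<close>,
  and \<open>insert l Y\<close> a positive one.\<close>

lemma topes_insert_iff:
  assumes "l \<in> A" "l \<notin> B" "Y \<subseteq> B"
  shows "Y \<in> topes (insert l B) \<longleftrightarrow> (\<exists>x \<in> region B Y. s l x = - 1)"
    "insert l Y \<in> topes (insert l B) \<longleftrightarrow> (\<exists>x \<in> region B Y. s l x = 1)"
proof -
  have "l \<notin> Y" using assms by blast
  then have "region (insert l B) Y = {x \<in> region B Y. s l x = - 1}"
    by (force simp: region_def tw_def)
  then show "Y \<in> topes (insert l B) \<longleftrightarrow> (\<exists>x \<in> region B Y. s l x = - 1)"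
    using assms(3) by (auto simp: topes_def)
  have eq: "region B (insert l Y) = region B Y"
    using assms by (intro region_cong) auto
  have "region (insert l B) (insert l Y) = {x \<in> region B Y. s l x = 1}"
    using region_subset_sphere[of B Y] unfolding region_insert eq tw_def by auto
  then show "insert l Y \<in> topes (insert l B) \<longleftrightarrow> (\<exists>x \<in> region B Y. s l x = 1)"
    using assms(3) by (auto simp: topes_def)
qed

lemma edges_iff_topes:
  assumes "l \<in> A" "B \<subseteq> A" "l \<notin> B" "Y \<subseteq> B"
  shows "Y \<in> edges l B \<longleftrightarrow> Y \<in> topes (insert l B) \<and> insert l Y \<in> topes (insert l B)"
  unfolding topes_insert_iff[OF assms(1,3,4)]
  using region_meets_curve[OF assms(2,1)] region_both_sides[OF assms(2,1)] assms(4)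
  by (fastforce simp: edges_def)

text \<open>\<open>P0\<close> and \<open>P1\<close> are the restrictions to \<open>B\<close> of the
  topes that are negative and positive on \<open>l\<close>. Their union consists of all topes of
  \<open>B\<close>, their intersection of those that \<open>l\<close> cuts, so inclusion-exclusion
  gives the deletion formula.\<close>

lemma card_topes_insert:
  assumes l: "l \<in> A" and B: "B \<subseteq> A" "l \<notin> B"
  shows "card (topes (insert l B)) = card (topes B) + card (edges l B)"
proof -
  define P0 P1 where "P0 = {Y. Y \<subseteq> B \<and> Y \<in> topes (insert l B)}" and "P1 = {Y. Y \<subseteq> B \<and> insert l Y \<in> topes (insert l B)}"
  have "finite B" using B finite_A finite_subset by blast
  then have fin: "finite P0" "finite P1"
    by (auto simp: P0_def P1_def intro: finite_subset[of _ "Pow B"])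
  have "topes (insert l B) = P0 \<union> insert l ` P1"
  proof (intro equalityI subsetI)
    fix Z assume Z: "Z \<in> topes (insert l B)"
    show "Z \<in> P0 \<union> insert l ` P1"
    proof (cases "l \<in> Z")
      case True
      then have "insert l (Z - {l}) = Z" by blast
      moreover have "Z - {l} \<subseteq> B" using Z by (auto simp: topes_def)
      ultimately have "Z - {l} \<in> P1" using Z by (simp add: P1_def)
      then show ?thesis using \<open>insert l (Z - {l}) = Z\<close> by (metis UnI2 imageI)
    next
      case False
      then show ?thesis using Z by (auto simp: P0_def topes_def)
    qed
  qed (auto simp: P0_def P1_def)
  moreover have "P0 \<inter> insert l ` P1 = {}"
    using B(2) by (auto simp: P0_def)
  moreover have "inj_on (insert l) P1"
    using B(2) by (intro inj_onI) (metis (mono_tags, lifting) P1_def insert_ident mem_Collect_eq subsetD)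
  ultimately have "card (topes (insert l B)) = card P0 + card P1"
    using fin by (simp add: card_Un_disjoint card_image)
  also have "\<dots> = card (P0 \<union> P1) + card (P0 \<inter> P1)"
    by (rule card_Un_Int[OF fin])
  also have "P0 \<inter> P1 = edges l B"
    using edges_iff_topes[OF l B] by (auto simp: P0_def P1_def edges_def)
  also have "P0 \<union> P1 = topes B"
  proof (intro equalityI subsetI)
    fix Y assume "Y \<in> P0 \<union> P1"
    then show "Y \<in> topes B"
      using topes_insert_iff[OF l B(2), of Y] by (auto simp: P0_def P1_def topes_def)
  next
    fix Y assume Y: "Y \<in> topes B"
    then obtain x where x: "x \<in> region B Y" "s l x \<noteq> 0"
      using generic_point[of "{l}" "region B Y"] region_open[OF B(1)] l by (auto simp: topes_def)
    then have "s l x = 1 \<or> s l x = - 1"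
      using side_cases[OF l, of x] region_subset_sphere[of B Y] by auto
    then show "Y \<in> P0 \<union> P1"
      using topes_insert_iff[OF l B(2), of Y] Y x(1) by (auto simp: P0_def P1_def topes_def)
  qed
  finally show ?thesis .
qed

lemma pt_eq:
  assumes "l \<in> A" "m \<in> A" "l \<noteq> m"
  shows "l \<inter> m = {pt l m}"
proof -
  obtain p where p: "l \<inter> m = {p}" using meet[OF assms] ..
  then have "pt l m = p" unfolding pt_def p by simp
  then show ?thesis using p by simp
qed

text \<open>The crossing is moved into a given half turn, which makes the crossing parameters of
  several lines comparable. A shift by an odd number of periods reverses the sign.\<close>

lemma curve_crossing_from:
  assumes "l \<in> A" "m \<in> A" "l \<noteq> m"
  shows "\<exists>u \<sigma>. a \<le> u \<and> u < a + 1 \<and> (\<sigma> = 1 \<or> \<sigma> = - 1) \<and> (\<forall>t. s m (g l t) = 0 \<longleftrightarrow> t - u \<in> \<int>) \<and>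
    (\<forall>t. u < t \<longrightarrow> t < u + 1 \<longrightarrow> s m (g l t) = \<sigma>)"
proof -
  obtain u \<sigma> where \<sigma>: "\<sigma> = 1 \<or> \<sigma> = - 1" and u: "\<And>t. s m (g l t) = 0 \<longleftrightarrow> t - u \<in> \<int>"
    "\<And>t. u < t \<Longrightarrow> t < u + 1 \<Longrightarrow> s m (g l t) = \<sigma>"
    by (rule curve_crossing[OF assms]) (rule that)
  define k where "k = \<lfloor>u - a\<rfloor>"
  have anti: "\<And>t. g l (t + 1) = - g l t"
    using curve[OF assms(1)] by (simp add: antipodal_curve_def)
  have zero: "s m (g l t) = 0 \<longleftrightarrow> t - (u - of_int k) \<in> \<int>" for t
  proof -
    have "t - (u - of_int k) = (t - u) + of_int k" by simp
    then show ?thesis using u(1) by (metis Ints_add Ints_diff Ints_of_int add_diff_cancel_right')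
  qed
  have sgn: "s m (g l t) = (if even k then \<sigma> else - \<sigma>)" if "u - of_int k < t" "t < u - of_int k + 1" for t
  proof -
    have "s m (g l (t + of_int k)) = \<sigma>" using u(2) that by simp
    then show ?thesis
      using antipodal_curve_add_int[where g = "g l", OF anti, of t k] side_minus[OF assms(2) curve_in_sphere[OF assms(1)]]
      by (auto split: if_splits)
  qed
  have "a \<le> u - of_int k" "u - of_int k < a + 1" unfolding k_def by linarith+
  then show ?thesis
    using zero sgn \<sigma> by (intro exI[of _ "u - of_int k"] exI[of _ "if even k then \<sigma> else - \<sigma>"]) auto
qed

text \<open>On the half turn from \<open>a\<close> to \<open>a + 1\<close> each line
  \<open>m\<close> is crossed once, at \<open>\<tau> m\<close>. The sign vector depends only on
  which lines have been crossed already, so the arcs of the half turn correspond to the crossing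
  times, that is, to the points on \<open>l\<close>; the other half turn contributes the
  complementary sign vectors.\<close>

lemma card_edges:
  assumes l: "l \<in> A" and B: "B \<subseteq> A - {l}" "B \<noteq> {}"
  shows "card (edges l B) = 2 * card (pt l ` B)"
proof -
  have BA: "m \<in> A" "l \<noteq> m" if "m \<in> B" for m using B that by auto
  have finB: "finite B" using B finite_A finite_subset by blast
  have anti: "\<And>t. g l (t + 1) = - g l t" and per: "\<And>t t'. g l t = g l t' \<or> g l t = - g l t' \<longleftrightarrow> t - t' \<in> \<int>"
    using curve[OF l] by (simp_all add: antipodal_curve_def)
  note gS = curve_in_sphere[OF l]
  have range0: "{x \<in> \<S>. s l x = 0} = range (g l)"
    using side_functionD(3)[OF side[OF l]] .
  obtain m0 where m0: "m0 \<in> B" using B by blast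
  \<comment> \<open>Starting at a crossing, here with \<open>m0\<close>, avoids an arc that
    straddles the two half turns.\<close>
  obtain a where a: "s m0 (g l a) = 0"
    using curve_crossing_from[OF l BA[OF m0], of 0] by (metis Ints_0 diff_self)
  have "\<forall>m\<in>B. \<exists>u \<sigma>. a \<le> u \<and> u < a + 1 \<and> (\<sigma> = 1 \<or> \<sigma> = - 1) \<and> (\<forall>t. s m (g l t) = 0 \<longleftrightarrow> t - u \<in> \<int>) \<and>
    (\<forall>t. u < t \<longrightarrow> t < u + 1 \<longrightarrow> s m (g l t) = \<sigma>)"
    using curve_crossing_from[OF l] BA by blast
  from bchoice[OF this] obtain \<tau> where \<tau>': "\<forall>m\<in>B. \<exists>\<sigma>. a \<le> \<tau> m \<and> \<tau> m < a + 1 \<and> (\<sigma> = 1 \<or> \<sigma> = - 1) \<and>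
    (\<forall>t. s m (g l t) = 0 \<longleftrightarrow> t - \<tau> m \<in> \<int>) \<and> (\<forall>t. \<tau> m < t \<longrightarrow> t < \<tau> m + 1 \<longrightarrow> s m (g l t) = \<sigma>)" ..
  from bchoice[OF \<tau>'] obtain \<sigma> where \<sigma>': "\<forall>m\<in>B. a \<le> \<tau> m \<and> \<tau> m < a + 1 \<and> (\<sigma> m = 1 \<or> \<sigma> m = - 1) \<and>
    (\<forall>t. s m (g l t) = 0 \<longleftrightarrow> t - \<tau> m \<in> \<int>) \<and> (\<forall>t. \<tau> m < t \<longrightarrow> t < \<tau> m + 1 \<longrightarrow> s m (g l t) = \<sigma> m)" ..
  have \<tau>: "a \<le> \<tau> m" "\<tau> m < a + 1" "s m (g l t) = 0 \<longleftrightarrow> t - \<tau> m \<in> \<int>" if "m \<in> B" for m t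
    using bspec[OF \<sigma>' that] by simp_all
  have \<sigma>: "\<sigma> m = 1 \<or> \<sigma> m = - 1" "\<tau> m < t \<Longrightarrow> t < \<tau> m + 1 \<Longrightarrow> s m (g l t) = \<sigma> m" if "m \<in> B" for m t
    using bspec[OF \<sigma>' that] by simp_all
  have int0: "t = t'" if "t - t' \<in> \<int>" "\<bar>t - t'\<bar> < 1" for t t' :: real
    using that by (metis Ints_cases abs_eq_0 abs_less_iff diff_eq_eq add_0 of_int_less_1_iff of_int_abs of_int_eq_0_iff zabs_less_one_iff)
  have \<tau>0: "\<tau> m0 = a"
    using int0[of a "\<tau> m0"] \<tau>(1,2)[OF m0] \<tau>(3)[OF m0] a by auto
  \<comment> \<open>The sign vector when exactly the lines in \<open>D\<close> have been crossed:
    \<open>\<sigma> m\<close> is the sign of \<open>m\<close> after its crossing,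
    \<open>- \<sigma> m\<close> the one before.\<close>
  define \<phi> where "\<phi> D = {m \<in> B. m \<in> D \<longleftrightarrow> \<sigma> m = 1}" for D
  \<comment> \<open>The sets of lines crossed by the time \<open>w\<close>, one for each crossing
    time; they describe the arcs that begin at \<open>w\<close>.\<close>
  define \<D> where "\<D> = (\<lambda>w. {m \<in> B. \<tau> m \<le> w}) ` \<tau> ` B"
  have compl: "\<phi> (B - D) = B - \<phi> D" for D
    by (auto simp: \<phi>_def)
  have inj\<phi>: "inj_on \<phi> (Pow B)"
    by (rule inj_onI) (auto simp: \<phi>_def)
  have edge_t: "tope_at B (g l t) \<in> edges l B" if "\<And>m. m \<in> B \<Longrightarrow> s m (g l t) \<noteq> 0" for t
  proof -
    have "B \<subseteq> A" using B by blast
    then have "g l t \<in> region B (tope_at B (g l t))"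
      by (rule region_tope_at[OF _ gS that])
    moreover have "s l (g l t) = 0" using range0 by blast
    ultimately show ?thesis by (auto simp: edges_def tope_at_def)
  qed
  have shift: "tope_at B (g l (t + of_int k)) = (if even k then tope_at B (g l t) else B - tope_at B (g l t))"
    if nz: "\<And>m. m \<in> B \<Longrightarrow> s m (g l t) \<noteq> 0" for t k
  proof (cases "even k")
    case True
    then show ?thesis
      using antipodal_curve_add_int[where g = "g l", OF anti, of t k] by simp
  next
    case False
    then have e: "g l (t + of_int k) = - g l t"
      using antipodal_curve_add_int[where g = "g l", OF anti, of t k] by simp
    have "s m (g l t) = 1 \<or> s m (g l t) = - 1" if "m \<in> B" for m
      using side_cases[OF BA(1)[OF that] gS[of t]] nz[OF that] by blast
    moreover have "s m (- g l t) = - s m (g l t)" if "m \<in> B" for m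
      using side_minus[OF BA(1)[OF that] gS] .
    ultimately show ?thesis
      using False unfolding e by (force simp: tope_at_def)
  qed
  have base: "tope_at B (g l t) = \<phi> {m \<in> B. \<tau> m < t}"
    if t: "a \<le> t" "t < a + 1" and nz: "\<And>m. m \<in> B \<Longrightarrow> s m (g l t) \<noteq> 0" for t
  proof -
    have "s m (g l t) = 1 \<longleftrightarrow> (\<tau> m < t \<longleftrightarrow> \<sigma> m = 1)" if m: "m \<in> B" for m
    proof (cases "\<tau> m < t")
      case True
      then have "s m (g l t) = \<sigma> m"
        using \<sigma>(2)[OF m, of t] \<tau>(1)[OF m] t by simp
      then show ?thesis using True by simp
    next
      case False
      moreover have "t \<noteq> \<tau> m" using nz[OF m] \<tau>(3)[OF m, of t] by auto
      ultimately have "s m (g l (t + 1)) = \<sigma> m"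
        using \<sigma>(2)[OF m, of "t + 1"] \<tau>(2)[OF m] t by simp
      then have "s m (g l t) = - \<sigma> m"
        using anti[of t] side_minus[OF BA(1)[OF m] gS, of t] by simp
      then show ?thesis using False \<sigma>(1)[OF m] by auto
    qed
    then show ?thesis by (auto simp: tope_at_def \<phi>_def)
  qed
  have "edges l B = \<phi> ` \<D> \<union> (\<lambda>D. \<phi> (B - D)) ` \<D>"
  proof (intro equalityI subsetI)
    fix Y assume "Y \<in> edges l B"
    then obtain x where x: "Y \<subseteq> B" "x \<in> region B Y" "s l x = 0"
      by (auto simp: edges_def)
    moreover have "x \<in> \<S>" using x(2) region_subset_sphere by blast
    ultimately obtain t where t: "x = g l t" using range0 by blast
    have Y: "Y = tope_at B (g l t)"
      using region_imp_tope_at[OF x(2,1)] t by simp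
    have nz: "s m (g l t) \<noteq> 0" if "m \<in> B" for m
      using region_nonzero[OF x(2) that] t by simp
    define k where "k = \<lfloor>t - a\<rfloor>"
    define t' where "t' = t - of_int k"
    have t': "a \<le> t'" "t' < a + 1" unfolding t'_def k_def by linarith+
    have nz': "s m (g l t') \<noteq> 0" if m: "m \<in> B" for m
    proof
      assume "s m (g l t') = 0"
      then have "t' - \<tau> m + of_int k \<in> \<int>" using \<tau>(3)[OF m] by simp
      moreover have "t' - \<tau> m + of_int k = t - \<tau> m" by (simp add: t'_def)
      ultimately show False using nz[OF m] \<tau>(3)[OF m] by metis
    qed
    let ?D = "{m \<in> B. \<tau> m < t'}"
    have "a \<noteq> t'" using nz'[OF m0] a by auto
    then have "m0 \<in> ?D" using m0 \<tau>0 t' by simp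
    have "?D \<in> \<D>"
    proof -
      let ?w = "Max (\<tau> ` ?D)"
      have fin: "finite (\<tau> ` ?D)" using finB by simp
      have w: "?w \<in> \<tau> ` ?D" using \<open>m0 \<in> ?D\<close> by (intro Max_in fin) auto
      have "?D = {m \<in> B. \<tau> m \<le> ?w}"
      proof (intro equalityI subsetI)
        fix m assume "m \<in> ?D"
        then show "m \<in> {m \<in> B. \<tau> m \<le> ?w}" using Max_ge[OF fin] by auto
      next
        fix m assume "m \<in> {m \<in> B. \<tau> m \<le> ?w}"
        then show "m \<in> ?D" using w by auto
      qed
      moreover have "?w \<in> \<tau> ` B" using w by auto
      ultimately show ?thesis unfolding \<D>_def by (rule image_eqI)
    qed
    moreover have "Y = \<phi> ?D \<or> Y = \<phi> (B - ?D)"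
    proof -
      have "t = t' + of_int k" by (simp add: t'_def)
      then have "Y = (if even k then \<phi> ?D else B - \<phi> ?D)"
        using shift[OF nz', of k] base[OF t' nz'] Y by simp
      then show ?thesis unfolding compl by presburger
    qed
    ultimately show "Y \<in> \<phi> ` \<D> \<union> (\<lambda>D. \<phi> (B - D)) ` \<D>" by auto
  next
    fix Y assume "Y \<in> \<phi> ` \<D> \<union> (\<lambda>D. \<phi> (B - D)) ` \<D>"
    then obtain m1 D where D: "m1 \<in> B" "D = {m \<in> B. \<tau> m \<le> \<tau> m1}" "Y = \<phi> D \<or> Y = \<phi> (B - D)"
      unfolding \<D>_def by blast
    \<comment> \<open>The midpoint \<open>t\<close> between the crossing time of \<open>m1\<close>
      and the next one, or the end of the half turn, will lie on the arc described by
      \<open>D\<close>.\<close>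
    let ?F = "insert (a + 1) {x \<in> \<tau> ` B. \<tau> m1 < x}"
    have finF: "finite ?F" using finB by simp
    have "Min ?F \<in> ?F" by (rule Min_in[OF finF]) simp
    then have "\<tau> m1 < Min ?F" using \<tau>(2)[OF D(1)] by auto
    moreover have "Min ?F \<le> a + 1" by (rule Min_le[OF finF]) simp
    moreover define t where "t = (\<tau> m1 + Min ?F) / 2"
    ultimately have t: "\<tau> m1 < t" "t < Min ?F" "a \<le> t" "t < a + 1"
      using \<tau>(1)[OF D(1)] by auto
    have gt: "t < \<tau> m" if "m \<in> B" "\<not> \<tau> m \<le> \<tau> m1" for m
    proof -
      have "Min ?F \<le> \<tau> m" by (rule Min_le[OF finF]) (use that in auto)
      then show ?thesis using t by simp
    qed
    have Dt: "D = {m \<in> B. \<tau> m < t}"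
      using D(2) gt t(1) by force
    have nz: "s m (g l t) \<noteq> 0" if m: "m \<in> B" for m
    proof
      assume "s m (g l t) = 0"
      then have "t = \<tau> m"
        using \<tau>(3)[OF m] \<tau>(1,2)[OF m] t by (intro int0) auto
      then show False using gt[OF m] t(1) by auto
    qed
    have e: "tope_at B (g l t) = \<phi> D"
      using base[OF t(3,4) nz] Dt by simp
    then have "\<phi> D \<in> edges l B" using edge_t[OF nz] by simp
    moreover have "\<phi> (B - D) \<in> edges l B"
    proof -
      have e1: "tope_at B (g l (t + 1)) = \<phi> (B - D)"
        using shift[OF nz, of 1] e compl by simp
      have "s m (g l (t + 1)) \<noteq> 0" if "m \<in> B" for m
        using anti[of t] side_minus[OF BA(1)[OF that] gS, of t] nz[OF that] by simp
      then show ?thesis using edge_t[of "t + 1"] e1 by simp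
    qed
    ultimately show "Y \<in> edges l B" using D(3) by blast
  qed
  moreover have "\<D> \<subseteq> Pow B" by (auto simp: \<D>_def)
  moreover have "finite \<D>" using finB by (simp add: \<D>_def)
  moreover have "\<phi> ` \<D> \<inter> (\<lambda>D. \<phi> (B - D)) ` \<D> = {}"
  proof -
    \<comment> \<open>Every set in \<open>\<D>\<close> contains \<open>m0\<close>, which is crossed
      first, so none is the complement of a member.\<close>
    have "\<phi> D \<noteq> \<phi> (B - D')" if D: "D \<in> \<D>" "D' \<in> \<D>" for D D'
    proof
      assume "\<phi> D = \<phi> (B - D')"
      then have "D = B - D'"
        using inj_onD[OF inj\<phi>, of D "B - D'"] D(1) \<open>\<D> \<subseteq> Pow B\<close> by blast
      moreover have "m0 \<in> D" "m0 \<in> D'"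
        using D m0 \<tau>0 \<tau>(1) by (auto simp: \<D>_def)
      ultimately show False by blast
    qed
    then show ?thesis by blast
  qed
  moreover have "card (\<phi> ` \<D>) = card \<D>"
    using inj\<phi> \<open>\<D> \<subseteq> Pow B\<close> by (metis card_image inj_on_subset)
  moreover have "card ((\<lambda>D. \<phi> (B - D)) ` \<D>) = card \<D>"
  proof (rule card_image, rule inj_onI)
    fix D D' assume D: "D \<in> \<D>" "D' \<in> \<D>" "\<phi> (B - D) = \<phi> (B - D')"
    then have "B - D = B - D'"
      using inj_onD[OF inj\<phi>, of "B - D" "B - D'"] by blast
    then show "D = D'" using D \<open>\<D> \<subseteq> Pow B\<close> by blast
  qed
  moreover have "card \<D> = card (\<tau> ` B)"
    unfolding \<D>_def
  proof (rule card_image, rule inj_onI)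
    fix w w' assume w: "w \<in> \<tau> ` B" "w' \<in> \<tau> ` B" "{m \<in> B. \<tau> m \<le> w} = {m \<in> B. \<tau> m \<le> w'}"
    then have "w \<le> w'" "w' \<le> w" by blast+
    then show "w = w'" by simp
  qed
  moreover have "card (\<tau> ` B) = card (pt l ` B)"
  proof -
    have "pt l m = proj (g l (\<tau> m))" if m: "m \<in> B" for m
    proof -
      have "s m (g l (\<tau> m)) = 0" using \<tau>(3)[OF m] by simp
      moreover have "s l (g l (\<tau> m)) = 0" using range0 by blast
      ultimately have "proj (g l (\<tau> m)) \<in> l \<inter> m"
        using side_zero_iff[OF BA(1)[OF m] gS] side_zero_iff[OF l gS] by blast
      then show ?thesis using pt_eq[OF l BA[OF m]] by simp
    qed
    then have "pt l ` B = (\<lambda>t. proj (g l t)) ` \<tau> ` B"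
      by (auto simp: image_image)
    moreover have "inj_on (\<lambda>t. proj (g l t)) (\<tau> ` B)"
    proof (rule inj_onI)
      fix t t' assume t: "t \<in> \<tau> ` B" "t' \<in> \<tau> ` B" "proj (g l t) = proj (g l t')"
      then have "t - t' \<in> \<int>"
        using proj_sphere_eq_iff[OF gS gS] per by blast
      moreover have "a \<le> t" "t < a + 1" "a \<le> t'" "t' < a + 1"
        using t \<tau> by auto
      ultimately show "t = t'" by (intro int0) auto
    qed
    ultimately show ?thesis by (simp add: card_image)
  qed
  ultimately show ?thesis
    by (simp add: card_Un_disjoint)
qed

section \<open>Incidences of vertices, lines and chambers\<close>

definition crossings :: "proj_plane set" where
  "crossings = {v. \<exists>l\<in>A. \<exists>m\<in>A. l \<noteq> m \<and> v \<in> l \<and> v \<in> m}"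

definition wt :: "proj_plane set set \<Rightarrow> proj_plane \<Rightarrow> nat" where
  "wt B v = card {l \<in> B. v \<in> l}"

text \<open>For a tope \<open>X\<close> one of the two sets is \<open>X\<close> itself, so
  \<open>l\<close> is a wall if flipping the sign of \<open>l\<close> alone gives a tope
  again.\<close>

definition wall :: "proj_plane set set \<Rightarrow> proj_plane set set" where
  "wall X = {l \<in> A. X - {l} \<in> topes A \<and> insert l X \<in> topes A}"

lemma in_meet_eq_pt: "l \<in> A \<Longrightarrow> m \<in> A \<Longrightarrow> l \<noteq> m \<Longrightarrow> v \<in> l \<Longrightarrow> v \<in> m \<Longrightarrow> v = pt l m"
  using pt_eq[of l m] by (metis IntI singletonD)

lemma pt_in: "l \<in> A \<Longrightarrow> m \<in> A \<Longrightarrow> l \<noteq> m \<Longrightarrow> pt l m \<in> l" "l \<in> A \<Longrightarrow> m \<in> A \<Longrightarrow> l \<noteq> m \<Longrightarrow> pt l m \<in> m"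
  using pt_eq[of l m] by (metis IntD1 singletonI, metis IntD2 singletonI)

lemma finite_crossings: "finite crossings"
proof (rule finite_subset)
  show "crossings \<subseteq> (\<lambda>(l, m). pt l m) ` (A \<times> A)"
    using in_meet_eq_pt by (fastforce simp: crossings_def image_iff)
qed (use finite_A in simp)

lemma pt_image:
  assumes "l \<in> A" "B \<subseteq> A - {l}"
  shows "pt l ` B = {v \<in> crossings. v \<in> l \<and> (\<exists>m\<in>B. v \<in> m)}"
proof (intro equalityI subsetI)
  fix v assume "v \<in> pt l ` B"
  then obtain m where m: "m \<in> B" "v = pt l m" by blast
  then have "m \<in> A" "l \<noteq> m" using assms by auto
  then have "v \<in> l" "v \<in> m" using pt_in assms m by auto
  then show "v \<in> {v \<in> crossings. v \<in> l \<and> (\<exists>m\<in>B. v \<in> m)}"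
    using m \<open>m \<in> A\<close> \<open>l \<noteq> m\<close> assms(1) by (auto simp: crossings_def)
next
  fix v assume "v \<in> {v \<in> crossings. v \<in> l \<and> (\<exists>m\<in>B. v \<in> m)}"
  then obtain m where m: "m \<in> B" "v \<in> l" "v \<in> m" by blast
  then have "v = pt l m" using in_meet_eq_pt[of l m v] assms by auto
  then show "v \<in> pt l ` B" using m by blast
qed

text \<open>A new line \<open>l\<close> raises \<open>wt B v - 1\<close> by one exactly at the
  points where it meets an earlier line, and by \<open>card_edges\<close> it has twice as many edges
  as such points. The sum runs over the crossings of all of \<open>A\<close>, so that the index set
  is fixed during the induction.\<close>

lemma card_topes:
  assumes "B \<subseteq> A" "B \<noteq> {}"
  shows "card (topes B) = 2 + 2 * (\<Sum>v\<in>crossings. wt B v - 1)"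
proof -
  have "finite B" using assms finite_A finite_subset by blast
  then show ?thesis using assms(2,1)
  proof (induction B rule: finite_ne_induct)
    case (singleton l)
    then have l: "l \<in> A" by simp
    obtain x :: "real ^ 3" where x: "x \<in> \<S>" using proj_surj by blast
    have "topes {} = {{}}" using x by (auto simp: topes_def region_def)
    moreover have "edges l {} = {{}}"
    proof -
      have "g l 0 \<in> region {} {}" using curve_in_sphere[OF l] by (simp add: region_def)
      moreover have "s l (g l 0) = 0" using side_functionD(3)[OF side[OF l]] by blast
      ultimately show ?thesis by (auto simp: edges_def)
    qed
    moreover have "wt {l} v - 1 = 0" for v
    proof -
      have "card {l' \<in> {l}. v \<in> l'} \<le> card {l}" by (rule card_mono) auto
      then show ?thesis unfolding wt_def by simp
    qed
    ultimately show ?case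
      using card_topes_insert[OF l, of "{}"] by simp
  next
    case (insert l B)
    then have l: "l \<in> A" and B: "B \<subseteq> A" "B \<subseteq> A - {l}" by auto
    \<comment> \<open>Truncated subtraction matters: at a point with \<open>wt B v = 0\<close> both
      sides are 0.\<close>
    have step: "wt (insert l B) v - 1 = (wt B v - 1) + (if v \<in> l \<and> (\<exists>m\<in>B. v \<in> m) then 1 else 0)" for v
    proof (cases "v \<in> l")
      case True
      have fin: "finite {m \<in> B. v \<in> m}" using insert.hyps by simp
      have "{m \<in> insert l B. v \<in> m} = insert l {m \<in> B. v \<in> m}" using True by auto
      then have "wt (insert l B) v = Suc (wt B v)"
        using insert.hyps fin by (simp add: wt_def)
      moreover have "wt B v \<noteq> 0 \<longleftrightarrow> (\<exists>m\<in>B. v \<in> m)"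
        using fin by (auto simp: wt_def)
      ultimately show ?thesis using True by auto
    next
      case False
      then have "{m \<in> insert l B. v \<in> m} = {m \<in> B. v \<in> m}" by auto
      then show ?thesis using False by (simp add: wt_def)
    qed
    have "(\<Sum>v\<in>crossings. wt (insert l B) v - 1) = (\<Sum>v\<in>crossings. wt B v - 1) + card (pt l ` B)"
      unfolding step pt_image[OF l B(2)] sum.distrib using finite_crossings
      by (simp add: sum.inter_filter[symmetric])
    then show ?case
      using card_topes_insert[OF l B(1) insert.hyps(3)] insert.IH[OF B(1)] card_edges[OF l B(2) insert.hyps(2)]
      by simp
  qed
qed

lemma card_crossings_on:
  assumes "l \<in> A" "A \<noteq> {l}"
  shows "card (edges l (A - {l})) = 2 * card {v \<in> crossings. v \<in> l}"
proof -
  have "pt l ` (A - {l}) = {v \<in> crossings. v \<in> l}"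
    unfolding pt_image[OF assms(1) subset_refl] by (auto simp: crossings_def)
  then show ?thesis
    using card_edges[OF assms(1) subset_refl] assms by auto
qed

text \<open>Double counting of pairs of a tope and a wall: an edge on \<open>l\<close> borders two
  topes, and \<open>l\<close> has two edges for each of its crossings.\<close>

lemma sum_card_wall:
  assumes "card A \<ge> 2"
  shows "(\<Sum>X\<in>topes A. card (wall X)) = 4 * (\<Sum>v\<in>crossings. wt A v)"
proof -
  have "(\<Sum>X\<in>topes A. card (wall X)) = (\<Sum>l\<in>A. card {X \<in> topes A. X - {l} \<in> topes A \<and> insert l X \<in> topes A})"
    unfolding wall_def by (rule double_count[OF finite_topes[OF subset_refl] finite_A])
  also have "\<dots> = (\<Sum>l\<in>A. 4 * card {v \<in> crossings. v \<in> l})"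
  proof (rule sum.cong[OF refl])
    fix l assume l: "l \<in> A"
    let ?E = "edges l (A - {l})"
    have ins: "insert l (A - {l}) = A" using l by auto
    have sub: "A - {l} \<subseteq> A" "l \<notin> A - {l}" by auto
    note E = edges_iff_topes[OF l sub, unfolded ins]
    have "{X \<in> topes A. X - {l} \<in> topes A \<and> insert l X \<in> topes A} = ?E \<union> insert l ` ?E"
    proof (intro equalityI subsetI)
      fix X assume X: "X \<in> {X \<in> topes A. X - {l} \<in> topes A \<and> insert l X \<in> topes A}"
      then have "X - {l} \<subseteq> A - {l}" by (auto simp: topes_def)
      then have "X - {l} \<in> ?E" using E[of "X - {l}"] X by simp
      then show "X \<in> ?E \<union> insert l ` ?E"
        by (cases "l \<in> X") (auto simp: image_iff insert_absorb intro!: bexI[of _ "X - {l}"])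
    next
      fix X assume "X \<in> ?E \<union> insert l ` ?E"
      then obtain Y where Y: "Y \<in> ?E" "X = Y \<or> X = insert l Y" by blast
      then have YA: "Y \<subseteq> A - {l}" by (simp add: edges_def)
      then have "X - {l} = Y" "insert l X = insert l Y" using Y(2) by auto
      then show "X \<in> {X \<in> topes A. X - {l} \<in> topes A \<and> insert l X \<in> topes A}"
        using E[OF YA] Y by auto
    qed
    moreover have "finite ?E"
      using finite_subset[OF edges_subset_topes finite_topes[OF sub(1)]] .
    moreover have "?E \<inter> insert l ` ?E = {}" "inj_on (insert l) ?E"
      by (auto simp: edges_def inj_on_def)
    ultimately have "card {X \<in> topes A. X - {l} \<in> topes A \<and> insert l X \<in> topes A} = 2 * card ?E"
      by (simp add: card_Un_disjoint card_image)
    moreover have "A \<noteq> {l}" using assms by auto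
    ultimately show "card {X \<in> topes A. X - {l} \<in> topes A \<and> insert l X \<in> topes A} = 4 * card {v \<in> crossings. v \<in> l}"
      using card_crossings_on[OF l] by simp
  qed
  also have "\<dots> = 4 * (\<Sum>v\<in>crossings. wt A v)"
    unfolding wt_def sum_distrib_left[symmetric] using double_count[OF finite_A finite_crossings, of "\<lambda>l v. v \<in> l"] by simp
  finally show ?thesis .
qed

text \<open>Both sides count ordered pairs of distinct lines, sorted on the left by their
  intersection point.\<close>

lemma sum_pairs: "(\<Sum>v\<in>crossings. wt A v * (wt A v - 1)) = card A * (card A - 1)"
proof -
  have line: "(\<Sum>v\<in>{v \<in> crossings. v \<in> l}. wt A v - 1) = card A - 1" if l: "l \<in> A" for l
  proof -
    have "wt A v - 1 = card {m \<in> A - {l}. v \<in> m}" if "v \<in> l" for v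
    proof -
      have "{m \<in> A. v \<in> m} = insert l {m \<in> A - {l}. v \<in> m}" using that l by auto
      then show ?thesis using finite_A by (simp add: wt_def)
    qed
    then have "(\<Sum>v\<in>{v \<in> crossings. v \<in> l}. wt A v - 1) = (\<Sum>v\<in>{v \<in> crossings. v \<in> l}. card {m \<in> A - {l}. v \<in> m})"
      by (intro sum.cong) auto
    also have "\<dots> = (\<Sum>m\<in>A - {l}. card {v \<in> {v \<in> crossings. v \<in> l}. v \<in> m})"
      by (rule double_count) (use finite_crossings finite_A in auto)
    also have "\<dots> = (\<Sum>m\<in>A - {l}. 1)"
    proof (rule sum.cong[OF refl])
      fix m assume m: "m \<in> A - {l}"
      have "{v \<in> {v \<in> crossings. v \<in> l}. v \<in> m} = {pt l m}"
      proof (intro equalityI subsetI)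
        fix v assume "v \<in> {v \<in> {v \<in> crossings. v \<in> l}. v \<in> m}"
        then show "v \<in> {pt l m}" using in_meet_eq_pt[of l m v] l m by auto
      next
        fix v assume "v \<in> {pt l m}"
        then have "v \<in> l" "v \<in> m" using pt_in[of l m] l m by auto
        then show "v \<in> {v \<in> {v \<in> crossings. v \<in> l}. v \<in> m}"
          using l m unfolding crossings_def by blast
      qed
      then show "card {v \<in> {v \<in> crossings. v \<in> l}. v \<in> m} = 1" by simp
    qed
    also have "\<dots> = card A - 1" using l finite_A by simp
    finally show ?thesis .
  qed
  have "(\<Sum>v\<in>crossings. wt A v * (wt A v - 1)) = (\<Sum>v\<in>crossings. \<Sum>l\<in>A. if v \<in> l then wt A v - 1 else 0)"
    using finite_A by (intro sum.cong) (auto simp: wt_def sum.inter_filter[symmetric])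
  also have "\<dots> = (\<Sum>l\<in>A. \<Sum>v\<in>crossings. if v \<in> l then wt A v - 1 else 0)"
    by (rule sum.swap)
  also have "\<dots> = (\<Sum>l\<in>A. card A - 1)"
    using finite_crossings line by (intro sum.cong) (simp_all add: sum.inter_filter[symmetric])
  finally show ?thesis by simp
qed

text \<open>A tope is determined by its walls: dropping a non-wall \<open>k\<close> from the list of lines does not merge
  the tope with another one, since the two would be separated by an edge on \<open>k\<close>.\<close>

lemma walls_determine_tope:
  assumes X: "X \<in> topes A" "wall X \<subseteq> B" and B: "B \<subseteq> A" and X': "X' \<in> topes A" "X' \<inter> B = X \<inter> B"
  shows "X' = X"
proof -
  \<comment> \<open>\<open>C\<close> contains the lines on which \<open>Z\<close> and
    \<open>X\<close> may differ.\<close>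
  have "finite C \<Longrightarrow> C \<subseteq> A - B \<Longrightarrow> Z \<in> topes A \<Longrightarrow> Z \<inter> (A - C) = X \<inter> (A - C) \<Longrightarrow> Z = X" for C Z
  proof (induction C arbitrary: Z rule: finite_induct)
    case empty
    then have "Z \<subseteq> A" "X \<subseteq> A" using X by (auto simp: topes_def)
    then show ?case using empty by auto
  next
    case (insert k C)
    have kA: "k \<in> A" "k \<notin> B" using insert.prems by auto
    show ?case
    proof (cases "k \<in> Z \<longleftrightarrow> k \<in> X")
      case True
      then have "Z \<inter> (A - C) = X \<inter> (A - C)" using insert.prems(3) by blast
      then show ?thesis using insert by auto
    next
      case False
      let ?E = "A - insert k C"
      have EA: "?E \<subseteq> A" "A \<subseteq> A" by auto
      obtain x where x: "x \<in> region A X" using X(1) by (auto simp: topes_def)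
      obtain y where y: "y \<in> region A Z" using insert.prems(2) by (auto simp: topes_def)
      have xE: "x \<in> region ?E X" "y \<in> region ?E X"
      proof -
        show "x \<in> region ?E X" using x by (simp add: region_def)
        have "y \<in> region ?E Z" using y by (simp add: region_def)
        then show "y \<in> region ?E X" using region_cong[OF insert.prems(3)] by simp
      qed
      have "tw X k x = 1" "tw Z k y = 1" using x y kA by (simp_all add: region_def)
      then have "s k x = 1 \<and> s k y = - 1 \<or> s k x = - 1 \<and> s k y = 1"
        using False by (auto simp: tw_def split: if_splits)
      then obtain z where z: "z \<in> region ?E X" "s k z = 0"
        using region_meets_curve[OF EA(1) kA(1)] xE by blast
      obtain z' where z': "z' \<in> region ?E X" "s k z' = 0" "\<And>m. m \<in> A - {k} \<Longrightarrow> s m z' \<noteq> 0"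
        by (rule generic_curve_point[OF kA(1) region_open[OF EA(1)] z]) (rule that)
      let ?Y = "tope_at (A - {k}) z'"
      have z'S: "z' \<in> \<S>" using z'(1) region_subset_sphere by blast
      have ins: "insert k (A - {k}) = A" using kA by auto
      have YA: "?Y \<subseteq> A - {k}" by (auto simp: tope_at_def)
      have "z' \<in> region (A - {k}) ?Y"
        by (rule region_tope_at) (use z' z'S in auto)
      then have "?Y \<in> edges k (A - {k})"
        using YA z'(2) by (auto simp: edges_def)
      then have YT: "?Y \<in> topes A" "insert k ?Y \<in> topes A"
        using edges_iff_topes[OF kA(1) _ _ YA, unfolded ins] by auto
      have YE: "m \<in> ?Y \<longleftrightarrow> m \<in> X" if "m \<in> ?E" for m
        using z'(1) that by (auto simp: region_def tw_def tope_at_def split: if_splits)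
      \<comment> \<open>\<open>X2\<close> agrees with \<open>X\<close> on \<open>k\<close> too, so
        the induction hypothesis identifies it with \<open>X\<close>. As \<open>X2\<close> borders
        an edge on \<open>k\<close>, the line \<open>k\<close> would be a wall of \<open>X\<close>
        outside \<open>B\<close>.\<close>
      define X2 where "X2 = (if k \<in> X then insert k ?Y else ?Y)"
      have "X2 \<inter> (A - C) = X \<inter> (A - C)"
        using YE YA insert.hyps(2) unfolding X2_def by auto
      moreover have "X2 \<in> topes A" using YT by (simp add: X2_def)
      ultimately have "X2 = X" using insert.IH insert.prems(1) by auto
      then have "X - {k} = ?Y" "insert k X = insert k ?Y"
        using YA by (auto simp: X2_def split: if_splits)
      then have "k \<in> wall X" using YT kA by (simp add: wall_def)
      then show ?thesis using X(2) kA by blast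
    qed
  qed
  from this[of "A - B" X'] show ?thesis
    using X' B finite_A by (simp add: double_diff)
qed

text \<open>The sign vectors of the eight chambers on the sphere around the two lifts of a double point.\<close>

definition quad :: "proj_plane \<Rightarrow> proj_plane set set set" where
  "quad v = {X \<in> topes A. \<exists>x\<in>\<S>. proj x = v \<and> (\<forall>k\<in>A. v \<notin> k \<longrightarrow> (k \<in> X \<longleftrightarrow> s k x = 1))}"

section \<open>Chambers around double points\<close>

lemma tope_near_double_point:
  assumes x: "x \<in> \<S>" "proj x = v" and v: "{k \<in> A. v \<in> k} = {l, m}" "l \<noteq> m" and S: "S \<subseteq> {l, m}"
  shows "tope_at A x \<union> S \<in> quad v"
proof -
  have lm: "l \<in> A" "m \<in> A" "v \<in> l" "v \<in> m" using v(1) by blast+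
  have zero: "s k x = 0 \<longleftrightarrow> k = l \<or> k = m" if "k \<in> A" for k
    using side_zero_iff[OF that x(1)] x(2) v(1) that by blast
  let ?Z = "tope_at A x" and ?B = "A - {l, m}"
  have x0: "x \<in> region ?B ?Z"
    using side_cases[OF _ x(1)] zero x(1) by (force simp: region_def tw_def tope_at_def)
  have BA: "?B \<subseteq> A" by blast
  obtain y where y: "y \<in> region ?B ?Z" "tw (?Z \<union> S) l y = 1" "tw (?Z \<union> S) m y = 1" "\<And>k. k \<in> A \<Longrightarrow> s k y \<noteq> 0"
    by (rule corner[OF lm(1,2) v(2) region_open[OF BA] x0]) (use zero lm in auto)
  have yS: "y \<in> \<S>" using y(1) region_subset_sphere by blast
  have "k \<in> tope_at A y \<longleftrightarrow> k \<in> ?Z \<union> S" if k: "k \<in> A" for k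
  proof (cases "k = l \<or> k = m")
    case True
    then show ?thesis using y(2,3) k by (auto simp: tope_at_def tw_def split: if_splits)
  next
    case False
    then have "tw ?Z k y = 1" using y(1) k by (simp add: region_def)
    then show ?thesis using False k S by (auto simp: tope_at_def tw_def split: if_splits)
  qed
  moreover have "?Z \<union> S \<subseteq> A" using S lm by (auto simp: tope_at_def)
  ultimately have "tope_at A y = ?Z \<union> S" by (auto simp: tope_at_def)
  then have "?Z \<union> S \<in> topes A"
    using tope_at_topes[OF subset_refl yS y(4)] by simp
  moreover have "\<forall>k\<in>A. v \<notin> k \<longrightarrow> (k \<in> ?Z \<union> S \<longleftrightarrow> s k x = 1)"
    using S lm by (auto simp: tope_at_def)
  ultimately show ?thesis
    using x by (auto simp: quad_def)
qed

lemma quad_flip: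
  assumes X: "X \<in> quad v" and v: "{k \<in> A. v \<in> k} = {l, m}" "l \<noteq> m" and S: "S \<subseteq> {l, m}"
  shows "(X - {l, m}) \<union> S \<in> quad v"
proof -
  obtain x where x: "x \<in> \<S>" "proj x = v" "\<forall>k\<in>A. v \<notin> k \<longrightarrow> (k \<in> X \<longleftrightarrow> s k x = 1)" and XA: "X \<subseteq> A"
    using X by (auto simp: quad_def topes_def)
  have "k \<in> tope_at A x \<longleftrightarrow> k \<in> X - {l, m}" for k
  proof (cases "k \<in> A")
    case True
    have "v \<in> k \<longleftrightarrow> k \<in> {l, m}" using v(1) True by blast
    then show ?thesis
      using side_zero_iff[OF True x(1)] x(2,3) True by (cases "v \<in> k") (simp_all add: tope_at_def)
  next
    case False
    then show ?thesis using XA by (auto simp: tope_at_def)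
  qed
  then have "tope_at A x = X - {l, m}" by blast
  then show ?thesis
    using tope_near_double_point[OF x(1,2) v S] by simp
qed

text \<open>Every sign combination of \<open>l\<close> and \<open>m\<close> occurs around
  \<open>v\<close>, so flipping either of them alone leads to a tope of the same quad.\<close>

lemma quad_wall:
  assumes "X \<in> quad v" and v: "{k \<in> A. v \<in> k} = {l, m}" "l \<noteq> m"
  shows "{l, m} \<subseteq> wall X" "X - {l} \<in> quad v" "insert l X \<in> quad v"
proof -
  have S: "X - {k} \<in> quad v \<and> insert k X \<in> quad v" if "k \<in> {l, m}" for k
  proof -
    have "X - {k} = (X - {l, m}) \<union> (X \<inter> {l, m} - {k})" "insert k X = (X - {l, m}) \<union> insert k (X \<inter> {l, m})"
      using that by auto
    moreover have "X \<inter> {l, m} - {k} \<subseteq> {l, m}" "insert k (X \<inter> {l, m}) \<subseteq> {l, m}"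
      using that by auto
    ultimately show ?thesis using quad_flip[OF assms] by metis
  qed
  then show "X - {l} \<in> quad v" "insert l X \<in> quad v" by auto
  have "l \<in> A" "m \<in> A" using v(1) by blast+
  then show "{l, m} \<subseteq> wall X" using S by (auto simp: wall_def quad_def)
qed

text \<open>Four chambers lie around each of the lifts \<open>x\<close> and \<open>- x\<close> of
  \<open>v\<close>. The two groups are disjoint, since a third line avoids \<open>v\<close> and has
  opposite signs at \<open>x\<close> and \<open>- x\<close>.\<close>

lemma card_quad:
  assumes v: "{k \<in> A. v \<in> k} = {l, m}" "l \<noteq> m" and n: "card A \<ge> 3"
  shows "card (quad v) \<ge> 8"
proof -
  obtain x where x: "x \<in> \<S>" "proj x = v" using proj_surj .
  have mx: "- x \<in> \<S>" "proj (- x) = v" using x proj_sphere_eq_iff[of "- x" x] by auto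
  let ?Q = "\<lambda>x. (\<lambda>S. tope_at A x \<union> S) ` Pow {l, m}"
  have no: "tope_at A y \<inter> {l, m} = {}" if y: "y \<in> \<S>" "proj y = v" for y
    using side_zero_iff[OF _ y(1)] y(2) v(1) by (fastforce simp: tope_at_def)
  have c: "card (?Q y) = 4" if "y \<in> \<S>" "proj y = v" for y
  proof -
    have "inj_on (\<lambda>S. tope_at A y \<union> S) (Pow {l, m})"
    proof (rule inj_onI)
      fix S T assume ST: "S \<in> Pow {l, m}" "T \<in> Pow {l, m}" "tope_at A y \<union> S = tope_at A y \<union> T"
      have cut: "(Z \<union> S') \<inter> M = S'" if "Z \<inter> M = {}" "S' \<subseteq> M" for Z S' M :: "proj_plane set set"
        using that by blast
      have "(tope_at A y \<union> S) \<inter> {l, m} = S" "(tope_at A y \<union> T) \<inter> {l, m} = T"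
        using ST(1,2) by (auto intro!: cut no that)
      then show "S = T" using ST(3) by metis
    qed
    then show ?thesis using v(2) by (simp add: card_image card_Pow)
  qed
  have "card {l, m} < card A" using n v(2) by simp
  then obtain k where k: "k \<in> A" "k \<notin> {l, m}"
    by (metis card_mono finite.emptyI finite.insertI leD subsetI)
  then have "v \<notin> k" using v(1) by blast
  then have "s k x \<noteq> 0" using side_zero_iff[OF k(1) x(1)] x(2) by simp
  then have "k \<in> tope_at A x \<longleftrightarrow> k \<notin> tope_at A (- x)"
    using side_cases[OF k(1) x(1)] side_minus[OF k(1) x(1)] k(1) by (auto simp: tope_at_def)
  then have "?Q x \<inter> ?Q (- x) = {}"
    using k(2) by auto
  then have "card (?Q x \<union> ?Q (- x)) = 8"
    using c[OF x] c[OF mx] by (subst card_Un_disjoint) auto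
  moreover have "?Q x \<union> ?Q (- x) \<subseteq> quad v"
    using tope_near_double_point[OF x v] tope_near_double_point[OF mx v] by auto
  moreover have "finite (quad v)"
    using finite_topes[OF subset_refl] by (simp add: quad_def)
  ultimately show ?thesis by (metis card_mono)
qed

text \<open>\<open>X\<close> has the walls \<open>l\<close>, \<open>m\<close>, \<open>m'\<close>,
  and so has its neighbour \<open>X'\<close> across \<open>l\<close>, because flipping
  \<open>l\<close> stays in both quads. As walls determine a tope, \<open>X\<close> and
  \<open>X'\<close> are the only topes with the signs of \<open>X\<close> on \<open>m\<close> and
  \<open>m'\<close>. A line other than \<open>l\<close> that misses the common point
  \<open>u\<close> of \<open>m\<close> and \<open>m'\<close> would yield a further one near its
  crossing with \<open>m\<close>.\<close>

lemma quads_meet_imp_pencil_aux: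
  assumes wall3: "\<And>X. X \<in> topes A \<Longrightarrow> card (wall X) = 3"
    and v: "{k \<in> A. v \<in> k} = {l, m}" "l \<noteq> m" and w: "{k \<in> A. w \<in> k} = {l, m'}" "l \<noteq> m'" and vw: "v \<noteq> w"
    and X: "X \<in> quad v" "X \<in> quad w"
  shows "\<exists>u. u \<notin> l \<and> (\<forall>k\<in>A - {l}. u \<in> k)"
proof -
  have in_A: "l \<in> A" "m \<in> A" "m' \<in> A" and inc: "v \<in> l" "v \<in> m" "w \<in> l" "w \<in> m'"
    using v(1) w(1) by blast+
  have "m \<noteq> m'"
  proof
    assume "m = m'"
    then show False using in_meet_eq_pt[of l m v] in_meet_eq_pt[of l m w] in_A inc v(2) vw by simp
  qed
  have three: "wall Y = {l, m, m'}" if "Y \<in> quad v" "Y \<in> quad w" for Y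
  proof -
    have "{l, m, m'} \<subseteq> wall Y" using quad_wall(1)[OF that(1) v] quad_wall(1)[OF that(2) w] by auto
    moreover have "card (wall Y) = 3" using that wall3 by (simp add: quad_def)
    moreover have "finite (wall Y)" using finite_A by (simp add: wall_def)
    moreover have "card {l, m, m'} = 3" using v(2) w(2) \<open>m \<noteq> m'\<close> by simp
    ultimately show ?thesis by (metis card_subset_eq)
  qed
  define X' where "X' = (if l \<in> X then X - {l} else insert l X)"
  have X': "X' \<in> quad v" "X' \<in> quad w"
    using quad_wall(2,3)[OF X(1) v] quad_wall(2,3)[OF X(2) w] by (auto simp: X'_def)
  have T: "X \<in> topes A" "X' \<in> topes A" using X X' by (simp_all add: quad_def)
  have only: "Z = X \<or> Z = X'" if Z: "Z \<in> topes A" "m \<in> Z \<longleftrightarrow> m \<in> X" "m' \<in> Z \<longleftrightarrow> m' \<in> X" for Z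
  proof (cases "l \<in> Z \<longleftrightarrow> l \<in> X")
    case True
    then have "Z \<inter> {l, m, m'} = X \<inter> {l, m, m'}" using Z by blast
    then show ?thesis
      using walls_determine_tope[OF T(1) _ _ Z(1), of "{l, m, m'}"] three[OF X] in_A by simp
  next
    case False
    then have "Z \<inter> {l, m, m'} = X' \<inter> {l, m, m'}"
      using Z v(2) w(2) unfolding X'_def by auto
    then show ?thesis
      using walls_determine_tope[OF T(2) _ _ Z(1), of "{l, m, m'}"] three[OF X'] in_A by simp
  qed
  let ?u = "pt m m'"
  have u: "?u \<in> m" "?u \<in> m'" using pt_in[OF in_A(2,3) \<open>m \<noteq> m'\<close>] by auto
  have "?u \<notin> l"
  proof
    assume "?u \<in> l"
    then have "?u = v"
      using in_meet_eq_pt[of l m] in_A u inc v(2) by metis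
    then have "m' \<in> {l, m}" using v(1) u in_A by blast
    then show False using w(2) \<open>m \<noteq> m'\<close> by blast
  qed
  moreover have "?u \<in> k" if k: "k \<in> A - {l}" for k
  proof (rule ccontr)
    assume nk: "?u \<notin> k"
    then have km: "k \<noteq> m" "k \<noteq> m'" "k \<noteq> l" "k \<in> A" using u k by auto
    \<comment> \<open>Of the two lifts of the crossing of \<open>m\<close> and \<open>k\<close>, one
      is on the side of \<open>m'\<close> that contains \<open>X\<close>; near it both signs of
      \<open>k\<close> occur together with the signs of \<open>X\<close> on \<open>m\<close> and
      \<open>m'\<close>, whereas \<open>X\<close> and \<open>X'\<close> agree on
      \<open>k\<close>.\<close>
    obtain y0 where y0: "y0 \<in> \<S>" "proj y0 = pt m k" using proj_surj .
    have q: "pt m k \<in> m" "pt m k \<in> k" using pt_in[OF in_A(2) km(4)] km(1) by auto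
    have "pt m k \<notin> m'"
      using in_meet_eq_pt[OF in_A(2,3) \<open>m \<noteq> m'\<close> q(1)] nk q(2) by metis
    then have "s m' y0 \<noteq> 0" using side_zero_iff[OF in_A(3) y0(1)] y0(2) by simp
    then have "tw X m' y0 = 1 \<or> tw X m' (- y0) = 1"
      using side_cases[OF in_A(3) y0(1)] side_minus[OF in_A(3) y0(1)] by (auto simp: tw_def)
    moreover have "proj (- y0) = proj y0" using proj_sphere_eq_iff[of "- y0" y0] y0(1) by simp
    ultimately obtain y where y: "y \<in> \<S>" "proj y = pt m k" "tw X m' y = 1"
      using y0 by (metis minus_in_sphere_iff)
    let ?U = "{y \<in> \<S>. tw X m' y = 1}"
    have U: "openin (top_of_set \<S>) ?U" "y \<in> ?U"
      using side_functionD(4)[OF side_tw[OF in_A(3)]] y by auto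
    have sz: "s m y = 0" "s k y = 0"
      using side_zero_iff[OF in_A(2) y(1)] side_zero_iff[OF km(4) y(1)] y(2) q by auto
    have ex: "\<exists>Z\<in>topes A. (m \<in> Z \<longleftrightarrow> m \<in> X) \<and> (m' \<in> Z \<longleftrightarrow> m' \<in> X) \<and> (k \<in> Z \<longleftrightarrow> b)" for b
    proof -
      define Y where "Y = (if b then insert k X else X - {k})"
      obtain z where z: "z \<in> ?U" "tw Y m z = 1" "tw Y k z = 1" "\<And>j. j \<in> A \<Longrightarrow> s j z \<noteq> 0"
        by (rule corner[OF in_A(2) km(4) km(1)[symmetric] U sz, where Y = Y]) (rule that)
      have "tope_at A z \<in> topes A"
        using z by (intro tope_at_topes) auto
      moreover have "m \<in> tope_at A z \<longleftrightarrow> m \<in> X"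
        using z(2) in_A km unfolding Y_def tope_at_def tw_def by (auto split: if_splits)
      moreover have "m' \<in> tope_at A z \<longleftrightarrow> m' \<in> X"
        using z(1) in_A unfolding tope_at_def tw_def by (auto split: if_splits)
      moreover have "k \<in> tope_at A z \<longleftrightarrow> b"
        using z(3) km unfolding Y_def tope_at_def tw_def by (auto split: if_splits)
      ultimately show ?thesis by blast
    qed
    obtain Z1 where Z1: "Z1 \<in> topes A" "m \<in> Z1 \<longleftrightarrow> m \<in> X" "m' \<in> Z1 \<longleftrightarrow> m' \<in> X" "k \<in> Z1"
      using ex[of True] by blast
    obtain Z2 where Z2: "Z2 \<in> topes A" "m \<in> Z2 \<longleftrightarrow> m \<in> X" "m' \<in> Z2 \<longleftrightarrow> m' \<in> X" "k \<notin> Z2"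
      using ex[of False] by blast
    have "k \<in> X \<longleftrightarrow> k \<in> X'" using km(3) by (auto simp: X'_def)
    then show False
      using only[OF Z1(1-3)] only[OF Z2(1-3)] Z1(4) Z2(4) by blast
  qed
  ultimately show ?thesis by blast
qed

text \<open>Two double points without a common line would give \<open>X\<close> four walls, so they
  share a line and the special case applies.\<close>

lemma quads_meet_imp_pencil:
  assumes wall3: "\<And>X. X \<in> topes A \<Longrightarrow> card (wall X) = 3"
    and v: "wt A v = 2" and w: "wt A w = 2" and vw: "v \<noteq> w" and X: "X \<in> quad v" "X \<in> quad w"
  shows "\<exists>l\<in>A. \<exists>u. u \<notin> l \<and> (\<forall>k\<in>A - {l}. u \<in> k)"
proof -
  obtain l m where lm: "{k \<in> A. v \<in> k} = {l, m}" "l \<noteq> m"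
    using v by (auto simp: wt_def card_2_iff)
  obtain l' m' where lm': "{k \<in> A. w \<in> k} = {l', m'}" "l' \<noteq> m'"
    using w by (auto simp: wt_def card_2_iff)
  have "{l, m} \<inter> {l', m'} \<noteq> {}"
  proof
    assume "{l, m} \<inter> {l', m'} = {}"
    then have "card ({l, m} \<union> {l', m'}) = 4"
      using lm(2) lm'(2) by (subst card_Un_disjoint) auto
    moreover have "{l, m} \<union> {l', m'} \<subseteq> wall X"
      using quad_wall(1)[OF X(1) lm] quad_wall(1)[OF X(2) lm'] by auto
    moreover have "finite (wall X)" using finite_A by (simp add: wall_def)
    ultimately have "4 \<le> card (wall X)" by (metis card_mono)
    moreover have "card (wall X) = 3" using X wall3 by (simp add: quad_def)
    ultimately show False by simp
  qed
  then obtain j where j: "j \<in> {l, m}" "j \<in> {l', m'}" by blast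
  obtain a where a: "{k \<in> A. v \<in> k} = {j, a}" "j \<noteq> a"
    using lm j(1) by (metis doubleton_eq_iff insertE singletonD)
  obtain b where b: "{k \<in> A. w \<in> k} = {j, b}" "j \<noteq> b"
    using lm' j(2) by (metis doubleton_eq_iff insertE singletonD)
  have "j \<in> A" using a(1) by blast
  then show ?thesis
    using quads_meet_imp_pencil_aux[OF wall3 a b vw X] by blast
qed

text \<open>Without a pencil the quads of different double points are disjoint, and each has at
  least eight topes.\<close>

lemma double_points_bound:
  assumes wall3: "\<And>X. X \<in> topes A \<Longrightarrow> card (wall X) = 3" and n: "card A \<ge> 3"
    and no_pencil: "\<not> (\<exists>l\<in>A. \<exists>u. u \<notin> l \<and> (\<forall>k\<in>A - {l}. u \<in> k))"
  shows "8 * card {v \<in> crossings. wt A v = 2} \<le> card (topes A)"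
proof -
  let ?D = "{v \<in> crossings. wt A v = 2}"
  have "8 * card ?D = (\<Sum>v\<in>?D. 8)" by simp
  also have "\<dots> \<le> (\<Sum>v\<in>?D. card (quad v))"
  proof (rule sum_mono)
    fix v assume "v \<in> ?D"
    then obtain l m where "{k \<in> A. v \<in> k} = {l, m}" "l \<noteq> m"
      by (auto simp: wt_def card_2_iff)
    then show "8 \<le> card (quad v)" using card_quad n by blast
  qed
  also have "\<dots> = card (\<Union>v\<in>?D. quad v)"
  proof (rule card_UN_disjoint[symmetric])
    show "finite ?D" using finite_crossings by simp
    show "\<forall>v\<in>?D. finite (quad v)" using finite_topes[OF subset_refl] by (simp add: quad_def)
    show "\<forall>v\<in>?D. \<forall>w\<in>?D. v \<noteq> w \<longrightarrow> quad v \<inter> quad w = {}"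
      using quads_meet_imp_pencil[OF wall3] no_pencil by blast
  qed
  also have "\<dots> \<le> card (topes A)"
    by (rule card_mono[OF finite_topes[OF subset_refl]]) (auto simp: quad_def)
  finally show ?thesis .
qed

end

section \<open>Chambers and their walls\<close>

text \<open>A nonzero vector represents a point of the image if its unit vector or the antipode of
  that is in \<open>U\<close>; this is an open condition, as \<open>sgn\<close> is continuous off
  0.\<close>

lemma open_image_proj:
  assumes "openin (top_of_set \<S>) U"
  shows "open (proj ` U)"
proof -
  obtain U' where U': "open U'" "U = \<S> \<inter> U'"
    using assms by (auto simp: openin_open)
  have pre: "open {v :: real ^ 3. v \<noteq> 0 \<and> c *\<^sub>R sgn v \<in> U'}" for c
  proof -
    have "continuous_on (- {0 :: real ^ 3}) (\<lambda>v. c *\<^sub>R sgn v)"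
      by (intro continuous_on_scaleR continuous_on_const continuous_on_sgn continuous_on_id) auto
    then have "open (- {0 :: real ^ 3} \<inter> (\<lambda>v. c *\<^sub>R sgn v) -` U')"
      using U'(1) by (intro continuous_open_preimage) auto
    moreover have "- {0 :: real ^ 3} \<inter> (\<lambda>v. c *\<^sub>R sgn v) -` U' = {v. v \<noteq> 0 \<and> c *\<^sub>R sgn v \<in> U'}"
      by auto
    ultimately show ?thesis by simp
  qed
  have iff: "proj v \<in> proj ` U \<longleftrightarrow> 1 *\<^sub>R sgn v \<in> U' \<or> (- 1) *\<^sub>R sgn v \<in> U'" if v: "v \<noteq> 0" for v
  proof -
    have sv: "sgn v \<in> \<S>" using v by (rule sgn_in_sphere)
    have "proj v \<in> proj ` U \<longleftrightarrow> (\<exists>x\<in>U. proj (sgn v) = proj x)"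
      using v by auto
    also have "\<dots> \<longleftrightarrow> (\<exists>x\<in>U. sgn v = x \<or> sgn v = - x)"
      using proj_sphere_eq_iff[OF sv] U'(2) by (intro bex_cong) auto
    also have "\<dots> \<longleftrightarrow> sgn v \<in> U \<or> - sgn v \<in> U"
      by (metis minus_minus)
    finally show ?thesis using U'(2) sv by auto
  qed
  have "{v. v \<noteq> 0 \<and> proj v \<in> proj ` U} =
      {v. v \<noteq> 0 \<and> 1 *\<^sub>R sgn v \<in> U'} \<union> {v. v \<noteq> 0 \<and> (- 1) *\<^sub>R sgn v \<in> U'}"
    using iff by auto
  then show ?thesis
    unfolding open_proj_plane_def using pre by (simp only: open_Un)
qed

lemma openin_proj_preimage:
  assumes "open W"
  shows "openin (top_of_set \<S>) {x \<in> \<S>. proj x \<in> W}"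
proof -
  have "{x \<in> \<S>. proj x \<in> W} = \<S> \<inter> {v. v \<noteq> 0 \<and> proj v \<in> W}"
    using sphere_nonzero by auto
  then show ?thesis
    using assms by (simp add: open_proj_plane_def openin_open_Int)
qed

lemma continuous_on_proj: "continuous_on \<S> proj"
proof -
  have "\<exists>U. open U \<and> U \<inter> \<S> = proj -` W \<inter> \<S>" if "open W" for W
  proof -
    have "open {v. v \<noteq> 0 \<and> proj v \<in> W}"
      using that by (simp add: open_proj_plane_def)
    moreover have "{v. v \<noteq> 0 \<and> proj v \<in> W} \<inter> \<S> = proj -` W \<inter> \<S>"
      using sphere_nonzero by auto
    ultimately show ?thesis by blast
  qed
  then show ?thesis
    unfolding continuous_on_open_invariant by blast
qed

context lifted_arrangement
begin

text \<open>The images of the regions are open and cover the complement of the lines. Two of them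
  are equal or disjoint, since regions with a common projected point have equal or opposite sign
  vectors. So a connected set cannot leave the image it meets.\<close>

lemma connected_subset_proj_region:
  assumes B: "B \<subseteq> A" and D: "connected D" "D \<subseteq> - \<Union>B" "D \<inter> proj ` region B Z \<noteq> {}"
  shows "D \<subseteq> proj ` region B Z"
proof -
  let ?R = "region B Z"
  \<comment> \<open>The sign vectors whose regions meet neither \<open>?R\<close> nor its antipodal
    image.\<close>
  let ?F = "{Y. region B Y \<inter> ?R = {} \<and> (\<forall>z\<in>region B Y. - z \<notin> ?R)}"
  let ?O = "\<Union>Y\<in>?F. region B Y"
  have RS: "region B Y \<subseteq> \<S>" for Y by (rule region_subset_sphere)
  have op: "open (proj ` ?R)" "open (proj ` ?O)"
  proof -
    have "openin (top_of_set \<S>) ?O"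
      by (rule openin_Union) (use region_open[OF B] in blast)
    then show "open (proj ` ?R)" "open (proj ` ?O)"
      using region_open[OF B] open_image_proj by blast+
  qed
  have disj: "proj ` ?R \<inter> proj ` ?O = {}"
  proof (rule ccontr)
    assume "proj ` ?R \<inter> proj ` ?O \<noteq> {}"
    then obtain x y Y where xy: "x \<in> ?R" "y \<in> region B Y" "Y \<in> ?F" "proj x = proj y" by auto
    have "x \<in> \<S>" "y \<in> \<S>" using xy RS by auto
    then have "x = y \<or> x = - y" using proj_sphere_eq_iff xy(4) by blast
    then show False using xy by auto
  qed
  have cov: "D \<subseteq> proj ` ?R \<union> proj ` ?O"
  proof
    fix p assume p: "p \<in> D"
    obtain x where x: "x \<in> \<S>" "proj x = p" using proj_surj .
    have nz: "s l x \<noteq> 0" if "l \<in> B" for l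
      using side_zero_iff[of l x] x p D(2) B that by auto
    let ?Y = "tope_at B x"
    have xY: "x \<in> region B ?Y" by (rule region_tope_at[OF B x(1) nz])
    show "p \<in> proj ` ?R \<union> proj ` ?O"
    proof (cases "?Y \<in> ?F")
      case True
      then show ?thesis using x(2) xY by blast
    next
      case False
      then consider z where "z \<in> region B ?Y" "z \<in> ?R" | z where "z \<in> region B ?Y" "- z \<in> ?R" by blast
      then show ?thesis
      proof cases
        case 1
        have "tw Z l x = 1" if l: "l \<in> B" for l
        proof -
          have "tw ?Y l z = 1" "tw Z l z = 1" "tw ?Y l x = 1" using 1 xY l by (auto simp: region_def)
          then show ?thesis by (auto simp: tw_def split: if_splits)
        qed
        then have "x \<in> ?R" using x(1) by (simp add: region_def)
        then show ?thesis using x(2) by blast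
      next
        case 2
        have zS: "z \<in> \<S>" using 2 RS by auto
        have "tw Z l (- x) = 1" if l: "l \<in> B" for l
        proof -
          have lA: "l \<in> A" using B l by blast
          have "tw ?Y l z = 1" "tw Z l (- z) = 1" "tw ?Y l x = 1" using 2 xY l by (auto simp: region_def)
          then show ?thesis
            using side_minus[OF lA x(1)] side_minus[OF lA zS] by (auto simp: tw_def split: if_splits)
        qed
        then have "- x \<in> ?R" using x(1) by (simp add: region_def)
        moreover have "proj (- x) = p" using x proj_sphere_eq_iff[of "- x" x] by simp
        ultimately show ?thesis by blast
      qed
    qed
  qed
  have one: "proj ` ?R \<inter> D = {} \<or> proj ` ?O \<inter> D = {}"
    using connectedD[OF D(1) op] disj cov by blast
  have concl: "D \<subseteq> P" if "P \<inter> D = {} \<or> Q \<inter> D = {}" "D \<inter> P \<noteq> {}" "D \<subseteq> P \<union> Q" for P Q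
    using that by blast
  show ?thesis by (rule concl[OF one D(3) cov])
qed

lemma proj_region_chamber:
  assumes "X \<in> topes A"
  shows "proj ` region A X \<in> chambers A"
  unfolding chambers_def in_components_maximal
proof (intro conjI allI impI)
  show "proj ` region A X \<noteq> {}" using assms by (simp add: topes_def)
  show sub: "proj ` region A X \<subseteq> - \<Union>A"
  proof (intro image_subsetI ComplI)
    fix x assume x: "x \<in> region A X" "proj x \<in> \<Union>A"
    then obtain l where l: "l \<in> A" "proj x \<in> l" by blast
    have "x \<in> \<S>" using x(1) region_subset_sphere by blast
    then show False using side_zero_iff[OF l(1)] l(2) region_nonzero[OF x(1) l(1)] by blast
  qed
  show "connected (proj ` region A X)"
    by (rule connected_continuous_image[OF continuous_on_subset[OF continuous_on_proj region_subset_sphere]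
        region_connected[OF subset_refl]])
  fix D assume D: "D \<noteq> {} \<and> proj ` region A X \<subseteq> D \<and> D \<subseteq> - \<Union>A \<and> connected D"
  have "proj ` region A X \<noteq> {}" using assms by (simp add: topes_def)
  then have "D \<inter> proj ` region A X \<noteq> {}"
    using D by (simp add: Int_absorb1)
  then have "D \<subseteq> proj ` region A X"
    using connected_subset_proj_region[OF subset_refl] D by blast
  then show "D = proj ` region A X" using D by blast
qed

lemma not_vertex_iff:
  assumes "l \<in> A" "p \<in> l"
  shows "p \<notin> vertices A \<longleftrightarrow> p \<notin> \<Union>(A - {l})"
proof -
  have fin: "finite (through A p)" using finite_A by (simp add: through_def)
  have l: "l \<in> through A p" using assms by (simp add: through_def)
  have "p \<notin> \<Union>(A - {l}) \<longleftrightarrow> through A p = {l}"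
    using assms by (auto simp: through_def)
  moreover have "through A p = {l} \<longleftrightarrow> card (through A p) \<le> 1"
    using card_le_Suc0_iff_eq[OF fin] l by auto
  ultimately show ?thesis
    by (auto simp: vertices_def weight_def)
qed

lemma wall_iff_edge:
  assumes "X \<subseteq> A" "l \<in> A"
  shows "l \<in> wall X \<longleftrightarrow> X - {l} \<in> edges l (A - {l})"
proof -
  have ins: "insert l (A - {l}) = A" "insert l (X - {l}) = insert l X" using assms(2) by auto
  show ?thesis
    using edges_iff_topes[OF assms(2), of "A - {l}" "X - {l}", unfolded ins] assms by (auto simp: wall_def)
qed

text \<open>At a point \<open>p\<close> of the edge only \<open>l\<close> is present, so the region
  of the other lines around a lift of \<open>p\<close> projects to a neighbourhood of
  \<open>p\<close> and meets the chamber. Up to the antipodal map, the chamber thus has on the other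
  lines the signs of a point of \<open>l\<close>.\<close>

lemma bounds_imp_wall:
  assumes X: "X \<in> topes A" and l: "l \<in> A" and b: "bounds A l (proj ` region A X)"
  shows "l \<in> wall X"
proof -
  let ?B = "A - {l}" and ?R = "region A X"
  have BA: "?B \<subseteq> A" by blast
  obtain e where e: "e \<in> components (l - vertices A)" "e \<subseteq> frontier (proj ` ?R)"
    using b by (auto simp: bounds_def)
  then obtain p where p: "p \<in> e" using in_components_nonempty by blast
  then have pl: "p \<in> l" "p \<notin> vertices A" "p \<in> closure (proj ` ?R)"
    using in_components_subset[OF e(1)] e(2) by (auto simp: frontier_def)
  obtain x where x: "x \<in> \<S>" "proj x = p" using proj_surj .
  have notin: "p \<notin> \<Union>?B" using not_vertex_iff[OF l pl(1)] pl(2) by blast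
  have nz: "s m y \<noteq> 0" if "m \<in> ?B" "y \<in> \<S>" "proj y = p" for m y
    using side_zero_iff[of m y] that notin by auto
  let ?U = "region ?B (tope_at ?B x)"
  have xU: "x \<in> ?U" by (rule region_tope_at[OF BA x(1)]) (use nz x in auto)
  have "open (proj ` ?U)" by (rule open_image_proj[OF region_open[OF BA]])
  moreover have "p \<in> proj ` ?U" using xU x(2) by blast
  ultimately have "proj ` ?U \<inter> proj ` ?R \<noteq> {}"
    using open_Int_closure_eq_empty[of "proj ` ?U" "proj ` ?R"] pl(3) by blast
  then obtain y z where yz: "y \<in> ?U" "z \<in> ?R" "proj y = proj z" by auto
  have S: "y \<in> \<S>" "z \<in> \<S>" using yz region_subset_sphere by blast+
  have same: "s m y = s m x" if "m \<in> ?B" for m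
  proof -
    have "tw (tope_at ?B x) m y = 1" "tw (tope_at ?B x) m x = 1"
      using yz(1) xU that by (auto simp: region_def)
    then show ?thesis by (auto simp: tw_def split: if_splits)
  qed
  have "y = z \<or> y = - z" using proj_sphere_eq_iff[OF S] yz(3) by simp
  then obtain x' where x': "x' \<in> \<S>" "proj x' = p" "\<And>m. m \<in> ?B \<Longrightarrow> s m z = s m x'"
  proof
    assume "y = z"
    then show thesis using that[OF x] same by simp
  next
    assume yz': "y = - z"
    have mx: "- x \<in> \<S>" "proj (- x) = p" using x proj_sphere_eq_iff[of "- x" x] by auto
    have "s m z = s m (- x)" if m: "m \<in> ?B" for m
      using same[OF m] side_minus[of m z] side_minus[of m x] yz' S(2) x(1) m by auto
    then show thesis using that[OF mx] by blast
  qed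
  have "X - {l} = tope_at ?B x'"
  proof -
    have "X = tope_at A z" using region_imp_tope_at[OF yz(2)] X by (simp add: topes_def)
    then have "k \<in> X - {l} \<longleftrightarrow> k \<in> tope_at ?B x'" for k
      using x'(3)[of k] by (cases "k = l"; cases "k \<in> A") (simp_all add: tope_at_def)
    then show ?thesis by blast
  qed
  moreover have "x' \<in> region ?B (tope_at ?B x')"
    by (rule region_tope_at[OF BA x'(1)]) (use nz x' in auto)
  moreover have "s l x' = 0" using side_zero_iff[OF l x'(1)] x'(2) pl(1) by simp
  moreover have "tope_at ?B x' \<subseteq> ?B" by (auto simp: tope_at_def)
  ultimately have "X - {l} \<in> edges l ?B" by (auto simp: edges_def)
  then show ?thesis using wall_iff_edge[OF _ l] X by (simp add: topes_def)
qed

text \<open>A 1-cell of \<open>l\<close> that meets the image of the region of the other lines stays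
  in that image by connectedness, and each of its points can be moved off \<open>l\<close> to the
  side of \<open>X\<close>. Hence it lies in the frontier of the chamber.\<close>

lemma wall_imp_bounds:
  assumes X: "X \<in> topes A" and l: "l \<in> wall X"
  shows "bounds A l (proj ` region A X)"
proof -
  have lA: "l \<in> A" using l by (simp add: wall_def)
  let ?B = "A - {l}" and ?Z = "X - {l}" and ?R = "region A X"
  have BA: "?B \<subseteq> A" by blast
  have "?Z \<in> edges l ?B" using wall_iff_edge[OF _ lA] X l by (simp add: topes_def)
  then obtain x where x: "x \<in> region ?B ?Z" "s l x = 0" by (auto simp: edges_def)
  have xS: "x \<in> \<S>" using x(1) region_subset_sphere by blast
  have pl: "proj x \<in> l" using side_zero_iff[OF lA xS] x(2) by simp
  have "proj x \<notin> \<Union>?B"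
  proof
    assume "proj x \<in> \<Union>?B"
    then obtain m where m: "m \<in> ?B" "proj x \<in> m" by blast
    then have "s m x = 0" using side_zero_iff[OF _ xS, of m] by simp
    then show False using region_nonzero[OF x(1) m(1)] by simp
  qed
  then have pv: "proj x \<in> l - vertices A" using not_vertex_iff[OF lA pl] pl by blast
  let ?e = "connected_component_set (l - vertices A) (proj x)"
  have e: "?e \<in> components (l - vertices A)" "connected ?e" "proj x \<in> ?e" "?e \<subseteq> l - vertices A"
    using pv by (simp_all add: componentsI connected_component_refl connected_component_subset)
  have "?e \<subseteq> - \<Union>?B" using e(4) not_vertex_iff[OF lA] by auto
  moreover have "?e \<inter> proj ` region ?B ?Z \<noteq> {}" using e(3) x(1) by blast
  ultimately have sub: "?e \<subseteq> proj ` region ?B ?Z"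
    by (rule connected_subset_proj_region[OF BA e(2)])
  have "?e \<subseteq> frontier (proj ` ?R)"
  proof
    fix q assume q: "q \<in> ?e"
    then obtain y where y: "y \<in> region ?B ?Z" "q = proj y" using sub by blast
    have yS: "y \<in> \<S>" using y(1) region_subset_sphere by blast
    have ql: "q \<in> l" using q e(4) by blast
    have sy: "s l y = 0" using side_zero_iff[OF lA yS] ql y(2) by simp
    have "q \<in> closure (proj ` ?R)"
    proof (rule ccontr)
      assume n: "q \<notin> closure (proj ` ?R)"
      let ?W = "{x \<in> \<S>. proj x \<in> - closure (proj ` ?R)}"
      have oW: "openin (top_of_set \<S>) (?W \<inter> region ?B ?Z)"
        by (intro openin_Int openin_proj_preimage region_open[OF BA] open_Compl closed_closure)
      have yW: "y \<in> ?W \<inter> region ?B ?Z" using y yS n by simp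
      obtain z where z: "z \<in> ?W \<inter> region ?B ?Z" "tw X l z = 1"
        using side_dense[OF lA oW yW sy] .
      have "region ?B ?Z = region ?B X" by (rule region_cong) auto
      moreover have "insert l ?B = A" using lA by blast
      ultimately have "z \<in> ?R"
        using z region_insert[of l ?B X] region_subset_sphere by auto
      then show False using z(1) closure_subset[of "proj ` ?R"] by blast
    qed
    moreover have "q \<notin> interior (proj ` ?R)"
    proof -
      have "proj ` ?R \<in> chambers A" by (rule proj_region_chamber[OF X])
      then have "proj ` ?R \<subseteq> - \<Union>A" unfolding chambers_def by (rule in_components_subset)
      then show ?thesis using ql lA interior_subset by blast
    qed
    ultimately show "q \<in> frontier (proj ` ?R)" by (simp add: frontier_def)
  qed
  then show ?thesis using e(1) by (auto simp: bounds_def)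
qed

lemma simplicial_card_wall:
  assumes "simplicial A" "X \<in> topes A"
  shows "card (wall X) = 3"
proof -
  have "wall X = {l \<in> A. bounds A l (proj ` region A X)}"
    using bounds_imp_wall[OF assms(2)] wall_imp_bounds[OF assms(2)] by (auto simp: wall_def)
  then show ?thesis
    using assms(1) proj_region_chamber[OF assms(2)] by (simp add: simplicial_def)
qed

end

section \<open>The characteristic polynomial and the bounds\<close>

text \<open>Transversality with one other line already makes the lift of \<open>l\<close>
  antipodal.\<close>

lemma pseudoline_arrangement_lift:
  assumes A: "pseudoline_arrangement A"
  obtains g s where "lifted_arrangement A g s"
proof -
  have fin: "finite A" "card A \<ge> 3"
    and meet: "\<And>l m. l \<in> A \<Longrightarrow> m \<in> A \<Longrightarrow> l \<noteq> m \<Longrightarrow> \<exists>p. l \<inter> m = {p} \<and> transversal_at l m p"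
    using A by (simp_all add: pseudoline_arrangement_def)
  have "\<exists>g s. antipodal_curve g \<and> range g = {x \<in> \<S>. proj x \<in> l} \<and> side_function s (range g)" if l: "l \<in> A" for l
  proof -
    have "\<exists>m\<in>A. m \<noteq> l"
    proof (rule ccontr)
      assume "\<not> ?thesis"
      then have "A \<subseteq> {l}" by blast
      then have "card A \<le> card {l}" by (intro card_mono) auto
      then show False using fin by simp
    qed
    then obtain m where m: "m \<in> A" "l \<noteq> m" by blast
    obtain p where p: "l \<inter> m = {p}" "transversal_at l m p" using meet[OF l m] by blast
    from p(2) obtain f h a b where f: "parametrizes f l" "parametrizes h m" "proj (f a) = p" "proj (h b) = p"
        "tangent f a \<noteq> tangent h b"
      unfolding transversal_at_def by blast
    have anti: "sgn (f (t + 1)) = - sgn (f t)" for t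
      by (rule transversal_imp_antipodal[OF f(1,2) p(1) f(3,4,5)])
    note c = parametrizes_antipodal_curve[OF f(1) anti]
    obtain s where "side_function s (range (\<lambda>t. sgn (f t)))"
      using antipodal_curve_side_function[OF c(1)] .
    then show ?thesis using c by blast
  qed
  then have "\<forall>l\<in>A. \<exists>g. \<exists>s. antipodal_curve g \<and> range g = {x \<in> \<S>. proj x \<in> l} \<and> side_function s (range g)"
    by simp
  from bchoice[OF this] obtain g where g: "\<forall>l\<in>A. \<exists>s. antipodal_curve (g l) \<and> range (g l) = {x \<in> \<S>. proj x \<in> l} \<and>
      side_function s (range (g l))" ..
  from bchoice[OF g] obtain s where s: "\<forall>l\<in>A. antipodal_curve (g l) \<and> range (g l) = {x \<in> \<S>. proj x \<in> l} \<and>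
      side_function (s l) (range (g l))" ..
  have "lifted_arrangement A g s"
  proof
    show "\<exists>p. l \<inter> m = {p}" if "l \<in> A" "m \<in> A" "l \<noteq> m" for l m
      using meet[OF that] by blast
  qed (use fin s in auto)
  then show thesis by (rule that)
qed

lemma (in lifted_arrangement) crossings_eq_vertices: "crossings = vertices A"
proof -
  have "2 \<le> card (through A v) \<longleftrightarrow> (\<exists>l\<in>A. \<exists>m\<in>A. l \<noteq> m \<and> v \<in> l \<and> v \<in> m)" for v
  proof -
    have "finite (through A v)" using finite_A by (simp add: through_def)
    then have "\<not> card (through A v) \<le> Suc 0 \<longleftrightarrow> (\<exists>l\<in>through A v. \<exists>m\<in>through A v. l \<noteq> m)"
      using card_le_Suc0_iff_eq[of "through A v"] by auto
    then show ?thesis by (auto simp: through_def)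
  qed
  then show ?thesis by (auto simp: crossings_def vertices_def weight_def)
qed

lemma (in lifted_arrangement) wt_eq_weight: "wt A v = weight A v"
  by (simp add: wt_def weight_def through_def)

text \<open>All crossings off \<open>l\<close> coincide with \<open>u\<close>, of weight
  \<open>card A - 1\<close>, and each other line meets \<open>l\<close> in a double point of its
  own. With at least four lines the weight of \<open>u\<close> is not 2, so the two counts do not
  interfere.\<close>

lemma (in lifted_arrangement) pencil_imp_near_pencil:
  assumes n: "card A \<ge> 3" and l: "l \<in> A" and u: "u \<notin> l" "\<And>k. k \<in> A - {l} \<Longrightarrow> u \<in> k"
  shows "near_pencil A"
proof (cases "card A = 3")
  case False
  then have n4: "card A \<ge> 4" using n by simp
  have thu: "through A u = A - {l}" using u l by (auto simp: through_def)
  then have wu: "weight A u = card A - 1" using l finite_A by (simp add: weight_def)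
  have meet_u: "v = u" if "k \<in> A - {l}" "k' \<in> A - {l}" "k \<noteq> k'" "v \<in> k" "v \<in> k'" for v k k'
    using in_meet_eq_pt[of k k' v] in_meet_eq_pt[of k k' u] that u(2) by auto
  have on_l: "v \<in> l \<and> (\<exists>k\<in>A - {l}. v \<in> k)" if w: "weight A v \<ge> 2" "v \<noteq> u" for v
  proof -
    have "v \<in> crossings" using w(1) by (simp add: crossings_eq_vertices vertices_def)
    then obtain k k' where k: "k \<in> A" "k' \<in> A" "k \<noteq> k'" "v \<in> k" "v \<in> k'"
      by (auto simp: crossings_def)
    then have "k = l \<or> k' = l" using meet_u[of k k' v] w(2) by auto
    then show ?thesis using k by auto
  qed
  have w2: "weight A v = 2" if v: "k \<in> A - {l}" "v \<in> l" "v \<in> k" for v k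
  proof -
    have "through A v = {l, k}"
      using meet_u[of _ k v] v u(1) l by (auto simp: through_def)
    moreover have "l \<noteq> k" using v(1) by blast
    then have "card {l, k} = 2" by simp
    ultimately show ?thesis by (simp add: weight_def)
  qed
  have "{v. weight A v = card A - 1} = {u}"
  proof (intro equalityI subsetI)
    fix v assume v: "v \<in> {v. weight A v = card A - 1}"
    show "v \<in> {u}"
    proof (rule ccontr)
      assume "v \<notin> {u}"
      then have "v \<in> l \<and> (\<exists>k\<in>A - {l}. v \<in> k)" using on_l[of v] v n4 by simp
      then have "weight A v = 2" using w2 by blast
      then show False using v n4 by simp
    qed
  qed (use wu in simp)
  then have one: "num_points A (card A - 1) = 1" by (simp add: num_points_def)
  have "{v. weight A v = 2} = pt l ` (A - {l})"
  proof (intro equalityI subsetI)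
    fix v assume v: "v \<in> {v. weight A v = 2}"
    then have "v \<noteq> u" using wu n4 by auto
    then obtain k where "v \<in> l" "k \<in> A - {l}" "v \<in> k" using on_l[of v] v by auto
    then show "v \<in> pt l ` (A - {l})" using in_meet_eq_pt[of l k v] l by auto
  next
    fix v assume "v \<in> pt l ` (A - {l})"
    then obtain k where k: "k \<in> A - {l}" "v = pt l k" by blast
    then have "v \<in> l" "v \<in> k" using pt_in[of l k] l by auto
    then show "v \<in> {v. weight A v = 2}" using w2 k(1) by simp
  qed
  moreover have "inj_on (pt l) (A - {l})"
  proof (rule inj_onI, rule ccontr)
    fix k k' assume k: "k \<in> A - {l}" "k' \<in> A - {l}" "pt l k = pt l k'" "k \<noteq> k'"
    then have "pt l k \<in> k" "pt l k \<in> k'" "pt l k \<in> l" using pt_in[of l k] pt_in[of l k'] l by auto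
    then show False using meet_u[OF k(1,2,4)] u(1) by metis
  qed
  ultimately have "num_points A 2 = card A - 1"
    using l finite_A by (simp add: num_points_def card_image)
  then show ?thesis using one by (simp add: near_pencil_def)
qed (simp add: near_pencil_def)

text \<open>The Moebius values are 1 at the bottom, \<open>- 1\<close> at the lines, the weight
  minus 1 at the vertices, and at the top minus the sum of all others. The ranks are disjoint
  because at least three lines without a common point keep \<open>A\<close> apart from the
  singletons and from every \<open>through A v\<close>.\<close>

lemma characteristic_poly_eq:
  assumes A: "pseudoline_arrangement A"
  defines "b \<equiv> (\<Sum>v\<in>vertices A. int (weight A v) - 1)"
  shows "characteristic_poly A = [: int (card A) - 1 - b, b, - int (card A), 1 :]"
proof -
  obtain g s where "lifted_arrangement A g s" using pseudoline_arrangement_lift[OF A] .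
  then interpret lifted_arrangement A g s .
  have n: "card A \<ge> 3" "\<Inter>A = {}" using A by (auto simp: pseudoline_arrangement_def)
  let ?L = "intersection_lattice A"
  let ?S1 = "(\<lambda>l. {l}) ` A" and ?S2 = "through A ` vertices A"
  have L: "?L = {{}} \<union> ?S1 \<union> ?S2 \<union> {A}"
    by (auto simp: intersection_lattice_def vertices_def weight_def)
  have finV: "finite (vertices A)" using finite_crossings crossings_eq_vertices by simp
  have fin: "finite ?L" unfolding L using finite_A finV by simp
  have c2: "card (through A v) \<ge> 2" if "v \<in> vertices A" for v
    using that by (simp add: vertices_def weight_def)
  have finT: "finite (through A v)" "through A v \<subseteq> A" for v using finite_A by (auto simp: through_def)
  have notA: "through A v \<noteq> A" for v
  proof
    assume "through A v = A"
    then have "v \<in> \<Inter>A" by (auto simp: through_def)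
    then show False using n(2) by simp
  qed
  have not1: "through A v \<noteq> {l}" "through A v \<noteq> {}" if "v \<in> vertices A" for v l
    using c2[OF that] by auto
  have A1: "A \<noteq> {l}" "A \<noteq> {}" for l using n(1) by auto
  \<comment> \<open>A vertex is determined by two lines through it, so the elements of rank 2 form
    an antichain.\<close>
  have le_eq: "v = w" if vw: "v \<in> vertices A" "through A v \<subseteq> through A w" for v w
  proof -
    have "v \<in> crossings" using vw(1) by (simp add: crossings_eq_vertices)
    then obtain l m where "l \<in> A" "m \<in> A" "l \<noteq> m" "v \<in> l" "v \<in> m"
      by (auto simp: crossings_def)
    moreover from this have "w \<in> l" "w \<in> m" using vw(2) by (auto simp: through_def)
    ultimately show ?thesis using in_meet_eq_pt[of l m] by metis
  qed
  have inj2: "inj_on (through A) (vertices A)"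
    by (rule inj_onI) (use le_eq in blast)
  let ?mu = "moebius ?L {}"
  have mu: "?mu Y = (if Y = {} then 1 else - (\<Sum>Z\<in>{Z \<in> ?L. Z \<subset> Y}. ?mu Z))" if "Y \<in> ?L" for Y
    using that fin moebius.simps[of ?L "{}" Y] L by auto
  have mu0: "?mu {} = 1" using mu[of "{}"] L by simp
  have mu1: "?mu {l} = - 1" if l: "l \<in> A" for l
  proof -
    have "{Z \<in> ?L. Z \<subset> {l}} = {{}}" using L by auto
    then show ?thesis using mu[of "{l}"] L l mu0 by simp
  qed
  have s1: "(\<Sum>Z\<in>(\<lambda>l. {l}) ` T. ?mu Z) = - int (card T)" if "T \<subseteq> A" for T
  proof -
    have "(\<Sum>Z\<in>(\<lambda>l. {l}) ` T. ?mu Z) = (\<Sum>l\<in>T. ?mu {l})"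
      by (subst sum.reindex) (auto simp: inj_on_def)
    also have "\<dots> = (\<Sum>l\<in>T. - 1)" using mu1 that by (intro sum.cong) auto
    finally show ?thesis by simp
  qed
  have mu2: "?mu (through A v) = int (weight A v) - 1" if v: "v \<in> vertices A" for v
  proof -
    have "{Z \<in> ?L. Z \<subset> through A v} = insert {} ((\<lambda>l. {l}) ` through A v)"
    proof (intro equalityI subsetI)
      fix Z assume Z: "Z \<in> {Z \<in> ?L. Z \<subset> through A v}"
      then have "Z \<in> {{}} \<union> ?S1 \<union> ?S2 \<union> {A}" using L by blast
      then consider "Z = {}" | l where "Z = {l}" | w where "w \<in> vertices A" "Z = through A w" | "Z = A"
        by (elim UnE imageE) blast+
      then show "Z \<in> insert {} ((\<lambda>l. {l}) ` through A v)"
      proof cases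
        case 3
        then show ?thesis using Z le_eq[of w v] by auto
      next
        case 4
        then show ?thesis using Z finT(2) by blast
      qed (use Z in auto)
    next
      fix Z assume Z: "Z \<in> insert {} ((\<lambda>l. {l}) ` through A v)"
      then show "Z \<in> {Z \<in> ?L. Z \<subset> through A v}"
        using not1[OF v] finT(2)[of v] unfolding L by auto
    qed
    moreover have "through A v \<in> ?L" using v L by blast
    ultimately have "?mu (through A v) = - (\<Sum>Z\<in>insert {} ((\<lambda>l. {l}) ` through A v). ?mu Z)"
      using mu[of "through A v"] not1[OF v] by simp
    also have "\<dots> = - (1 - int (weight A v))"
      using finT s1[OF finT(2), of v] mu0 by (subst sum.insert) (auto simp: weight_def)
    finally show ?thesis by simp
  qed
  have s2: "(\<Sum>Z\<in>?S2. ?mu Z) = b"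
    unfolding b_def by (subst sum.reindex[OF inj2]) (simp add: mu2)
  have d: "{} \<notin> ?S1 \<union> ?S2" "?S1 \<inter> ?S2 = {}" "A \<notin> insert {} (?S1 \<union> ?S2)"
    by (metis (no_types, lifting) UnE imageE insert_not_empty not1(2),
      metis (no_types, lifting) disjoint_iff imageE not1(1),
      metis (no_types, lifting) A1 notA UnE imageE insertE)
  have finS: "finite ?S1" "finite ?S2" using finite_A finV by auto
  have L': "?L = insert A (insert {} (?S1 \<union> ?S2))" using L by auto
  have sum_L: "(\<Sum>X\<in>?L. f X) = f A + f {} + sum f ?S1 + sum f ?S2" for f :: "_ \<Rightarrow> 'c :: comm_monoid_add"
    unfolding L' using d finS by (simp add: sum.union_disjoint add.assoc)
  have "{Z \<in> ?L. Z \<subset> A} = insert {} (?S1 \<union> ?S2)"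
    unfolding L using d finT(2) by auto
  then have muA: "?mu A = - (1 - int (card A) + b)"
    using mu[of A] L A1 d finS s1[OF subset_refl] s2 mu0 by (simp add: sum.union_disjoint)
  have rk: "lattice_rank A {} = 0" "\<And>l. l \<in> A \<Longrightarrow> lattice_rank A {l} = 1"
    "\<And>v. v \<in> vertices A \<Longrightarrow> lattice_rank A (through A v) = 2" "lattice_rank A A = 3"
    using not1 notA[symmetric] A1 by (auto simp: lattice_rank_def)
  have "characteristic_poly A = monom (?mu A) 0 + monom 1 3 + (\<Sum>X\<in>?S1. monom (?mu X) 2) + (\<Sum>X\<in>?S2. monom (?mu X) 1)"
    unfolding characteristic_poly_def sum_L using rk mu0 by (intro arg_cong2[of _ _ _ _ "(+)"] sum.cong) auto
  also have "(\<Sum>X\<in>?S1. monom (?mu X) 2) = monom (- int (card A)) 2"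
    using s1[OF subset_refl] by (simp add: monom_sum[symmetric])
  also have "(\<Sum>X\<in>?S2. monom (?mu X) 1) = monom b 1"
    using s2 by (simp add: monom_sum[symmetric])
  finally show ?thesis
    unfolding muA by (simp add: monom_altdef numeral_eq_Suc algebra_simps)
qed

text \<open>The polynomial is \<open>(t - 1) (t\<^sup>2 - (n - 1) t + (b - n + 1))\<close>.\<close>

lemma real_roots_discriminant:
  fixes n b :: int
  assumes "only_real_roots [: n - 1 - b, b, - n, 1 :]"
  shows "4 * (b - n + 1) \<le> (n - 1)\<^sup>2"
proof (rule ccontr)
  assume neg: "\<not> ?thesis"
  \<comment> \<open>\<open>d\<close> is minus the discriminant of the quadratic factor, so
    \<open>z\<close> below is one of its two non-real roots.\<close>
  define d where "d = 4 * real_of_int (b - n + 1) - (real_of_int n - 1)\<^sup>2"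
  have "real_of_int (4 * (b - n + 1)) > real_of_int ((n - 1)\<^sup>2)" using neg by linarith
  then have d: "d > 0" by (simp add: d_def)
  define z where "z = Complex ((real_of_int n - 1) / 2) (sqrt d / 2)"
  have "z\<^sup>2 - (of_int n - 1) * z + of_int (b - n + 1) = 0"
  proof -
    have "Re (z\<^sup>2 - (of_int n - 1) * z + of_int (b - n + 1)) = 0"
      using d by (simp add: z_def power2_eq_square) (simp add: d_def field_simps power2_eq_square)
    moreover have "Im (z\<^sup>2 - (of_int n - 1) * z + of_int (b - n + 1)) = 0"
      by (simp add: z_def power2_eq_square field_simps)
    ultimately show ?thesis by (simp add: complex_eq_iff)
  qed
  moreover have "poly (map_poly of_int [: n - 1 - b, b, - n, 1 :]) z =
      (z - 1) * (z\<^sup>2 - (of_int n - 1) * z + of_int (b - n + 1))"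
    by (simp add: map_poly_pCons algebra_simps power2_eq_square)
  ultimately have "poly (map_poly of_int [: n - 1 - b, b, - n, 1 :]) z = 0" by simp
  then have "z \<in> \<real>" using assms by (simp add: only_real_roots_def)
  then show False using d by (simp add: complex_is_Real_iff z_def)
qed

lemma sum_by_weight:
  fixes w :: "'a \<Rightarrow> nat" and \<phi> :: "nat \<Rightarrow> nat"
  assumes "finite V" "\<And>v. v \<in> V \<Longrightarrow> w v \<in> {2..6}"
  defines "t \<equiv> \<lambda>i. card {v \<in> V. w v = i}"
  shows "(\<Sum>v\<in>V. \<phi> (w v)) = t 2 * \<phi> 2 + t 3 * \<phi> 3 + t 4 * \<phi> 4 + t 5 * \<phi> 5 + t 6 * \<phi> 6"
proof -
  have "(\<Sum>v\<in>V. \<phi> (w v)) = (\<Sum>i\<in>{2..6}. \<Sum>v\<in>{v \<in> V. w v = i}. \<phi> (w v))"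
    by (rule sum.group[symmetric]) (use assms in auto)
  also have "\<dots> = (\<Sum>i\<in>{2..6}. t i * \<phi> i)"
    by (intro sum.cong) (auto simp: t_def)
  also have "{2..6} = {2, 3, 4, 5, 6 :: nat}" by auto
  finally show ?thesis by simp
qed

text \<open>\<open>N\<close> stands for the square of \<open>n\<close>, which makes everything
  linear. \<open>faces\<close> gives equality in Melchior's inequality; \<open>low\<close> rests on
  \<open>roots\<close>, and \<open>high\<close> on \<open>doubles\<close> together with
  \<open>roots\<close>. Twice \<open>high\<close> minus \<open>low\<close> cancels both
  \<open>N\<close> and \<open>x6\<close>, which leaves the bound \<open>mid\<close>.\<close>

lemma weight_counts_bounds:
  fixes x2 x3 x4 x5 x6 b n N :: real
  assumes pairs: "2 * x2 + 6 * x3 + 12 * x4 + 20 * x5 + 30 * x6 = N - n"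
    and roots: "4 * (b - n + 1) \<le> N - 2 * n + 1"
    and b: "b = x2 + 2 * x3 + 3 * x4 + 4 * x5 + 5 * x6"
    and faces: "3 * (2 + 2 * b) = 4 * (2 * x2 + 3 * x3 + 4 * x4 + 5 * x5 + 6 * x6)"
    and doubles: "8 * x2 \<le> 2 + 2 * b"
    and nonneg: "0 \<le> x4" "0 \<le> x5" "0 \<le> x6"
  shows "(N - 10 * n + 25 + 44) / 16 \<le> x2" "x2 \<le> (N + 2 * n + 1) / 16"
    "(N - 22 * n + 185) / 24 \<le> x3" "x3 \<le> (N + 116 * n - 597) / 24"
    "x4 + x5 \<le> 3 / 2 * n - 17 / 2"
    "(N - 46 * n + 225) / 48 \<le> x6" "x6 \<le> (N + 2 * n - 47) / 48"
proof -
  have melchior: "x2 = 3 + x4 + 2 * x5 + 3 * x6"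
    using faces b by (simp add: algebra_simps)
  have t3: "3 * x3 = (N - n) / 2 - 3 - 7 * x4 - 12 * x5 - 18 * x6"
    using pairs melchior by (simp add: algebra_simps)
  have low: "x4 + 3 * x5 + 6 * x6 \<ge> (N - 10 * n + 21) / 8"
    using roots b t3 melchior by (simp add: field_simps)
  have high: "x4 + 2 * x5 + 3 * x6 \<le> (N + 2 * n - 47) / 16"
    using doubles roots melchior by (simp add: field_simps)
  show mid: "x4 + x5 \<le> 3 / 2 * n - 17 / 2"
    using low high by (simp add: field_simps)
  \<comment> \<open>The sum \<open>x4 + 2 * x5 + 3 * x6\<close> is at least half of the left side of
    \<open>low\<close>.\<close>
  show "(N - 10 * n + 25 + 44) / 16 \<le> x2"
    using melchior low nonneg by (simp add: field_simps)
  show "x2 \<le> (N + 2 * n + 1) / 16"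
    using melchior high by (simp add: field_simps)
  \<comment> \<open>Six times \<open>high\<close> absorbs the subtracted terms of \<open>t3\<close>
    except for one \<open>x4\<close>, which \<open>mid\<close> bounds.\<close>
  show "(N - 22 * n + 185) / 24 \<le> x3"
    using t3 high mid nonneg by (simp add: field_simps)
  \<comment> \<open>Three times \<open>low\<close> gives \<open>(N + 26 * n - 87) / 24\<close>. The
    stated bound exceeds this by \<open>5 / 2\<close> times \<open>3 / 2 * n - 17 / 2\<close>, which
    is nonnegative by \<open>mid\<close>.\<close>
  show "x3 \<le> (N + 116 * n - 597) / 24"
    using t3 low mid nonneg by (simp add: field_simps)
  \<comment> \<open>In \<open>low\<close> the part \<open>x4 + 3 * x5\<close> is at most
    \<open>3 * (x4 + x5)\<close>, to which \<open>mid\<close> applies.\<close>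
  show "(N - 46 * n + 225) / 48 \<le> x6"
    using low mid nonneg by (simp add: field_simps)
  show "x6 \<le> (N + 2 * n - 47) / 48"
    using high nonneg by (simp add: field_simps)
qed

theorem theorem4p11:
  fixes A :: "proj_plane set set" and n :: nat
  assumes "pseudoline_arrangement A"
    and "n = card A"
    and "simplicial A"
    and "\<not> near_pencil A"
    and "only_real_roots (characteristic_poly A)"
    and "multiplicity A \<le> 6"
  shows "((real n - 5)\<^sup>2 + 44) / 16 \<le> real (num_points A 2) \<and>
         real (num_points A 2) \<le> (real n + 1)\<^sup>2 / 16 \<and>
         ((real n)\<^sup>2 - 22 * real n + 185) / 24 \<le> real (num_points A 3) \<and>
         real (num_points A 3) \<le> ((real n)\<^sup>2 + 116 * real n - 597) / 24 \<and>
         real (num_points A 4) + real (num_points A 5) \<le> 3 / 2 * real n - 17 / 2 \<and>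
         ((real n)\<^sup>2 - 46 * real n + 225) / 48 \<le> real (num_points A 6) \<and>
         real (num_points A 6) \<le> ((real n)\<^sup>2 + 2 * real n - 47) / 48"
proof -
  obtain g s where "lifted_arrangement A g s" using pseudoline_arrangement_lift[OF assms(1)] .
  then interpret lifted_arrangement A g s .
  have n3: "card A \<ge> 3" using assms(1) by (simp add: pseudoline_arrangement_def)
  let ?V = "vertices A" and ?w = "weight A"
  have finV: "finite ?V" using finite_crossings crossings_eq_vertices by simp
  have tcard: "num_points A i = card {v \<in> ?V. ?w v = i}" if "i \<ge> 2" for i
    using that unfolding num_points_def vertices_def by (intro arg_cong[of _ _ card]) auto
  have w6: "?w v \<in> {2..6}" if v: "v \<in> ?V" for v
  proof -
    \<comment> \<open>\<open>Max\<close> bounds the weights only if its set is finite; this holds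
      because a weight is at most the number of lines.\<close>
    have "{j. num_points A j > 0} \<subseteq> {..card A}"
    proof
      fix j assume "j \<in> {j. num_points A j > 0}"
      then have "{v. ?w v = j} \<noteq> {}" unfolding num_points_def by (metis card.empty less_irrefl mem_Collect_eq)
      then obtain u where "?w u = j" by blast
      moreover have "?w u \<le> card A"
        unfolding weight_def through_def using finite_A by (intro card_mono) auto
      ultimately show "j \<in> {..card A}" by simp
    qed
    then have fin: "finite {j. num_points A j > 0}" using finite_subset by blast
    have w2: "?w v \<ge> 2" using v by (simp add: vertices_def)
    have "v \<in> {u \<in> ?V. ?w u = ?w v}" using v by simp
    then have "num_points A (?w v) > 0"
      unfolding tcard[OF w2] using finV by (metis (no_types, lifting) card_gt_0_iff empty_iff finite_subset mem_Collect_eq subsetI)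
    then have "?w v \<le> multiplicity A"
      unfolding multiplicity_def by (intro Max_ge[OF fin]) simp
    then show ?thesis using w2 assms(6) by simp
  qed
  define t where "t i = num_points A i" for i
  have by_weight: "(\<Sum>v\<in>?V. \<phi> (?w v)) = t 2 * \<phi> 2 + t 3 * \<phi> 3 + t 4 * \<phi> 4 + t 5 * \<phi> 5 + t 6 * \<phi> 6" for \<phi> :: "nat \<Rightarrow> nat"
    using sum_by_weight[OF finV w6, where \<phi> = \<phi>] by (simp add: t_def tcard)
  have wall3: "card (wall X) = 3" if "X \<in> topes A" for X
    by (rule simplicial_card_wall[OF assms(3) that])
  define b where "b = (\<Sum>v\<in>?V. ?w v - 1)"
  have b: "b = t 2 + 2 * t 3 + 3 * t 4 + 4 * t 5 + 5 * t 6"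
    unfolding b_def using by_weight[of "\<lambda>i. i - 1"] by simp
  have "A \<noteq> {}" using n3 by auto
  then have topes: "card (topes A) = 2 + 2 * b"
    using card_topes[OF subset_refl] by (simp add: b_def crossings_eq_vertices wt_eq_weight)
  have faces: "3 * (2 + 2 * b) = 4 * (2 * t 2 + 3 * t 3 + 4 * t 4 + 5 * t 5 + 6 * t 6)"
    using sum_card_wall wall3 n3 topes by_weight[of "\<lambda>i. i"] by (simp add: crossings_eq_vertices wt_eq_weight)
  have pairs: "2 * t 2 + 6 * t 3 + 12 * t 4 + 20 * t 5 + 30 * t 6 = n * (n - 1)"
    using sum_pairs by_weight[of "\<lambda>i. i * (i - 1)"] assms(2) by (simp add: crossings_eq_vertices wt_eq_weight)
  have doubles: "8 * t 2 \<le> 2 + 2 * b"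
  proof -
    have no_pencil: "\<not> (\<exists>l\<in>A. \<exists>u. u \<notin> l \<and> (\<forall>k\<in>A - {l}. u \<in> k))"
      using pencil_imp_near_pencil[OF n3] assms(4) by blast
    have "8 * card {v \<in> crossings. wt A v = 2} \<le> card (topes A)"
      by (rule double_points_bound[OF _ n3 no_pencil]) (rule wall3)
    then show ?thesis
      by (simp add: topes t_def tcard crossings_eq_vertices wt_eq_weight)
  qed
  have "(\<Sum>v\<in>?V. int (?w v) - 1) = int b"
    unfolding b_def of_nat_sum
  proof (rule sum.cong[OF refl])
    fix v assume "v \<in> ?V"
    then have "1 \<le> ?w v" using w6[of v] by simp
    then show "int (?w v) - 1 = int (?w v - 1)" by (simp only: of_nat_diff of_nat_1)
  qed
  then have roots: "4 * (int b - int n + 1) \<le> (int n - 1)\<^sup>2"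
    using real_roots_discriminant[of "int n" "int b"] characteristic_poly_eq[OF assms(1)] assms(2,5) by simp
  define N where "N = (real n)\<^sup>2"
  have "real (n * (n - 1)) = N - real n"
    using n3 assms(2) by (simp add: N_def of_nat_diff power2_eq_square algebra_simps)
  then have pairs': "2 * real (t 2) + 6 * real (t 3) + 12 * real (t 4) + 20 * real (t 5) + 30 * real (t 6) = N - real n"
    using arg_cong[OF pairs, of real] by simp
  have "real_of_int (4 * (int b - int n + 1)) \<le> real_of_int ((int n - 1)\<^sup>2)"
    using roots by linarith
  then have roots': "4 * (real b - real n + 1) \<le> N - 2 * real n + 1"
    by (simp add: N_def power2_eq_square algebra_simps)
  have b': "real b = real (t 2) + 2 * real (t 3) + 3 * real (t 4) + 4 * real (t 5) + 5 * real (t 6)"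
    using arg_cong[OF b, of real] by simp
  have faces': "3 * (2 + 2 * real b) = 4 * (2 * real (t 2) + 3 * real (t 3) + 4 * real (t 4) + 5 * real (t 5) + 6 * real (t 6))"
    using arg_cong[OF faces, of real] by simp
  have doubles': "8 * real (t 2) \<le> 2 + 2 * real b"
    using doubles by linarith
  have sq: "(real n - 5)\<^sup>2 = N - 10 * real n + 25" "(real n + 1)\<^sup>2 = N + 2 * real n + 1"
    by (simp_all add: N_def power2_eq_square algebra_simps)
  have nonneg: "real (t i) \<ge> 0" for i by simp
  show ?thesis
    unfolding sq N_def[symmetric] t_def[symmetric]
    using weight_counts_bounds[OF pairs' roots' b' faces' doubles' nonneg nonneg nonneg] by blast
qed

end
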